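(* Let $\mathbb X$ be $\mathbb S^d$, $\mathbb R^d$, or $\mathbb H^d$, and let $\{S_{W_1\dots W_n}\}_{n\ge 1}$ be a random sequence of polarizations on $\mathbb X$ defined by a sequence of independent random variables $\{W_i\}_{i\ge1}$ on $\Omega$. If $$\sum_{i=1}^{\infty}P\bigl(d(\sigma_{W_i}a_i,b_i)<\rho\bigr)=\infty$$ for every radius $\rho>0$ and every pair of bounded sequences $\{a_i\}$, $\{b_i\}$ in $\mathbb X$ with $d(b_i,o)\ge d(a_i,o)+2\rho$ for all $i$, then $$P\left(\lim_{n\to\infty}\|S_{W_1\dots W_n}f-f^*\|_\infty=0\quad \forall f\in \mathcal C_c^+(\mathbb X)\right)=1 .$$
   Context: $\mathbb X$ is the sphere $\mathbb S^d$, Euclidean space $\mathbb R^d$, or standard hyperbolic space $\mathbb H^d$, with its uniform Riemannian distance $d(x,y)$, Riemannian volume $m$, and a distinguished point $o\in\mathbb X$ (the origin). $\mathcal C_c^+(\mathbb X)$ is the space of nonnegative continuous compactly supported functions on $\mathbb X$. For $A\subset\mathbb X$ of finite volume, $A^*$ is the open ball centered at $o$ with $m(A^* )=m(A)$ (if $\mathbb X=\mathbb S^d$ and $m(A)=m(\mathbb S^d)$, take $A^*=\mathbb S^d$). For nonnegative measurable $f$ whose level sets $\{f>t\}$, $t>0$, have finite volume, the symmetric decreasing rearrangement is $f^*(x)=\int_0^\infty \mathbf 1_{\{f>t\}^*}(x)\,dt$. A reflection of $\mathbb X$ is an isometry $\sigma$ with $\sigma^2=I$ exchanging two complementary half-spaces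 such that $d(x,\sigma y)\ge d(x,y)$ whenever $x,y$ lie in the same half-space. For distinct $x,y$ there is a unique reflection mapping $x$ to $y$. Fix normal (geodesic polar) coordinates $x=(r,u)$ centered at $o$, with $r=d(x,o)$ and $u\in\mathbb S^{d-1}$, and let $\Omega=[0,\infty)\times\mathbb S^{d-1}$. For $\omega=(r,u)\in\Omega$ with $r>0$ (and $r\le\pi$ if $\mathbb X=\mathbb S^d$), $\sigma_\omega$ is the reflection mapping $o$ to the point with normal coordinates $(r,u)$. Writing $\bar x=\sigma_\omega x$, $H^+=\{x:d(x,o)\le d(\bar x,o)\}$, $H^-=\{x:d(x,o)\ge d(\bar x,o)\}$, the polarization $S_\omega f$ is $S_\omega f(x)=\max\{f(x),f(\bar x)\}$ for $x\in H^+$ and $S_\omega f(x)=\min\{f(x),f(\bar x)\}$ for $x\in H^-$. Set $S_{\omega_1\dots\omega_n}=S_{\omega_n}\circ\dots\circ S_{\omega_1}$. A random variable $W=(R,U)$ on $\Omega$ used to define a random polarization $S_W$ is distributed according to a Borel probability measure $\mu$ on $\Omega$ with $\mu(R=0)=0$, and, if $\mathbb X=\mathbb S^d$, also $\mu(R>\pi)=0$. For a sequence of independent $W_i$ with distributions $\mu_i$, $P$ is the product measure on $\Omega^{\mathbb N}$. *)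

theory Defs
  imports "HOL-Probability.Probability"
begin

text \<open>The three spaces are realised as hypersurfaces of \<open>\<real>\<^sup>d \<times> \<real>\<close> with \<open>d = CARD('n) \<ge> 1\<close>:
  the unit sphere, the affine hyperplane \<open>\<real>\<^sup>d \<times> {1}\<close> (an isometric copy of \<open>\<real>\<^sup>d\<close>),
  and the upper sheet of the hyperboloid \<open>t\<^sup>2 - \<bar>v\<bar>\<^sup>2 = 1\<close>. In each case the topology of the
  distance \<open>sdist\<close> is the subspace topology, and the carrier is closed.\<close>

datatype space_form = Sph | Euc | Hyp

type_synonym 'n point = "(real^'n) \<times> real"

definition carr :: "space_form \<Rightarrow> 'n::finite point set" where
  "carr X = (case X of
      Sph \<Rightarrow> {x. norm x = 1}
    | Euc \<Rightarrow> {(v, t). t = 1}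
    | Hyp \<Rightarrow> {(v, t). t > 0 \<and> t\<^sup>2 - (norm v)\<^sup>2 = 1})"

definition sdist :: "space_form \<Rightarrow> 'n::finite point \<Rightarrow> 'n point \<Rightarrow> real" where
  "sdist X x y = (case X of
      Sph \<Rightarrow> arccos (x \<bullet> y)
    | Euc \<Rightarrow> dist x y
    | Hyp \<Rightarrow> arcosh (snd x * snd y - fst x \<bullet> fst y))"

definition orig :: "'n::finite point" where
  "orig = (0, 1)"

definition sball :: "space_form \<Rightarrow> 'n::finite point \<Rightarrow> real \<Rightarrow> 'n point set" where
  "sball X x r = {y \<in> carr X. sdist X x y < r}"

text \<open>Geodesic polar coordinates \<open>(r, u)\<close>, \<open>u \<in> \<S>\<^sup>d\<^sup>-\<^sup>1\<close>, at the origin.\<close>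

definition polar_point :: "space_form \<Rightarrow> real \<times> (real^'n) \<Rightarrow> 'n::finite point" where
  "polar_point X = (\<lambda>(r, u). case X of
      Sph \<Rightarrow> (sin r *\<^sub>R u, cos r)
    | Euc \<Rightarrow> (r *\<^sub>R u, 1)
    | Hyp \<Rightarrow> (sinh r *\<^sub>R u, cosh r))"

definition Omega :: "(real \<times> (real^'n::finite)) set" where
  "Omega = {0..} \<times> sphere 0 1"

text \<open>Riemannian volume, computed in the charts given by the projection \<open>(v, t) \<mapsto> v\<close>. Each
  carrier consists of graphs \<open>t = s * graph_height v\<close>, with \<open>s = 1\<close>, or \<open>s = \<plusminus>1\<close> for the sphere (minus its
  equator, a null set). The metric in these charts is \<open>g = I + v v\<^sup>T / (1 - \<bar>v\<bar>\<^sup>2)\<close> on the sphere,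
  \<open>g = I\<close> on Euclidean space and \<open>g = I - v v\<^sup>T / (1 + \<bar>v\<bar>\<^sup>2)\<close> on hyperbolic space, so in all cases
  \<open>sqrt (det g) = 1 / graph_height v\<close>.\<close>

definition graph_height :: "space_form \<Rightarrow> (real^'n::finite) \<Rightarrow> real" where
  "graph_height X v = (case X of
      Sph \<Rightarrow> sqrt (1 - (norm v)\<^sup>2)
    | Euc \<Rightarrow> 1
    | Hyp \<Rightarrow> sqrt (1 + (norm v)\<^sup>2))"

definition chart_dom :: "space_form \<Rightarrow> (real^'n::finite) set" where
  "chart_dom X = (if X = Sph then ball 0 1 else UNIV)"

definition sheets :: "space_form \<Rightarrow> real set" where
  "sheets X = (if X = Sph then {1, -1} else {1})"

definition vol :: "space_form \<Rightarrow> 'n::finite point measure" where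
  "vol X = distr
     (density (lborel \<Otimes>\<^sub>M count_space (sheets X))
       (\<lambda>(v, s). ennreal (indicator (chart_dom X) v / graph_height X v)))
     borel (\<lambda>(v, s). (v, s * graph_height X v))"

text \<open>For \<open>vol X A = 0\<close> the ball of radius \<open>0\<close> is the empty set.\<close>

definition set_star :: "space_form \<Rightarrow> 'n::finite point set \<Rightarrow> 'n point set" where
  "set_star X A =
     (if X = Sph \<and> emeasure (vol X) A = emeasure (vol X) (carr X :: 'n point set) then carr X
      else (THE B. (\<exists>r. B = sball X orig r) \<and> emeasure (vol X) B = emeasure (vol X) A))"

definition fun_star :: "space_form \<Rightarrow> ('n::finite point \<Rightarrow> real) \<Rightarrow> 'n point \<Rightarrow> real" where
  "fun_star X f x =
     (LINT t:{0<..}|lborel. indicator (set_star X {y \<in> carr X. f y > t}) x)"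

text \<open>In all three models, the closed half-spaces bounded by totally geodesic hypersurfaces are
  the intersections of the carrier with linear half-spaces whose bounding hyperplane properly
  divides the carrier. For \<open>Euc\<close>, \<open>a = (a', b)\<close> gives \<open>{v. a' \<bullet> v + b \<ge> 0}\<close>, and proper division
  forces \<open>a' \<noteq> 0\<close>.\<close>

definition complementary_half_spaces ::
    "space_form \<Rightarrow> 'n::finite point set \<Rightarrow> 'n point set \<Rightarrow> bool" where
  "complementary_half_spaces X H H' \<longleftrightarrow>
     (\<exists>a. H = {x \<in> carr X. a \<bullet> x \<ge> 0} \<and> H' = {x \<in> carr X. a \<bullet> x \<le> 0} \<and>
          (\<exists>x\<in>carr X. a \<bullet> x > 0) \<and> (\<exists>x\<in>carr X. a \<bullet> x < 0))"

text \<open>Reflections are extensional functions on the carrier, so that the reflection exchanging two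
  given distinct points is unique as a HOL function.\<close>

definition is_reflection :: "space_form \<Rightarrow> ('n::finite point \<Rightarrow> 'n point) \<Rightarrow> bool" where
  "is_reflection X \<sigma> \<longleftrightarrow>
     \<sigma> \<in> carr X \<rightarrow>\<^sub>E carr X \<and>
     (\<forall>x\<in>carr X. \<forall>y\<in>carr X. sdist X (\<sigma> x) (\<sigma> y) = sdist X x y) \<and>
     (\<forall>x\<in>carr X. \<sigma> (\<sigma> x) = x) \<and>
     (\<exists>H H'. complementary_half_spaces X H H' \<and> \<sigma> ` H = H' \<and> \<sigma> ` H' = H \<and>
        (\<forall>x y. (x \<in> H \<and> y \<in> H) \<or> (x \<in> H' \<and> y \<in> H') \<longrightarrow> sdist X x (\<sigma> y) \<ge> sdist X x y))"

text \<open>Meaningful when \<open>polar_point X \<omega> \<noteq> orig\<close>, in particular for \<open>r > 0\<close> and, on the sphere,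
  \<open>r \<le> \<pi>\<close>.\<close>

definition refl_at :: "space_form \<Rightarrow> real \<times> (real^'n) \<Rightarrow> 'n::finite point \<Rightarrow> 'n point" where
  "refl_at X \<omega> = (THE \<sigma>. is_reflection X \<sigma> \<and> \<sigma> orig = polar_point X \<omega>)"

text \<open>Where \<open>d(x,o) = d(\<sigma>x,o)\<close>, \<open>x\<close> is fixed by the reflection, so both clauses of the polarization
  agree there.\<close>

definition polarize ::
    "space_form \<Rightarrow> real \<times> (real^'n) \<Rightarrow> ('n::finite point \<Rightarrow> real) \<Rightarrow> 'n point \<Rightarrow> real" where
  "polarize X \<omega> f x =
     (if sdist X x orig \<le> sdist X (refl_at X \<omega> x) orig
      then max (f x) (f (refl_at X \<omega> x)) else min (f x) (f (refl_at X \<omega> x)))"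

text \<open>With indices starting at \<open>0\<close>: \<open>polarize_seq X w n f = S\<^bsub>w (n-1)\<^esub> (\<dots> (S\<^bsub>w 0\<^esub> f))\<close>.\<close>

primrec polarize_seq ::
    "space_form \<Rightarrow> (nat \<Rightarrow> real \<times> (real^'n)) \<Rightarrow> nat \<Rightarrow>
     ('n::finite point \<Rightarrow> real) \<Rightarrow> 'n point \<Rightarrow> real" where
  "polarize_seq X w 0 f = f"
| "polarize_seq X w (Suc n) f = polarize X (w n) (polarize_seq X w n f)"

text \<open>Only the values on the carrier matter. The carrier is closed, so the closure is the support.\<close>

definition Cc_plus :: "space_form \<Rightarrow> ('n::finite point \<Rightarrow> real) set" where
  "Cc_plus X = {f. continuous_on (carr X) f \<and> (\<forall>x\<in>carr X. f x \<ge> 0) \<and>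
                   compact (closure {x \<in> carr X. f x \<noteq> 0})}"

definition sup_norm :: "space_form \<Rightarrow> ('n::finite point \<Rightarrow> real) \<Rightarrow> real" where
  "sup_norm X g = (SUP x\<in>carr X. \<bar>g x\<bar>)"

definition bounded_seq :: "space_form \<Rightarrow> (nat \<Rightarrow> 'n::finite point) \<Rightarrow> bool" where
  "bounded_seq X a \<longleftrightarrow> (\<forall>i. a i \<in> carr X) \<and> (\<exists>B. \<forall>i. sdist X (a i) orig \<le> B)"

definition polarization_law ::
    "space_form \<Rightarrow> (real \<times> (real^'n::finite)) measure \<Rightarrow> bool" where
  "polarization_law X \<mu> \<longleftrightarrow>
     prob_space \<mu> \<and> sets \<mu> = sets (restrict_space borel Omega) \<and>
     emeasure \<mu> {\<omega> \<in> Omega. fst \<omega> = 0} = 0 \<and>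
     (X = Sph \<longrightarrow> emeasure \<mu> {\<omega> \<in> Omega. fst \<omega> > pi} = 0)"

end

theory Submission
  imports Defs
begin

text \<open>Polarization does not increase the first moment \<open>\<integral> f(x) d(x,o) dm\<close>, and it decreases it by a
  fixed amount whenever the reflection carries a point \<open>a\<close> close to a point \<open>b\<close> that lies farther
  from the origin and at which \<open>f\<close> is larger. A function that is equimeasurable with \<open>f\<close> but not
  uniformly close to \<open>f\<^sup>*\<close> admits such a pair, because two sets of the same volume, one of them a
  ball, cannot strictly contain each other. Let \<open>q\<^sub>n\<close> be the infimum over all such pairs of the
  probability that the \<open>n\<close>-th reflection does this; applying the hypothesis to almost minimizing
  pairs gives \<open>\<Sum> q\<^sub>n = \<infinity>\<close>. The expected first moment drops by at least a constant times
  \<open>q\<^sub>n P(disorder at time n)\<close> at each step and is finite, so almost surely disorder is absent at some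
  time, and distances to \<open>f\<^sup>*\<close> do not increase afterwards since \<open>S f\<^sup>* = f\<^sup>*\<close>.

  The three models are treated uniformly through the form \<open>v \<bullet> v' + \<kappa> t t'\<close> with \<open>\<kappa> = 1, 0, -1\<close>:
  distance is an increasing function of the form on \<open>x - y\<close>, and every reflection is the restriction
  of a linear involution of the ambient space. Volume is, up to a constant, Lebesgue measure of the
  cone over a set, hence invariant under these involutions.\<close>

section \<open>Quadratic-form models and reflections\<close>

text \<open>The pair at which disorder shows depends on the earlier reflections, whereas the
  hypothesis speaks of fixed sequences. This is why the infimum runs over every pair in a bounded
  region: the next reflection is independent of the past, so whatever pair the past has produced is
  hit with at least the infimal probability. The drop of the moment must have a size that does not
  depend on n. It does because all iterates share the support radius and the modulus of continuity
  of \<open>f\<close>; both are preserved since, for two points on opposite sides of a mirror,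
  reflecting one of them does not increase their distance. The exceptional null set depends on
  \<open>f\<close> and on the tolerance. Polarization and rearrangement are both contractions for
  the supremum norm, so a countable family that approximates every \<open>f\<close> uniformly is
  enough. The reflections of the statement are given by a definite description through half-spaces,
  so no formula for them is available until uniqueness has been proved; for this the half-spaces of
  an arbitrary reflection have to be identified first.\<close>

definition kap :: "space_form \<Rightarrow> real" where
  "kap X = (case X of Sph \<Rightarrow> 1 | Euc \<Rightarrow> 0 | Hyp \<Rightarrow> -1)"

definition bil :: "space_form \<Rightarrow> 'n::finite point \<Rightarrow> 'n point \<Rightarrow> real" where
  "bil X x y = fst x \<bullet> fst y + kap X * (snd x * snd y)"

definition qd :: "space_form \<Rightarrow> 'n::finite point \<Rightarrow> 'n point \<Rightarrow> real" where
  "qd X x y = bil X (x - y) (x - y)"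

text \<open>On the sphere and the hyperboloid \<open>bil X x x\<close> is 1 or -1, so
  \<open>qd\<close> is \<open>2 - 2 * bil X x y\<close> or \<open>-2 - 2 * bil X x y\<close>;
  solving for \<open>bil X x y\<close> gives the arguments of \<open>arccos\<close> and
  \<open>arcosh\<close>.\<close>

definition dfun :: "space_form \<Rightarrow> real \<Rightarrow> real" where
  "dfun X q = (case X of Sph \<Rightarrow> arccos (1 - q / 2) | Euc \<Rightarrow> sqrt q | Hyp \<Rightarrow> arcosh (1 + q / 2))"

lemma bil_simps:
  "bil X (x + y) z = bil X x z + bil X y z" "bil X (x - y) z = bil X x z - bil X y z"
  "bil X (c *\<^sub>R x) z = c * bil X x z"
  "bil X z (x + y) = bil X z x + bil X z y" "bil X z (x - y) = bil X z x - bil X z y"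
  "bil X z (c *\<^sub>R x) = c * bil X z x"
  by (simp_all add: bil_def inner_simps algebra_simps)

lemma bil_commute: "bil X x y = bil X y x"
  by (simp add: bil_def inner_commute mult.commute)

lemma carr_iff:
  "x \<in> carr Sph \<longleftrightarrow> bil Sph x x = 1"
  "x \<in> carr Euc \<longleftrightarrow> snd x = 1"
  "x \<in> carr Hyp \<longleftrightarrow> bil Hyp x x = -1 \<and> snd x > 0"
proof -
  show "x \<in> carr Sph \<longleftrightarrow> bil Sph x x = 1"
    by (simp add: carr_def bil_def kap_def norm_eq_1 inner_prod_def)
  show "x \<in> carr Euc \<longleftrightarrow> snd x = 1"
    by (simp add: carr_def case_prod_beta)
  show "x \<in> carr Hyp \<longleftrightarrow> bil Hyp x x = -1 \<and> snd x > 0"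
    by (simp add: carr_def bil_def kap_def case_prod_beta dot_square_norm power2_eq_square[of "snd x"])
       argo
qed

lemma bil_expand:
  "bil X (x - l *\<^sub>R c) (w - m *\<^sub>R c)
    = bil X x w - m * bil X x c - l * bil X w c + l * m * bil X c c"
  by (simp add: bil_simps bil_commute[of X c w] algebra_simps)

lemma bil_carr_const:
  assumes "x \<in> carr X" "y \<in> carr X"
  shows "X = Euc \<and> snd x = 1 \<and> snd y = 1 \<or> X \<noteq> Euc \<and> bil X x x = bil X y y"
  using assms by (cases X) (auto simp: carr_iff)

lemma closed_carr: "closed (carr X)"
proof (cases X)
  case Sph
  have "carr Sph = {x :: 'a point. bil Sph x x = 1}" by (auto simp: carr_iff)
  then show ?thesis unfolding Sph bil_def by (auto intro!: closed_Collect_eq continuous_intros)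
next
  case Euc
  have "carr Euc = {x :: 'a point. snd x = 1}" by (auto simp: carr_iff)
  then show ?thesis unfolding Euc by (auto intro!: closed_Collect_eq continuous_intros)
next
  case Hyp
  \<comment> \<open>On the quadric the height cannot vanish, so the open condition on it may be
    replaced by a closed one.\<close>
  have "snd x > 0 \<longleftrightarrow> snd x \<ge> 0" if "bil Hyp x x = -1" for x :: "'a point"
    using that inner_ge_zero[of "fst x"] by (cases "snd x = 0") (auto simp: bil_def kap_def)
  then have "carr Hyp = {x :: 'a point. bil Hyp x x = -1} \<inter> {x. snd x \<ge> 0}" by (auto simp: carr_iff)
  then show ?thesis unfolding Hyp bil_def
    by (auto intro!: closed_Int closed_Collect_eq closed_Collect_le continuous_intros)
qed

lemma orig_carr [simp]: "orig \<in> carr X"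
  by (cases X) (auto simp: orig_def carr_def norm_Pair)

lemma qd_eq: "qd X x y = bil X x x + bil X y y - 2 * bil X x y"
  by (simp add: qd_def bil_simps bil_commute[of X y x])

lemma qd_self [simp]: "qd X x x = 0"
  by (simp add: qd_eq)

text \<open>The difference of two points of the sheet is spacelike: the differences of the squared
  heights and of the squared norms agree, and the heights exceed the norms, so the heights differ by
  less than \<open>norm (v - w)\<close>.\<close>

lemma qd_pos_Hyp:
  fixes x y :: "'n::finite point"
  assumes x: "x \<in> carr Hyp" and y: "y \<in> carr Hyp" and ne: "x \<noteq> y"
  shows "qd Hyp x y > 0"
proof -
  obtain v t w s where xy: "x = (v, t)" "y = (w, s)" by (cases x; cases y) auto
  have t: "t > 0" "t\<^sup>2 = 1 + (norm v)\<^sup>2" and s: "s > 0" "s\<^sup>2 = 1 + (norm w)\<^sup>2"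
    using x y by (auto simp: carr_def xy)
  have tv: "norm v < t" "norm w < s"
    by (auto intro!: power2_less_imp_less[of _ t] power2_less_imp_less[of _ s] simp: t s less_imp_le)
  have vw: "v \<noteq> w"
  proof
    assume "v = w" then have "t\<^sup>2 = s\<^sup>2" by (simp add: t s)
    then have "t = s" using t(1) s(1) by (simp only: power2_eq_iff_nonneg less_imp_le)
    with \<open>v = w\<close> ne xy show False by simp
  qed
  have "(t - s) * (t + s) = (norm v - norm w) * (norm v + norm w)"
    using t s by (simp add: algebra_simps power2_eq_square)
  then have "\<bar>t - s\<bar> * (t + s) = \<bar>norm v - norm w\<bar> * (norm v + norm w)"
    using t(1) s(1) by (metis abs_mult abs_of_nonneg add_nonneg_nonneg less_imp_le norm_ge_zero)
  also have "\<dots> \<le> norm (v - w) * (norm v + norm w)"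
    by (intro mult_right_mono norm_triangle_ineq3) auto
  also have "\<dots> < norm (v - w) * (t + s)"
    using vw tv by (intro mult_strict_left_mono) auto
  finally have "\<bar>t - s\<bar> < norm (v - w)" using t(1) s(1) by simp
  then have "\<bar>t - s\<bar>\<^sup>2 < (norm (v - w))\<^sup>2" by (intro power_strict_mono) auto
  then show ?thesis by (simp add: qd_def bil_def kap_def xy dot_square_norm power2_eq_square[of "t - s"])
qed

lemma qd_pos:
  assumes "x \<in> carr X" "y \<in> carr X" "x \<noteq> y"
  shows "qd X x y > 0"
proof (cases "X = Hyp")
  case True then show ?thesis using qd_pos_Hyp[of x y] assms by simp
next
  case False
  have "qd X x y = (norm (x - y))\<^sup>2"
    using False assms
    by (cases X) (simp_all add: qd_def bil_def kap_def carr_iff power2_norm_eq_inner inner_prod_def)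
  then show ?thesis using assms by simp
qed

lemma qd_ge_0: "x \<in> carr X \<Longrightarrow> y \<in> carr X \<Longrightarrow> qd X x y \<ge> 0"
  using qd_pos[of x X y] by (cases "x = y") auto

lemma qd_le_4: "x \<in> carr Sph \<Longrightarrow> y \<in> carr Sph \<Longrightarrow> qd Sph x y \<le> 4"
proof -
  assume *: "x \<in> carr Sph" "y \<in> carr Sph"
  have "0 \<le> bil Sph (x + y) (x + y)" by (simp add: bil_def kap_def)
  with * show ?thesis by (auto simp: bil_simps carr_iff qd_eq bil_commute[of _ y x])
qed

lemma sdist_qd:
  assumes "x \<in> carr X" "y \<in> carr X"
  shows "sdist X x y = dfun X (qd X x y)"
proof (cases X)
  case Sph
  then show ?thesis using assms
    by (simp add: sdist_def dfun_def qd_eq carr_iff diff_divide_distrib)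
       (simp add: bil_def kap_def inner_prod_def)
next
  case Euc
  then show ?thesis using assms
    by (cases x; cases y) (auto simp: sdist_def dfun_def qd_def carr_iff bil_def kap_def dist_norm norm_Pair power2_norm_eq_inner[symmetric])
next
  case Hyp
  then show ?thesis using assms
    by (simp add: sdist_def dfun_def qd_eq carr_iff diff_divide_distrib)
       (simp add: bil_def kap_def inner_prod_def)
qed

lemma dfun_strict_mono:
  assumes "0 \<le> q" "q < q'" "X = Sph \<Longrightarrow> q' \<le> 4"
  shows "dfun X q < dfun X q'"
  using assms by (cases X) (auto simp: dfun_def arccos_less_arccos arcosh_less_iff_real)

text \<open>Turns comparisons of distances into comparisons of quadratic polynomials; the half-space
  property of reflections, and later the choice between maximum and minimum, are decided in this
  form.\<close>

lemma sdist_le_iff: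
  assumes "x \<in> carr X" "y \<in> carr X" "x' \<in> carr X" "y' \<in> carr X"
  shows "sdist X x y \<le> sdist X x' y' \<longleftrightarrow> qd X x y \<le> qd X x' y'"
proof -
  have "dfun X (qd X x y) < dfun X (qd X x' y')" if "qd X x y < qd X x' y'"
    using that assms by (intro dfun_strict_mono) (auto simp: qd_ge_0 qd_le_4)
  moreover have "dfun X (qd X x' y') < dfun X (qd X x y)" if "qd X x' y' < qd X x y"
    using that assms by (intro dfun_strict_mono) (auto simp: qd_ge_0 qd_le_4)
  ultimately show ?thesis
    using assms by (cases "qd X x y" "qd X x' y'" rule: linorder_cases) (simp_all add: sdist_qd)
qed

lemma sdist_commute: "sdist X x y = sdist X y x"
  by (cases X) (auto simp: sdist_def inner_commute dist_commute mult.commute)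

lemma sdist_self [simp]: "x \<in> carr X \<Longrightarrow> sdist X x x = 0"
  by (simp add: sdist_qd dfun_def split: space_form.splits)

lemma sdist_pos: "x \<in> carr X \<Longrightarrow> y \<in> carr X \<Longrightarrow> x \<noteq> y \<Longrightarrow> sdist X x y > 0"
  using sdist_le_iff[of x X y x x] qd_pos[of x X y] by fastforce

lemma sdist_nonneg: "x \<in> carr X \<Longrightarrow> y \<in> carr X \<Longrightarrow> sdist X x y \<ge> 0"
  using sdist_pos[of x X y] by (cases "x = y") auto

text \<open>For \<open>y = z\<close> division by \<open>0\<close> makes \<open>rfl X y z\<close> the identity. The offset in \<open>lam\<close>
  vanishes on the sphere and on the hyperboloid; in Euclidean space it turns the affine reflection
  into a linear map of the ambient space.\<close>

definition lam :: "space_form \<Rightarrow> 'n::finite point \<Rightarrow> 'n point \<Rightarrow> 'n point \<Rightarrow> real" where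
  "lam X y z x = (2 * bil X x (z - y) - (bil X z z - bil X y y) * snd x) / qd X z y"

definition rfl :: "space_form \<Rightarrow> 'n::finite point \<Rightarrow> 'n point \<Rightarrow> 'n point \<Rightarrow> 'n point" where
  "rfl X y z x = x - lam X y z x *\<^sub>R (z - y)"

lemma lam_simps:
  "lam X y z (x + x') = lam X y z x + lam X y z x'"
  "lam X y z (x - x') = lam X y z x - lam X y z x'"
  "lam X y z (c *\<^sub>R x) = c * lam X y z x"
  by (simp_all add: lam_def bil_simps algebra_simps add_divide_distrib diff_divide_distrib)

lemma linear_rfl: "linear (rfl X y z)"
  by (intro linearI) (simp_all add: rfl_def lam_simps algebra_simps)

lemma rfl_same [simp]: "rfl X y y x = x"
  by (simp add: rfl_def)

context
  fixes X :: space_form and y z :: "'n::finite point"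
  assumes y: "y \<in> carr X" and z: "z \<in> carr X"
begin

text \<open>Either the model is Euclidean and \<open>snd\<close> is 1 throughout, or the factor in
  front vanishes. Hence the offset cancels in differences of \<open>lam\<close> on the
  carrier.\<close>

lemma off_diff:
  assumes "x \<in> carr X" "x' \<in> carr X"
  shows "(bil X z z - bil X y y) * snd x = (bil X z z - bil X y y) * snd x'"
  using bil_carr_const[OF y z] bil_carr_const[OF assms] by (elim disjE) simp_all

lemma lam_diff:
  assumes "x \<in> carr X" "x' \<in> carr X"
  shows "(lam X y z x - lam X y z x') * qd X z y = 2 * bil X (x - x') (z - y)"
proof (cases "y = z")
  case False
  then have "qd X z y \<noteq> 0" using qd_pos[of z X y] y z by auto
  moreover have "lam X y z x - lam X y z x' = 2 * bil X (x - x') (z - y) / qd X z y"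
    unfolding lam_def off_diff[OF assms] diff_divide_distrib[symmetric]
    by (simp add: bil_simps(2) algebra_simps)
  ultimately show ?thesis by simp
qed (simp add: bil_def)

text \<open>The values -1 and 1 make \<open>lam = 0\<close> the bisector of \<open>y\<close> and
  \<open>z\<close>. Their difference 2 is the value of \<open>lam\<close> at \<open>z - y\<close>,
  which is why \<open>rfl\<close> changes the sign of \<open>lam\<close> and is an involution of the
  whole ambient space.\<close>

lemma lam_y: "y \<noteq> z \<Longrightarrow> lam X y z y = -1" and lam_z: "y \<noteq> z \<Longrightarrow> lam X y z z = 1"
proof -
  assume "y \<noteq> z"
  then have q: "qd X z y \<noteq> 0" using qd_pos[of z X y] y z by auto
  have o: "(bil X z z - bil X y y) * snd y = bil X z z - bil X y y"
    using bil_carr_const[OF y z] by auto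
  moreover have "2 * bil X y (z - y) - (bil X z z - bil X y y) = - qd X z y"
    by (simp add: bil_simps qd_eq bil_commute[of X y z])
  ultimately show 1: "lam X y z y = -1" unfolding lam_def using q by (simp only:) simp
  have "(lam X y z z - lam X y z y) * qd X z y = 2 * qd X z y"
    using lam_diff[OF z y] by (simp add: qd_def)
  with q 1 show "lam X y z z = 1" by simp
qed

lemma lam_rfl: "lam X y z (rfl X y z x) = - lam X y z x"
proof (cases "y = z")
  case True then show ?thesis by (simp add: rfl_def lam_def bil_def)
next
  case False
  then have "lam X y z (z - y) = 2" by (simp add: lam_simps(2) lam_y lam_z)
  then show ?thesis unfolding rfl_def lam_simps by (simp add: lam_simps)
qed

lemma rfl_rfl [simp]: "rfl X y z (rfl X y z x) = x"
  using lam_rfl[of x] unfolding rfl_def[of X y z "rfl X y z x"] by (simp add: rfl_def)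

lemma rfl_y: "rfl X y z y = z"
  by (cases "y = z") (auto simp: rfl_def lam_y)

lemma rfl_z: "rfl X y z z = y"
  using rfl_y rfl_rfl by metis

text \<open>Source of the bisector formula and of the half-space property: passing to the mirror
  image of \<open>w\<close> changes \<open>qd X x w\<close> by a positive multiple of the product of
  the signed positions of \<open>x\<close> and \<open>w\<close>.\<close>

lemma qd_rfl_right:
  assumes "x \<in> carr X" "w \<in> carr X"
  shows "qd X x (rfl X y z w) = qd X x w + lam X y z x * lam X y z w * qd X z y"
proof -
  let ?l = "lam X y z w" and ?c = "z - y"
  have "qd X x (rfl X y z w) = bil X ((x - w) + ?l *\<^sub>R ?c) ((x - w) + ?l *\<^sub>R ?c)"
    by (simp add: qd_def rfl_def algebra_simps)
  also have "\<dots> = qd X x w + ?l * (2 * bil X (x - w) ?c) + ?l * ?l * qd X z y"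
    unfolding bil_simps(1,4) bil_simps(3,6) bil_commute[of X "z - y" "x - w"]
    by (simp add: qd_def algebra_simps)
  also have "\<dots> = qd X x w + lam X y z x * ?l * qd X z y"
    unfolding lam_diff[OF assms, symmetric] by (simp add: algebra_simps)
  finally show ?thesis .
qed

lemma qd_rfl_rfl:
  assumes "x \<in> carr X" "w \<in> carr X"
  shows "qd X (rfl X y z x) (rfl X y z w) = qd X x w"
proof -
  let ?l = "lam X y z x - lam X y z w" and ?c = "z - y"
  have "rfl X y z x - rfl X y z w = (x - w) - ?l *\<^sub>R ?c" by (simp add: rfl_def algebra_simps)
  then have "qd X (rfl X y z x) (rfl X y z w) = bil X ((x - w) - ?l *\<^sub>R ?c) ((x - w) - ?l *\<^sub>R ?c)"
    by (simp add: qd_def)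
  also have "\<dots> = qd X x w - ?l * (2 * bil X (x - w) ?c) + ?l * ?l * qd X z y"
    unfolding bil_expand by (simp add: qd_def algebra_simps)
  also have "\<dots> = qd X x w"
    unfolding lam_diff[OF assms, symmetric] by (simp add: algebra_simps)
  finally show ?thesis .
qed

text \<open>Without offset, \<open>rfl\<close> is the orthogonal reflection with respect to the
  form, so it preserves the form on all of the ambient space and in particular the quadric.\<close>

lemma bil_rfl: "X \<noteq> Euc \<Longrightarrow> bil X (rfl X y z x) (rfl X y z w) = bil X x w"
proof (cases "y = z")
  case False
  assume "X \<noteq> Euc"
  then have o: "bil X z z = bil X y y" using bil_carr_const[OF y z] by auto
  have q: "qd X z y \<noteq> 0" using False qd_pos[of z X y] y z by auto
  have l: "lam X y z x * qd X z y = 2 * bil X x (z - y)" for x using q o by (simp add: lam_def)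
  have "bil X (rfl X y z x) (rfl X y z w) = bil X x w - lam X y z w * bil X x (z - y)
     - lam X y z x * bil X w (z - y) + lam X y z x * lam X y z w * qd X z y"
    unfolding rfl_def bil_expand by (simp add: qd_def)
  moreover have "2 * (lam X y z w * bil X x (z - y)) = lam X y z x * lam X y z w * qd X z y"
    "2 * (lam X y z x * bil X w (z - y)) = lam X y z x * lam X y z w * qd X z y"
    using l[of x] l[of w] by algebra+
  ultimately show ?thesis by argo
qed simp

lemma rfl_carr: 
  assumes x: "x \<in> carr X" shows "rfl X y z x \<in> carr X"
proof (cases X)
  case Sph then show ?thesis using bil_rfl x by (simp add: carr_iff)
next
  case Euc
  then have "snd (z - y) = 0" using y z by (simp add: carr_iff)
  then show ?thesis using x Euc by (simp add: carr_iff rfl_def)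
next
  case Hyp
  have 1: "bil X (rfl X y z x) (rfl X y z x) = -1" using bil_rfl x Hyp by (simp add: carr_iff)
  \<comment> \<open>The lower sheet has to be excluded. The image pairs with \<open>z\<close> as
    \<open>x\<close> does with \<open>y\<close>, so to at most -1, whereas a point of the quadric
    with height at most 0 pairs with \<open>z\<close> to a nonnegative number.\<close>
  have 2: "bil X (rfl X y z x) z = bil X x y" using bil_rfl[of x y] Hyp rfl_y by simp
  have 3: "bil X x y \<le> -1" using qd_ge_0[OF x y] x y Hyp by (simp add: qd_eq carr_iff)
  obtain v t where r: "rfl X y z x = (v, t)" by (cases "rfl X y z x")
  obtain w s where zz: "z = (w, s)" by (cases z)
  have t2: "t\<^sup>2 = 1 + (norm v)\<^sup>2" using 1 Hyp r
    by (simp add: bil_def kap_def power2_norm_eq_inner power2_eq_square[of t])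
  have s: "s > 0" "s\<^sup>2 = 1 + (norm w)\<^sup>2" using z Hyp by (simp_all add: carr_def zz)
  have "norm v \<le> \<bar>t\<bar>" "norm w \<le> s"
    using power2_le_imp_le[of "norm v" "\<bar>t\<bar>"] power2_le_imp_le[of "norm w" s] t2 s
    by simp_all
  then have "norm v * norm w \<le> \<bar>t\<bar> * s" by (intro mult_mono) auto
  then have vw: "\<bar>v \<bullet> w\<bar> \<le> \<bar>t\<bar> * s" using Cauchy_Schwarz_ineq2[of v w] by simp
  have "bil X (v, t) (w, s) \<le> -1" using 2 3 by (metis r zz)
  then have "v \<bullet> w - t * s \<le> -1" using Hyp by (simp add: bil_def kap_def)
  have "t > 0"
  proof (rule ccontr)
    assume "\<not> t > 0"
    then have "\<bar>t\<bar> * s = - t * s" by simp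
    with vw \<open>v \<bullet> w - t * s \<le> -1\<close> show False by argo
  qed
  then show ?thesis using 1 Hyp r by (simp add: carr_iff)
qed

lemma sdist_rfl_rfl:
  "x \<in> carr X \<Longrightarrow> w \<in> carr X \<Longrightarrow> sdist X (rfl X y z x) (rfl X y z w) = sdist X x w"
  by (simp add: sdist_qd rfl_carr qd_rfl_rfl)

lemma sdist_rfl_swap:
  "x \<in> carr X \<Longrightarrow> w \<in> carr X \<Longrightarrow> sdist X (rfl X y z x) w = sdist X x (rfl X y z w)"
  using sdist_rfl_rfl[of x "rfl X y z w"] by (simp add: rfl_carr)

lemma qd_bisector: "x \<in> carr X \<Longrightarrow> qd X x z - qd X x y = - lam X y z x * qd X z y"
  using qd_rfl_right[of x y] by (cases "y = z") (auto simp: rfl_y y lam_y)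

lemma sdist_bisector:
  assumes "x \<in> carr X" "y \<noteq> z"
  shows "sdist X x y \<le> sdist X x z \<longleftrightarrow> lam X y z x \<le> 0"
    and "sdist X x z \<le> sdist X x y \<longleftrightarrow> lam X y z x \<ge> 0"
proof -
  have q: "qd X z y > 0" using assms qd_pos[of z X y] y z by auto
  have "qd X x z = qd X x y - lam X y z x * qd X z y" using qd_bisector[OF assms(1)] by simp
  with q show "sdist X x y \<le> sdist X x z \<longleftrightarrow> lam X y z x \<le> 0"
     "sdist X x z \<le> sdist X x y \<longleftrightarrow> lam X y z x \<ge> 0"
    by (simp_all add: sdist_le_iff assms y z mult_le_0_iff zero_le_mult_iff)
qed

lemma sdist_half_space:
  assumes "x \<in> carr X" "w \<in> carr X" "lam X y z x * lam X y z w \<ge> 0"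
  shows "sdist X x w \<le> sdist X x (rfl X y z w)"
proof -
  have "lam X y z x * lam X y z w * qd X z y \<ge> 0" using assms qd_ge_0[OF z y] by simp
  then show ?thesis using assms by (simp add: sdist_le_iff rfl_carr qd_rfl_right)
qed

text \<open>\<open>complementary_half_spaces\<close> uses the Euclidean inner product, so
  \<open>kap\<close> and the offset are absorbed into the last coordinate of the normal vector. The
  sign puts \<open>y\<close> on the positive side.\<close>

lemma lam_inner: "\<exists>a. \<forall>x. a \<bullet> x = - lam X y z x"
proof (intro exI allI)
  let ?c = "z - y" and ?q = "inverse (qd X z y)" and ?o = "bil X z z - bil X y y"
  fix x :: "'n point"
  have "((- 2 * ?q) *\<^sub>R fst ?c, (?o - 2 * kap X * snd ?c) * ?q) \<bullet> x
      = (- 2 * ?q) * (fst x \<bullet> fst ?c) + (?o - 2 * kap X * snd ?c) * ?q * snd x"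
    by (simp add: inner_prod_def inner_commute)
  also have "\<dots> = - lam X y z x"
    unfolding lam_def bil_def[of X x] divide_inverse by algebra
  finally show "((- 2 * ?q) *\<^sub>R fst ?c, (?o - 2 * kap X * snd ?c) * ?q) \<bullet> x = - lam X y z x" .
qed

lemma is_reflection_rfl:
  assumes "y \<noteq> z"
  shows "is_reflection X (restrict (rfl X y z) (carr X))"
proof -
  from lam_inner obtain a where a: "\<And>x. a \<bullet> x = - lam X y z x" by metis
  define H H' where "H = {x \<in> carr X. a \<bullet> x \<ge> 0}" and "H' = {x \<in> carr X. a \<bullet> x \<le> 0}"
  let ?s = "restrict (rfl X y z) (carr X)"
  have HI: "x \<in> H \<longleftrightarrow> x \<in> carr X \<and> lam X y z x \<le> 0"
    "x \<in> H' \<longleftrightarrow> x \<in> carr X \<and> lam X y z x \<ge> 0" for x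
    by (simp_all add: H_def H'_def a)
  have 1: "complementary_half_spaces X H H'"
    unfolding complementary_half_spaces_def H_def H'_def
    by (intro exI[of _ a] conjI refl bexI[of _ y] bexI[of _ z] y z) (simp_all add: a lam_y lam_z assms)
  have s: "?s x = rfl X y z x" if "x \<in> carr X" for x using that by simp
  have im: "?s ` A = B"
    if "\<And>x. x \<in> A \<Longrightarrow> x \<in> carr X \<and> rfl X y z x \<in> B" "\<And>x. x \<in> B \<Longrightarrow> rfl X y z x \<in> A" for A B
  proof (intro equalityI subsetI)
    fix x assume "x \<in> B"
    then show "x \<in> ?s ` A"
      using that(1)[OF that(2)] that(2)[of x] by (intro image_eqI[of _ _ "rfl X y z x"]) simp_all
  next
    fix x assume "x \<in> ?s ` A"
    then obtain w where "w \<in> A" "x = ?s w" by (rule imageE)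
    then show "x \<in> B" using that(1)[of w] by simp
  qed
  have 2: "?s ` H = H'" "?s ` H' = H"
    by (intro im; simp add: HI rfl_carr lam_rfl)+
  have 3: "sdist X x (?s w) \<ge> sdist X x w" if "x \<in> H \<and> w \<in> H \<or> x \<in> H' \<and> w \<in> H'" for x w
    using that s[of w] sdist_half_space[of x w]
    by (elim disjE) (simp_all add: HI mult_nonpos_nonpos)
  have "?s \<in> carr X \<rightarrow>\<^sub>E carr X" using rfl_carr by (intro PiE_I) simp_all
  moreover have "\<forall>x\<in>carr X. \<forall>w\<in>carr X. sdist X (?s x) (?s w) = sdist X x w"
    by (intro ballI) (simp add: sdist_rfl_rfl)
  moreover have "\<forall>x\<in>carr X. ?s (?s x) = x" by (intro ballI) (simp add: rfl_carr)
  ultimately show ?thesis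
    unfolding is_reflection_def using 1 2 3 by blast
qed

end

section \<open>Uniqueness of reflections\<close>

text \<open>A geodesic is the radial image of a chord. The only obstruction is a chord through the
  centre, which needs antipodal points of the sphere.\<close>

lemma carr_segment:
  assumes x: "x \<in> carr X" and z: "z \<in> carr X" and ne: "z \<noteq> - x" and s: "0 \<le> s" "s \<le> 1"
  shows "\<exists>l>0. l *\<^sub>R ((1 - s) *\<^sub>R x + s *\<^sub>R z) \<in> carr X"
proof -
  let ?q = "(1 - s) *\<^sub>R x + s *\<^sub>R z"
  show ?thesis
  proof (cases X)
    case Sph
    then have n: "norm x = 1" "norm z = 1" using x z by (simp_all add: carr_def)
    have "?q \<noteq> 0"
    proof
      assume "?q = 0"
      then have eq: "(1 - s) *\<^sub>R x = - (s *\<^sub>R z)" by (simp add: eq_neg_iff_add_eq_0)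
      then have "norm ((1 - s) *\<^sub>R x) = norm (s *\<^sub>R z)" by simp
      then have "1 - s = s" using s n by simp
      with eq s have "s *\<^sub>R x = s *\<^sub>R (- z)" "s \<noteq> 0" by simp_all
      then have "x = - z" by (metis scaleR_cancel_left)
      with ne show False by simp
    qed
    then show ?thesis using Sph by (intro exI[of _ "inverse (norm ?q)"]) (simp add: carr_def)
  next
    case Euc
    then show ?thesis using x z by (intro exI[of _ 1]) (simp add: carr_iff)
  next
    case Hyp
    have xz: "bil X x z \<le> -1" using qd_ge_0[OF x z] x z Hyp by (simp add: qd_eq carr_iff)
    \<comment> \<open>Since \<open>bil X x z \<le> -1\<close>, the form along the chord is at most
      minus the square of \<open>(1 - s) + s\<close>, so the chord stays inside the cone.\<close>
    have "bil X ?q ?q = (1 - s) * (1 - s) * bil X x x + s * s * bil X z z + 2 * (s * (1 - s)) * bil X x z"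
      by (simp add: bil_simps bil_commute[of X z x] algebra_simps)
    also have "\<dots> \<le> (1 - s) * (1 - s) * (- 1) + s * s * (- 1) + 2 * (s * (1 - s)) * (- 1)"
      using x z Hyp s xz by (intro add_mono mult_left_mono) (simp_all add: carr_iff)
    also have "\<dots> = -1" by algebra
    finally have b: "bil X ?q ?q \<le> -1" .
    have p: "snd ?q > 0"
    proof (cases "s = 0")
      case True then show ?thesis using x Hyp by (simp add: carr_iff)
    next
      case False
      then have "s * snd z > 0" using s z Hyp by (simp add: carr_iff)
      moreover have "(1 - s) * snd x \<ge> 0" using s x Hyp by (simp add: carr_iff)
      ultimately show ?thesis by simp
    qed
    obtain q where q: "q = ?q" by simp
    let ?l = "1 / sqrt (- bil X q q)"
    have "?l * (?l * bil X q q) = -1" using b[folded q] by (simp add: field_simps)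
    moreover have "?l > 0" using b[folded q] by simp
    ultimately have "?l *\<^sub>R q \<in> carr X" using Hyp p[folded q] by (simp add: carr_iff bil_simps(3,6))
    with \<open>?l > 0\<close> show ?thesis unfolding q[symmetric] by (intro exI[of _ ?l] conjI)
  qed
qed

lemma rfl_fixed: "lam X y z x = 0 \<Longrightarrow> rfl X y z x = x"
  by (simp add: rfl_def)

text \<open>A linear functional with zeros at two points of a chord vanishes along it. Joining
  \<open>y\<close> or \<open>z\<close> to a point beyond their bisector produces such a chord, so
  \<open>lam X u u'\<close> vanishes on the whole carrier; for distinct points its value at
  \<open>u\<close> would be -1.\<close>

lemma lam_0_carr_imp:
  assumes u: "u \<in> carr X" "u' \<in> carr X" and y: "y \<in> carr X" and z: "z \<in> carr X" and ne: "y \<noteq> z"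
    and b: "\<And>w. w \<in> carr X \<Longrightarrow> lam X y z w = 0 \<Longrightarrow> lam X u u' w = 0"
    and yz: "lam X u u' y = 0" "lam X u u' z = 0"
  shows "u = u'"
proof (rule ccontr)
  assume nu: "u \<noteq> u'"
  have neg: "lam X u u' (- w) = - lam X u u' w" for w
    using lam_simps(3)[of X u u' "-1" w] by simp
  have cross: "lam X u u' w = 0"
    if w: "w \<in> carr X" and v: "v \<in> carr X" "lam X u u' v = 0"
      and sg: "lam X y z v * lam X y z w < 0" for v w
  proof (cases "w = - v")
    case True then show ?thesis using v neg by simp
  next
    case False
    let ?a = "\<bar>lam X y z v\<bar>" and ?b = "\<bar>lam X y z w\<bar>"
    \<comment> \<open>The parameter at which the chord from \<open>v\<close> to \<open>w\<close>
      crosses the bisector of \<open>y\<close> and \<open>z\<close>.\<close>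
    let ?s = "?a / (?a + ?b)"
    have ab: "?a > 0" "?b > 0" using sg by auto
    then have s: "0 < ?s" "?s \<le> 1" "1 - ?s = ?b / (?a + ?b)" by (simp_all add: field_simps)
    obtain l where l: "l > 0" "l *\<^sub>R ((1 - ?s) *\<^sub>R v + ?s *\<^sub>R w) \<in> carr X"
      using carr_segment[OF v(1) w False less_imp_le[OF s(1)] s(2)] by blast
    have "(1 - ?s) * lam X y z v + ?s * lam X y z w = 0"
    proof -
      have "?b * lam X y z v + ?a * lam X y z w = 0"
        using sg by (auto simp: mult_less_0_iff abs_if)
      then show ?thesis unfolding s(3) by (simp add: add_divide_distrib[symmetric])
    qed
    then have "lam X y z (l *\<^sub>R ((1 - ?s) *\<^sub>R v + ?s *\<^sub>R w)) = 0" unfolding lam_simps by simp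
    from b[OF l(2) this] have "(1 - ?s) * lam X u u' v + ?s * lam X u u' w = 0"
      using l(1) unfolding lam_simps by simp
    then show ?thesis using v(2) s(1) ab by simp
  qed
  have "lam X u u' w = 0" if w: "w \<in> carr X" for w
  proof (cases "lam X y z w" "0::real" rule: linorder_cases)
    case less
    then show ?thesis using cross[OF w z yz(2)] by (simp add: lam_z[OF y z ne])
  next
    case equal then show ?thesis using b w by simp
  next
    case greater
    then show ?thesis using cross[OF w y yz(1)] by (simp add: lam_y[OF y z ne])
  qed
  from this[OF u(1)] lam_y[OF u nu] show False by simp
qed

text \<open>The hyperplane of \<open>a\<close> is unknown at first. The distance condition fixes its
  points and puts each of its sides into a side of the bisector of \<open>y\<close> and
  \<open>z\<close>; conversely every bisector point lies on the hyperplane. Therefore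
  \<open>\<sigma> x\<close> and \<open>rfl X y z x\<close> have equal distances to \<open>y\<close>,
  to \<open>z\<close> and to the whole bisector, which forces them to coincide.\<close>

lemma reflection_eq_rfl_aux:
  fixes \<sigma> :: "'n::finite point \<Rightarrow> 'n point"
  assumes y: "y \<in> carr X" and z: "z \<in> carr X" and ne: "y \<noteq> z"
    and c: "\<And>x. x \<in> carr X \<Longrightarrow> \<sigma> x \<in> carr X"
    and iso: "\<And>x w. x \<in> carr X \<Longrightarrow> w \<in> carr X \<Longrightarrow> sdist X (\<sigma> x) (\<sigma> w) = sdist X x w"
    and inv: "\<And>x. x \<in> carr X \<Longrightarrow> \<sigma> (\<sigma> x) = x"
    and H: "\<And>x. x \<in> carr X \<Longrightarrow> a \<bullet> x \<ge> 0 \<Longrightarrow> a \<bullet> \<sigma> x \<le> 0"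
    and H': "\<And>x. x \<in> carr X \<Longrightarrow> a \<bullet> x \<le> 0 \<Longrightarrow> a \<bullet> \<sigma> x \<ge> 0"
    and ge: "\<And>x w. x \<in> carr X \<Longrightarrow> w \<in> carr X \<Longrightarrow> a \<bullet> x \<ge> 0 \<and> a \<bullet> w \<ge> 0 \<or> a \<bullet> x \<le> 0 \<and> a \<bullet> w \<le> 0
      \<Longrightarrow> sdist X x (\<sigma> w) \<ge> sdist X x w"
    and yz: "\<sigma> y = z" and ay: "a \<bullet> y \<ge> 0"
    and x: "x \<in> carr X"
  shows "\<sigma> x = rfl X y z x"
proof -
  have zy: "\<sigma> z = y" using inv[OF y] yz by simp
  have az: "a \<bullet> z \<le> 0" using H[OF y ay] yz by simp
  have l1: "lam X y z x \<le> 0" if "x \<in> carr X" "a \<bullet> x \<ge> 0" for x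
    using ge[OF that(1) y] that ay yz sdist_bisector[OF y z that(1) ne] by simp
  have l2: "lam X y z x \<ge> 0" if "x \<in> carr X" "a \<bullet> x \<le> 0" for x
    using ge[OF that(1) z] that az zy sdist_bisector[OF y z that(1) ne] by simp
  \<comment> \<open>The image of a boundary point is a boundary point as well, so the distance
    condition applies to \<open>x\<close> and \<open>\<sigma> x\<close> and bounds their distance by
    that of \<open>x\<close> to \<open>\<sigma> (\<sigma> x) = x\<close>.\<close>
  have fix0: "\<sigma> x = x" if "x \<in> carr X" "a \<bullet> x = 0" for x
  proof (rule ccontr)
    assume "\<sigma> x \<noteq> x"
    have "a \<bullet> \<sigma> x = 0" using H[of x] H'[of x] that by simp
    then have "sdist X x (\<sigma> (\<sigma> x)) \<ge> sdist X x (\<sigma> x)" using that by (intro ge c) simp_all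
    then have "sdist X x (\<sigma> x) \<le> 0" using that by (simp add: inv)
    then show False using sdist_pos[of x X "\<sigma> x"] that c \<open>\<sigma> x \<noteq> x\<close> by fastforce
  qed
  have small: "\<exists>s. 0 < s \<and> s \<le> 1 \<and> (1 - s) * \<alpha> > s * \<beta>" if "\<alpha> > 0" "\<beta> \<ge> 0" for \<alpha> \<beta> :: real
  proof (intro exI conjI)
    let ?s = "\<alpha> / (2 * (\<alpha> + \<beta>))"
    have "?s * (\<alpha> + \<beta>) = \<alpha> / 2" using that by (simp add: field_simps)
    moreover have "(1 - ?s) * \<alpha> - ?s * \<beta> = \<alpha> - ?s * (\<alpha> + \<beta>)" by algebra
    ultimately show "(1 - ?s) * \<alpha> > ?s * \<beta>" using that(1) by linarith
  qed (use that in \<open>simp_all add: field_simps\<close>)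
  \<comment> \<open>If a bisector point lay strictly on one side of the hyperplane, a short step
    towards whichever of \<open>y\<close>, \<open>z\<close> belongs to the other side would keep it
    there and yet carry it to the wrong side of the bisector.\<close>
  have bis: "a \<bullet> w = 0" if w: "w \<in> carr X" and l0: "lam X y z w = 0" for w
  proof -
    have neg: "lam X y z (- w) = 0" using l0 lam_simps(3)[of X y z "-1" w] by simp
    have "\<not> a \<bullet> w < 0"
    proof
      assume aw: "a \<bullet> w < 0"
      have "y \<noteq> - w" using neg lam_y[OF y z ne] by auto
      obtain s where s: "0 < s" "s \<le> 1" "(1 - s) * (- (a \<bullet> w)) > s * (a \<bullet> y)"
        using small[of "- (a \<bullet> w)" "a \<bullet> y"] aw ay by auto
      obtain l where l: "l > 0" "l *\<^sub>R ((1 - s) *\<^sub>R w + s *\<^sub>R y) \<in> carr X"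
        using carr_segment[OF w y \<open>y \<noteq> - w\<close>, of s] s by auto
      have "a \<bullet> (l *\<^sub>R ((1 - s) *\<^sub>R w + s *\<^sub>R y)) = l * ((1 - s) * (a \<bullet> w) + s * (a \<bullet> y))"
        by (simp add: inner_simps)
      also have "\<dots> \<le> 0" using l(1) s(3) by (intro mult_nonneg_nonpos) simp_all
      finally have "lam X y z (l *\<^sub>R ((1 - s) *\<^sub>R w + s *\<^sub>R y)) \<ge> 0" using l2 l(2) by blast
      then have "l * s \<le> 0" unfolding lam_simps l0 lam_y[OF y z ne] by simp
      then show False using l(1) s(1) by (simp add: mult_le_0_iff)
    qed
    moreover have "\<not> a \<bullet> w > 0"
    proof
      assume aw: "a \<bullet> w > 0"
      have "z \<noteq> - w" using neg lam_z[OF y z ne] by auto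
      obtain s where s: "0 < s" "s \<le> 1" "(1 - s) * (a \<bullet> w) > s * (- (a \<bullet> z))"
        using small[of "a \<bullet> w" "- (a \<bullet> z)"] aw az by auto
      obtain l where l: "l > 0" "l *\<^sub>R ((1 - s) *\<^sub>R w + s *\<^sub>R z) \<in> carr X"
        using carr_segment[OF w z \<open>z \<noteq> - w\<close>, of s] s by auto
      have "0 \<le> l * ((1 - s) * (a \<bullet> w) + s * (a \<bullet> z))" using l(1) s(3) by (intro mult_nonneg_nonneg) simp_all
      also have "\<dots> = a \<bullet> (l *\<^sub>R ((1 - s) *\<^sub>R w + s *\<^sub>R z))"
        by (simp add: inner_simps)
      finally have "lam X y z (l *\<^sub>R ((1 - s) *\<^sub>R w + s *\<^sub>R z)) \<le> 0" using l1 l(2) by blast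
      then have "l * s \<le> 0" unfolding lam_simps l0 lam_z[OF y z ne] by simp
      then show False using l(1) s(1) by (simp add: mult_le_0_iff)
    qed
    ultimately show ?thesis by simp
  qed
  let ?u = "\<sigma> x" and ?u' = "rfl X y z x"
  have u: "?u \<in> carr X" "?u' \<in> carr X" using c[OF x] rfl_carr[OF y z x] by auto
  have eqd: "lam X ?u ?u' w = 0" if "w \<in> carr X" "sdist X ?u w = sdist X ?u' w" for w
  proof (cases "?u = ?u'")
    case False
    have "sdist X w ?u = sdist X w ?u'" using that(2) unfolding sdist_commute[of X w] .
    then show ?thesis using sdist_bisector[OF u that(1) False] by simp
  qed (simp add: lam_def bil_def)
  show ?thesis
  proof (rule lam_0_carr_imp[OF u y z ne])
    fix w assume w: "w \<in> carr X" "lam X y z w = 0"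
    have "sdist X ?u w = sdist X ?u' w"
      using iso[OF x w(1)] fix0[OF w(1) bis[OF w]] sdist_rfl_rfl[OF y z x w(1)] rfl_fixed[OF w(2)] by simp
    then show "lam X ?u ?u' w = 0" by (rule eqd[OF w(1)])
  next
    have "sdist X ?u y = sdist X ?u' y"
      using iso[OF x z] zy sdist_rfl_rfl[OF y z x z] rfl_z[OF y z] by simp
    then show "lam X ?u ?u' y = 0" by (rule eqd[OF y])
  next
    have "sdist X ?u z = sdist X ?u' z"
      using iso[OF x y] yz sdist_rfl_rfl[OF y z x y] rfl_y[OF y z] by simp
    then show "lam X ?u ?u' z = 0" by (rule eqd[OF z])
  qed
qed

lemma reflection_eq_rfl:
  fixes y z :: "'n::finite point"
  assumes y: "y \<in> carr X" and z: "z \<in> carr X" and ne: "y \<noteq> z"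
    and r: "is_reflection X \<sigma>" and yz: "\<sigma> y = z"
  shows "\<sigma> = restrict (rfl X y z) (carr X)"
proof (rule extensionalityI[where A = "carr X :: 'n point set"])
  note r' = r[unfolded is_reflection_def]
  have ext: "\<sigma> \<in> carr X \<rightarrow>\<^sub>E carr X" by (rule r'[THEN conjunct1])
  then show "\<sigma> \<in> extensional (carr X)" unfolding PiE_def by (rule IntD2)
  have c: "\<sigma> x \<in> carr X" if "x \<in> carr X" for x using ext that by (rule PiE_mem)
  have iso: "sdist X (\<sigma> x) (\<sigma> w) = sdist X x w" if "x \<in> carr X" "w \<in> carr X" for x w
    by (rule r'[THEN conjunct2, THEN conjunct1, rule_format, OF that])
  have inv: "\<sigma> (\<sigma> x) = x" if "x \<in> carr X" for x
    by (rule r'[THEN conjunct2, THEN conjunct2, THEN conjunct1, rule_format, OF that])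
  from r'[THEN conjunct2, THEN conjunct2, THEN conjunct2]
  obtain H H' where hh: "complementary_half_spaces X H H'" and im: "\<sigma> ` H = H'" "\<sigma> ` H' = H"
    and ge0: "\<forall>x w. (x \<in> H \<and> w \<in> H) \<or> (x \<in> H' \<and> w \<in> H') \<longrightarrow> sdist X x (\<sigma> w) \<ge> sdist X x w"
    by (elim exE conjE) (rule that)
  note ge = ge0[rule_format]
  from hh obtain a where a: "H = {x \<in> carr X. a \<bullet> x \<ge> 0}" "H' = {x \<in> carr X. a \<bullet> x \<le> 0}"
    unfolding complementary_half_spaces_def by (elim exE conjE) (rule that)
  have h: "a \<bullet> \<sigma> x \<le> 0" if "x \<in> carr X" "a \<bullet> x \<ge> 0" for x
  proof -
    have "\<sigma> x \<in> H'" unfolding im(1)[symmetric] by (rule imageI) (simp add: a(1) that)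
    then show ?thesis by (simp add: a(2))
  qed
  have h': "a \<bullet> \<sigma> x \<ge> 0" if "x \<in> carr X" "a \<bullet> x \<le> 0" for x
  proof -
    have "\<sigma> x \<in> H" unfolding im(2)[symmetric] by (rule imageI) (simp add: a(2) that)
    then show ?thesis by (simp add: a(1))
  qed
  fix x :: "'n point" assume x: "x \<in> carr X"
  have ge': "sdist X x (\<sigma> w) \<ge> sdist X x w"
    if "x \<in> carr X" "w \<in> carr X" "a \<bullet> x \<ge> 0 \<and> a \<bullet> w \<ge> 0 \<or> a \<bullet> x \<le> 0 \<and> a \<bullet> w \<le> 0" for x w
    using that(3) by (intro ge) (simp add: a that(1,2))
  have "\<sigma> x = rfl X y z x"
  proof (cases "a \<bullet> y \<ge> 0")
    case True
    show ?thesis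
      by (rule reflection_eq_rfl_aux[OF y z ne c iso inv h h' ge' yz True x])
  next
    case False
    \<comment> \<open>Passing to \<open>- a\<close> only exchanges the roles of the two half-spaces,
      so that \<open>y\<close> lies on the nonnegative side.\<close>
    have ay: "- a \<bullet> y \<ge> 0" using False by simp
    have g1: "- a \<bullet> \<sigma> x \<le> 0" if "x \<in> carr X" "- a \<bullet> x \<ge> 0" for x using h'[of x] that by simp
    have g2: "- a \<bullet> \<sigma> x \<ge> 0" if "x \<in> carr X" "- a \<bullet> x \<le> 0" for x using h[of x] that by simp
    have g3: "sdist X x (\<sigma> w) \<ge> sdist X x w"
      if "x \<in> carr X" "w \<in> carr X" "- a \<bullet> x \<ge> 0 \<and> - a \<bullet> w \<ge> 0 \<or> - a \<bullet> x \<le> 0 \<and> - a \<bullet> w \<le> 0" for x w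
      using that(3) by (intro ge' that(1,2)) auto
    show ?thesis
      by (rule reflection_eq_rfl_aux[OF y z ne c iso inv g1 g2 g3 yz ay x])
  qed
  then show "\<sigma> x = restrict (rfl X y z) (carr X) x" using x by simp
qed simp

section \<open>Geodesic polar coordinates and the triangle inequality\<close>

lemma polar_point_carr:
  fixes \<omega> :: "real \<times> (real^'n::finite)"
  assumes "norm (snd \<omega>) = 1"
  shows "polar_point X \<omega> \<in> carr X"
proof -
  have "snd \<omega> \<bullet> snd \<omega> = 1" using assms by (simp add: dot_square_norm)
  then show ?thesis
    using cosh_square_eq[of "fst \<omega>"] sin_cos_squared_add[of "fst \<omega>"]
    by (cases X) (simp_all add: polar_point_def case_prod_beta carr_iff bil_def kap_def power2_eq_square)
qed

lemma sdist_polar_point: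
  fixes \<omega> :: "real \<times> (real^'n::finite)"
  assumes "norm (snd \<omega>) = 1" "fst \<omega> \<ge> 0" "X = Sph \<Longrightarrow> fst \<omega> \<le> pi"
  shows "sdist X (polar_point X \<omega>) orig = fst \<omega>"
  using assms
  by (cases X) (simp_all add: polar_point_def case_prod_beta sdist_def orig_def inner_prod_def
      arccos_cos arcosh_cosh_real dist_norm norm_Pair)

lemma refl_at_eq:
  fixes \<omega> :: "real \<times> (real^'n::finite)"
  assumes "norm (snd \<omega>) = 1" "fst \<omega> > 0" "X = Sph \<Longrightarrow> fst \<omega> \<le> pi"
  shows "refl_at X \<omega> = restrict (rfl X orig (polar_point X \<omega>)) (carr X)"
proof -
  let ?p = "polar_point X \<omega>"
  have p: "?p \<in> carr X" by (rule polar_point_carr) fact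
  have ne: "orig \<noteq> ?p" using sdist_polar_point[of \<omega> X] assms by auto
  show ?thesis unfolding refl_at_def
  proof (rule the_equality, rule conjI)
    show "is_reflection X (restrict (rfl X orig ?p) (carr X))" by (rule is_reflection_rfl[OF orig_carr p ne])
    show "restrict (rfl X orig ?p) (carr X) orig = ?p" by (simp add: rfl_y[OF orig_carr p])
  qed (elim conjE, rule reflection_eq_rfl[OF orig_carr p ne])
qed

lemma polar_ex:
  fixes x :: "'n::finite point"
  assumes x: "x \<in> carr X"
  obtains u where "norm u = 1" "x = polar_point X (sdist X x orig, u)"
proof -
  obtain v t where xv: "x = (v, t)" by (cases x)
  define e :: "real^'n" where "e = axis undefined 1"
  \<comment> \<open>For \<open>v = 0\<close> the point is the origin or its antipode and every
    direction serves, since its coefficient is 0.\<close>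
  define u where "u = (if v = 0 then e else v /\<^sub>R norm v)"
  have u: "norm u = 1" by (simp add: u_def e_def norm_axis_1)
  have v: "v = norm v *\<^sub>R u" by (simp add: u_def)
  have "x = polar_point X (sdist X x orig, u)"
  proof (cases X)
    case Sph
    have n: "(norm v)\<^sup>2 + t\<^sup>2 = 1" using x Sph by (simp add: carr_iff xv bil_def kap_def dot_square_norm power2_eq_square)
    have t: "\<bar>t\<bar> \<le> 1" using n zero_le_power2[of "norm v"] abs_square_le_1[of t] by linarith
    have "norm v = sqrt (1 - t\<^sup>2)" using n by (metis add_diff_cancel_right' norm_ge_zero real_sqrt_unique)
    then have "norm v = sin (arccos t)" using t by (simp add: sin_arccos_abs)
    with v have "v = sin (arccos t) *\<^sub>R u" by metis
    then show ?thesis using Sph t by (simp add: polar_point_def xv sdist_def orig_def inner_prod_def cos_arccos_abs)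
  next
    case Euc
    then show ?thesis using x v by (simp add: polar_point_def xv sdist_def orig_def carr_iff dist_norm norm_Pair)
  next
    case Hyp
    have n: "(norm v)\<^sup>2 = t\<^sup>2 - 1" "t > 0" using x Hyp by (simp_all add: carr_iff xv bil_def kap_def dot_square_norm power2_eq_square)
    have t: "t \<ge> 1" 
    proof -
      have "t\<^sup>2 \<ge> 1" using n(1) zero_le_power2[of "norm v"] by linarith
      then have "\<bar>1\<bar> \<le> \<bar>t\<bar>" unfolding abs_le_square_iff by simp
      then show ?thesis using n(2) by simp
    qed
    have "norm v = sqrt (t\<^sup>2 - 1)" using n by (metis norm_ge_zero real_sqrt_unique)
    then have "norm v = sinh (arcosh t)" using t by (simp add: sinh_arcosh_real)
    with v have v': "v = sinh (arcosh t) *\<^sub>R u" by metis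
    have "sdist X x orig = arcosh t" using Hyp by (simp add: xv sdist_def orig_def)
    then show ?thesis using Hyp t by (simp add: polar_point_def xv v'[symmetric])
  qed
  with u that show ?thesis by blast
qed

lemma sdist_orig_le_pi: "x \<in> carr Sph \<Longrightarrow> sdist Sph x orig \<le> pi"
proof -
  assume "x \<in> carr Sph"
  then have "\<bar>snd x\<bar> \<le> 1" using norm_snd_le[of "snd x" "fst x"] by (simp add: carr_def)
  then show ?thesis by (simp add: sdist_def orig_def inner_prod_def arccos_ubound)
qed

text \<open>On the curved models the angle enters only through \<open>u \<bullet> w\<close>. Its
  lowest value -1 turns the form into the addition formula for the sum of the radii; on the sphere
  this covers sums below \<pi>, and beyond that the diameter bound suffices.\<close>

lemma sdist_triangle_orig:
  fixes x z :: "'n::finite point"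
  assumes x: "x \<in> carr X" and z: "z \<in> carr X"
  shows "sdist X x z \<le> sdist X x orig + sdist X z orig"
proof -
  define \<alpha> \<beta> where "\<alpha> = sdist X x orig" and "\<beta> = sdist X z orig"
  obtain u where u: "norm u = 1" "x = polar_point X (\<alpha>, u)" using polar_ex[OF x] by (auto simp: \<alpha>_def)
  obtain w where w: "norm w = 1" "z = polar_point X (\<beta>, w)" using polar_ex[OF z] by (auto simp: \<beta>_def)
  have nn: "\<alpha> \<ge> 0" "\<beta> \<ge> 0" using sdist_nonneg[OF _ orig_carr] x z by (simp_all add: \<alpha>_def \<beta>_def)
  have uw: "\<bar>u \<bullet> w\<bar> \<le> 1" using Cauchy_Schwarz_ineq2[of u w] u w by simp
  have "sdist X x z \<le> \<alpha> + \<beta>"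
  proof (cases X)
    case Sph
    have pi: "\<alpha> \<le> pi" "\<beta> \<le> pi" using x z Sph sdist_orig_le_pi[of x] sdist_orig_le_pi[of z] by (simp_all add: \<alpha>_def \<beta>_def)
    have b: "\<bar>x \<bullet> z\<bar> \<le> 1" using Cauchy_Schwarz_ineq2[of x z] x z Sph by (simp add: carr_def)
    show ?thesis
    proof (cases "\<alpha> + \<beta> \<ge> pi")
      case True
      have "arccos (x \<bullet> z) \<le> pi" using b by (intro arccos_ubound) auto
      with True Sph show ?thesis by (simp add: sdist_def)
    next
      case False
      have "sin \<alpha> * sin \<beta> * (u \<bullet> w) \<ge> sin \<alpha> * sin \<beta> * (-1)"
        using uw pi nn by (intro mult_left_mono mult_nonneg_nonneg sin_ge_zero) auto
      then have "x \<bullet> z \<ge> cos (\<alpha> + \<beta>)"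
        using Sph u w by (simp add: polar_point_def inner_prod_def cos_add mult.assoc mult.left_commute)
      then have "arccos (x \<bullet> z) \<le> arccos (cos (\<alpha> + \<beta>))" using b by (intro arccos_le_arccos) auto
      with False nn Sph show ?thesis by (simp add: sdist_def arccos_cos)
    qed
  next
    case Euc
    then show ?thesis using dist_triangle2[of x z orig] by (simp add: sdist_def \<alpha>_def \<beta>_def dist_commute)
  next
    case Hyp
    have "sinh \<alpha> * sinh \<beta> * (u \<bullet> w) \<ge> sinh \<alpha> * sinh \<beta> * (-1)"
      using uw nn by (intro mult_left_mono mult_nonneg_nonneg) auto
    then have "snd x * snd z - fst x \<bullet> fst z \<le> cosh (\<alpha> + \<beta>)"
      using Hyp u w by (simp add: polar_point_def cosh_add mult.assoc mult.left_commute)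
    moreover have "snd x * snd z - fst x \<bullet> fst z \<ge> 1"
      using qd_ge_0[OF x z] x z Hyp by (simp add: qd_eq carr_iff) (simp add: bil_def kap_def)
    ultimately have "arcosh (snd x * snd z - fst x \<bullet> fst z) \<le> arcosh (cosh (\<alpha> + \<beta>))"
      by (metis arcosh_less_iff_real cosh_real_ge_1 not_le)
    with nn Hyp show ?thesis by (simp add: sdist_def arcosh_cosh_real)
  qed
  then show ?thesis by (simp add: \<alpha>_def \<beta>_def)
qed

text \<open>The reflection exchanging the middle point with the origin reduces the claim to the
  preceding case.\<close>

lemma sdist_triangle:
  assumes x: "x \<in> carr X" and y: "y \<in> carr X" and z: "z \<in> carr X"
  shows "sdist X x z \<le> sdist X x y + sdist X y z"
proof -
  let ?r = "rfl X y orig"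
  have "sdist X (?r x) (?r z) \<le> sdist X (?r x) (?r y) + sdist X (?r z) (?r y)"
    using sdist_triangle_orig[of "?r x" X "?r z"] x z rfl_carr[OF y orig_carr] by (simp add: rfl_y y)
  then show ?thesis using x y z by (simp add: sdist_rfl_rfl sdist_commute)
qed

section \<open>Topology of the distance\<close>

lemma continuous_on_bil [continuous_intros]:
  "continuous_on S f \<Longrightarrow> continuous_on S g \<Longrightarrow> continuous_on S (\<lambda>x. bil X (f x) (g x))"
  unfolding bil_def by (intro continuous_intros)

lemma continuous_on_qd [continuous_intros]:
  "continuous_on S f \<Longrightarrow> continuous_on S g \<Longrightarrow> continuous_on S (\<lambda>x. qd X (f x) (g x))"
  unfolding qd_def by (intro continuous_intros)

lemma continuous_on_dfun: "continuous_on {q. 0 \<le> q \<and> (X = Sph \<longrightarrow> q \<le> 4)} (dfun X)"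
  unfolding dfun_def by (cases X) (auto intro!: continuous_intros)

lemma continuous_on_sdist:
  fixes f :: "'a::topological_space \<Rightarrow> 'n::finite point"
  assumes f: "continuous_on S f" and g: "continuous_on S g"
    and fc: "\<And>x. x \<in> S \<Longrightarrow> f x \<in> carr X" and gc: "\<And>x. x \<in> S \<Longrightarrow> g x \<in> carr X"
  shows "continuous_on S (\<lambda>x. sdist X (f x) (g x))"
proof -
  have "continuous_on S (\<lambda>x. dfun X (qd X (f x) (g x)))"
  proof (rule continuous_on_compose2[OF continuous_on_dfun])
    show "continuous_on S (\<lambda>x. qd X (f x) (g x))" using f g by (rule continuous_on_qd)
    show "(\<lambda>x. qd X (f x) (g x)) ` S \<subseteq> {q. 0 \<le> q \<and> (X = Sph \<longrightarrow> q \<le> 4)}"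
      using fc gc by (auto simp: qd_ge_0 qd_le_4)
  qed
  then show ?thesis by (rule continuous_on_eq) (simp add: sdist_qd fc gc)
qed

lemma continuous_on_polar_point: "continuous_on UNIV (polar_point X)"
  unfolding polar_point_def case_prod_beta by (cases X) (auto intro!: continuous_intros)

lemma closed_cball: "closed {x \<in> carr X. sdist X x orig \<le> R}"
  by (rule continuous_closed_preimage[of "carr X" "\<lambda>x. sdist X x orig" "{..R}", unfolded vimage_def,
      simplified Int_def mem_Collect_eq atMost_iff])
     (auto intro!: continuous_on_sdist continuous_intros closed_carr)

text \<open>Polar coordinates cover the ball by the image of a compact box; intersecting with the
  closed ball avoids computing distances for radii beyond \<pi> on the sphere.\<close>

lemma compact_cball: "compact {x \<in> carr X :: 'n::finite point set. sdist X x orig \<le> R}"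
proof (rule compact_Int_closed[OF _ closed_cball, THEN back_subst[of compact]])
  show "compact (polar_point X ` ({0..R} \<times> sphere (0::real^'n) 1))"
    by (intro compact_continuous_image compact_Times compact_Icc compact_sphere
        continuous_on_subset[OF continuous_on_polar_point]) simp
  show "polar_point X ` ({0..R} \<times> sphere (0::real^'n) 1) \<inter> {x \<in> carr X. sdist X x orig \<le> R} =
    {x \<in> carr X. sdist X x orig \<le> R}"
  proof (intro equalityI subsetI IntI)
    fix x :: "'n point" assume x: "x \<in> {x \<in> carr X. sdist X x orig \<le> R}"
    then obtain u where u: "norm u = 1" "x = polar_point X (sdist X x orig, u)"
      using polar_ex by blast
    have "(sdist X x orig, u) \<in> {0..R} \<times> sphere (0::real^'n) 1"
      using x u(1) sdist_nonneg[of x X orig] by simp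
    then show "x \<in> polar_point X ` ({0..R} \<times> sphere (0::real^'n) 1)"
      using u(2) by (rule image_eqI[rotated])
  qed simp_all
qed

lemma Cc_plus_bounded_support:
  fixes f :: "'n::finite point \<Rightarrow> real"
  assumes "f \<in> Cc_plus X"
  obtains L where "L \<ge> 0" "\<And>x. x \<in> carr X \<Longrightarrow> f x \<noteq> 0 \<Longrightarrow> sdist X x orig \<le> L"
proof -
  let ?K = "closure {x \<in> carr X. f x \<noteq> 0}"
  have K: "compact ?K" using assms by (simp add: Cc_plus_def)
  have sub: "?K \<subseteq> carr X" by (rule closure_minimal[OF _ closed_carr]) auto
  then have "continuous_on ?K (\<lambda>x. sdist X x orig)"
    by (intro continuous_on_sdist continuous_intros) auto
  then have "compact ((\<lambda>x. sdist X x orig) ` ?K)" using K by (rule compact_continuous_image)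
  then have "bdd_above ((\<lambda>x. sdist X x orig) ` ?K)"
    by (intro bounded_imp_bdd_above compact_imp_bounded)
  then obtain L where L: "\<And>x. x \<in> ?K \<Longrightarrow> sdist X x orig \<le> L" unfolding bdd_above_def by blast
  show ?thesis
  proof (rule that[of "max L 0"])
    fix x assume "x \<in> carr X" "f x \<noteq> 0"
    then have "x \<in> ?K" by (intro closure_subset[THEN subsetD]) simp
    from L[OF this] show "sdist X x orig \<le> max L 0" by simp
  qed simp
qed

text \<open>The carrier need not be compact, but of two close points with different values one lies
  in the support and the other within distance 1 of it, so a sequence of counterexamples stays in a
  compact ball. The modulus is taken in \<open>sdist\<close>, the distance that reflections
  preserve.\<close>

lemma uniformly_continuous_of_support:
  fixes f :: "'n::finite point \<Rightarrow> real"
  assumes cont: "continuous_on (carr X) f"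
    and L: "\<And>x. x \<in> carr X \<Longrightarrow> f x \<noteq> 0 \<Longrightarrow> sdist X x orig \<le> L" and e: "e > 0"
  shows "\<exists>r>0. \<forall>x\<in>carr X. \<forall>y\<in>carr X. sdist X x y < r \<longrightarrow> \<bar>f x - f y\<bar> \<le> e"
proof (rule ccontr)
  assume neg: "\<not> ?thesis"
  let ?K = "{x \<in> carr X :: 'n point set. sdist X x orig \<le> L + 1}"
  have "\<exists>x y. x \<in> ?K \<and> y \<in> ?K \<and> sdist X x y < 1 / real (Suc n) \<and> \<bar>f x - f y\<bar> > e" for n
  proof -
    have n: "1 / real (Suc n) > 0" "1 / real (Suc n) \<le> 1" by simp_all
    with neg have "\<exists>x\<in>carr X. \<exists>y\<in>carr X. sdist X x y < 1 / real (Suc n) \<and> \<not> \<bar>f x - f y\<bar> \<le> e"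
      by blast
    then obtain x y where xy: "x \<in> carr X" "y \<in> carr X" "sdist X x y < 1 / real (Suc n)" "\<bar>f x - f y\<bar> > e"
      unfolding not_le by blast
    have lt: "sdist X x y \<le> 1" "sdist X y x \<le> 1"
      using xy(3) n(2) sdist_commute[of X x y] by linarith+
    have "f x \<noteq> 0 \<or> f y \<noteq> 0" using xy(4) e by auto
    then have "sdist X x orig \<le> L \<or> sdist X y orig \<le> L" using L xy(1,2) by blast
    then have "sdist X x orig \<le> L + 1 \<and> sdist X y orig \<le> L + 1"
      using sdist_triangle[OF xy(1,2) orig_carr] sdist_triangle[OF xy(2,1) orig_carr] lt by linarith
    with xy show ?thesis by blast
  qed
  from choice[OF allI[OF this]] obtain x where "\<forall>n. \<exists>y. x n \<in> ?K \<and> y \<in> ?K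
      \<and> sdist X (x n) y < 1 / real (Suc n) \<and> \<bar>f (x n) - f y\<bar> > e" ..
  from choice[OF this] obtain y where xy': "\<forall>n. x n \<in> ?K \<and> y n \<in> ?K
      \<and> sdist X (x n) (y n) < 1 / real (Suc n) \<and> \<bar>f (x n) - f (y n)\<bar> > e" ..
  then have xy: "x n \<in> ?K" "y n \<in> ?K" "sdist X (x n) (y n) < 1 / real (Suc n)"
      "\<bar>f (x n) - f (y n)\<bar> > e" for n by blast+
  have "compact (?K \<times> ?K)" by (intro compact_Times compact_cball)
  from this[unfolded compact_def, rule_format, of "\<lambda>n. (x n, y n)"]
  obtain l r where l: "l \<in> ?K \<times> ?K" and r: "strict_mono r"
      and lim: "((\<lambda>n. (x n, y n)) \<circ> r) \<longlonglongrightarrow> l"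
    using SigmaI[OF xy(1,2)] by blast
  have limx: "(\<lambda>n. x (r n)) \<longlonglongrightarrow> fst l" and limy: "(\<lambda>n. y (r n)) \<longlonglongrightarrow> snd l"
    using tendsto_fst[OF lim] tendsto_snd[OF lim] by (simp_all add: o_def)
  have lc: "fst l \<in> carr X" "snd l \<in> carr X" using l by (auto simp: mem_Times_iff)
  have xc: "x n \<in> carr X" "y n \<in> carr X" for n using xy(1,2)[of n] by auto
  have "continuous_on (carr X \<times> carr X) (\<lambda>p. sdist X (fst p) (snd p))"
    by (intro continuous_on_sdist continuous_intros) (auto simp: mem_Times_iff)
  then have "(\<lambda>n. sdist X (fst (x (r n), y (r n))) (snd (x (r n), y (r n)))) \<longlonglongrightarrow> sdist X (fst l) (snd l)"
    by (rule continuous_on_tendsto_compose[OF _ lim[unfolded o_def]])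
       (use lc xc in \<open>auto simp: mem_Times_iff\<close>)
  then have "(\<lambda>n. sdist X (x (r n)) (y (r n))) \<longlonglongrightarrow> sdist X (fst l) (snd l)" by simp
  moreover have "(\<lambda>n. sdist X (x (r n)) (y (r n))) \<longlonglongrightarrow> 0"
  proof (rule tendsto_sandwich[OF _ _ tendsto_const])
    show "(\<lambda>n. 1 / real (Suc (r n))) \<longlonglongrightarrow> 0"
      using LIMSEQ_subseq_LIMSEQ[OF LIMSEQ_inverse_real_of_nat r] by (simp add: o_def inverse_eq_divide)
  qed (intro always_eventually allI sdist_nonneg xc less_imp_le[OF xy(3)])+
  ultimately have "sdist X (fst l) (snd l) = 0" by (rule LIMSEQ_unique)
  then have eq: "fst l = snd l" using sdist_pos[OF lc] by fastforce
  have "(\<lambda>n. f (x (r n))) \<longlonglongrightarrow> f (fst l)" "(\<lambda>n. f (y (r n))) \<longlonglongrightarrow> f (snd l)"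
    by (rule continuous_on_tendsto_compose[OF cont limx] continuous_on_tendsto_compose[OF cont limy];
        use lc xc in simp)+
  then have "(\<lambda>n. \<bar>f (x (r n)) - f (y (r n))\<bar>) \<longlonglongrightarrow> \<bar>f (fst l) - f (snd l)\<bar>"
    by (intro tendsto_intros)
  then have "\<bar>f (fst l) - f (snd l)\<bar> \<ge> e"
    by (rule LIMSEQ_le_const) (use xy(4) in \<open>auto intro!: exI[of _ 0] less_imp_le\<close>)
  with eq e show False by simp
qed

text \<open>Lets continuity of a polarized function follow from its modulus, with no gluing along
  the mirror.\<close>

lemma continuous_on_of_modulus:
  fixes f :: "'n::finite point \<Rightarrow> real"
  assumes "\<And>e. e > 0 \<Longrightarrow> \<exists>r>0. \<forall>x\<in>carr X. \<forall>y\<in>carr X. sdist X x y < r \<longrightarrow> \<bar>f x - f y\<bar> \<le> e"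
  shows "continuous_on (carr X) f"
proof (rule continuous_onI)
  fix x :: "'n point" and e :: real assume x: "x \<in> carr X" and e: "e > 0"
  obtain r where r: "r > 0" "\<And>x y. x \<in> carr X \<Longrightarrow> y \<in> carr X \<Longrightarrow> sdist X x y < r \<Longrightarrow> \<bar>f x - f y\<bar> \<le> e"
    using assms[OF e] by blast
  have "continuous_on (carr X) (\<lambda>y. sdist X y x)"
    using x by (intro continuous_on_sdist continuous_intros)
  then obtain d where d: "d > 0" "\<And>y. y \<in> carr X \<Longrightarrow> dist y x < d \<Longrightarrow> dist (sdist X y x) (sdist X x x) < r"
    using x r(1) unfolding continuous_on_iff by blast
  show "\<exists>d>0. \<forall>x'\<in>carr X. dist x' x < d \<longrightarrow> dist (f x') (f x) \<le> e"
  proof (intro exI[of _ d] conjI ballI impI d(1))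
    fix y assume y: "y \<in> carr X" "dist y x < d"
    have "sdist X y x < r" using d(2)[OF y] x by (simp add: dist_real_def)
    then show "dist (f y) (f x) \<le> e" using r(2)[OF y(1) x] by (simp add: dist_real_def)
  qed
qed

section \<open>Polarization\<close>

text \<open>Polarization along any map. It will be used with the linear \<open>rfl\<close>, an
  explicit total map that agrees with \<open>refl_at\<close> on the carrier for admissible
  radii.\<close>

definition polg :: "space_form \<Rightarrow> ('n::finite point \<Rightarrow> 'n point) \<Rightarrow> ('n point \<Rightarrow> real) \<Rightarrow> 'n point \<Rightarrow> real" where
  "polg X \<sigma> f x = (if sdist X x orig \<le> sdist X (\<sigma> x) orig
      then max (f x) (f (\<sigma> x)) else min (f x) (f (\<sigma> x)))"

lemma polarize_polg: "polarize X \<omega> = polg X (refl_at X \<omega>)"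
  by (intro ext) (simp add: polarize_def polg_def)

text \<open>For \<open>h \<le> k\<close> the third summand is exactly what is saved by placing the
  larger value at the smaller distance: the drop of the moment on one mirror pair.\<close>

lemma exchange_identity:
  fixes a b h k :: real
  shows "max a b * h + min a b * k + max 0 (b - a) * (k - h) = a * h + b * k"
  by (simp add: max_def min_def algebra_simps)

context
  fixes X :: space_form and p :: "'n::finite point" and \<sigma> :: "'n point \<Rightarrow> 'n point"
  assumes p: "p \<in> carr X"
  defines "\<sigma> \<equiv> rfl X orig p"
begin

lemma sig_carr: "x \<in> carr X \<Longrightarrow> \<sigma> x \<in> carr X"
  and sig_sig: "\<sigma> (\<sigma> x) = x"
  and sig_iso: "x \<in> carr X \<Longrightarrow> y \<in> carr X \<Longrightarrow> sdist X (\<sigma> x) (\<sigma> y) = sdist X x y"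
  and sig_swap: "x \<in> carr X \<Longrightarrow> y \<in> carr X \<Longrightarrow> sdist X (\<sigma> x) y = sdist X x (\<sigma> y)"
  unfolding \<sigma>_def by (simp_all add: p rfl_carr sdist_rfl_rfl sdist_rfl_swap)

lemma near_iff:
  assumes "x \<in> carr X"
  shows "sdist X x orig \<le> sdist X (\<sigma> x) orig \<longleftrightarrow> lam X orig p x \<le> 0"
    and "sdist X (\<sigma> x) orig \<le> sdist X x orig \<longleftrightarrow> lam X orig p x \<ge> 0"
proof -
  have e: "sdist X (\<sigma> x) orig = sdist X x p"
    using sig_swap[OF assms orig_carr] by (simp add: \<sigma>_def rfl_y p)
  show "sdist X x orig \<le> sdist X (\<sigma> x) orig \<longleftrightarrow> lam X orig p x \<le> 0"
    "sdist X (\<sigma> x) orig \<le> sdist X x orig \<longleftrightarrow> lam X orig p x \<ge> 0"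
    unfolding e using sdist_bisector[OF orig_carr p assms]
    by (cases "orig = p", simp_all add: lam_def bil_def)+
qed

lemma polg_pair:
  assumes x: "x \<in> carr X" and le: "sdist X x orig \<le> sdist X (\<sigma> x) orig"
  shows "polg X \<sigma> f x = max (f x) (f (\<sigma> x))" "polg X \<sigma> f (\<sigma> x) = min (f x) (f (\<sigma> x))"
proof -
  show "polg X \<sigma> f x = max (f x) (f (\<sigma> x))" using le by (simp add: polg_def)
  show "polg X \<sigma> f (\<sigma> x) = min (f x) (f (\<sigma> x))"
  proof (cases "sdist X (\<sigma> x) orig \<le> sdist X x orig")
    case True
    \<comment> \<open>A tie of distances means that \<open>x\<close> lies on the mirror.\<close>
    then have "lam X orig p x = 0" using le near_iff[OF x] by simp
    then have "\<sigma> x = x" by (simp add: \<sigma>_def rfl_def)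
    then show ?thesis by (simp add: polg_def)
  next
    case False
    then show ?thesis by (simp add: polg_def sig_sig min.commute)
  qed
qed

text \<open>The maximum can import a value only from a mirror image that is no closer to the origin,
  and the minimum of nonnegative values is nonzero only where \<open>f\<close> is.\<close>

lemma polg_support:
  assumes "\<And>x. x \<in> carr X \<Longrightarrow> f x \<ge> 0" "\<And>x. x \<in> carr X \<Longrightarrow> f x \<noteq> 0 \<Longrightarrow> sdist X x orig \<le> L"
    and x: "x \<in> carr X" and nz: "polg X \<sigma> f x \<noteq> 0"
  shows "sdist X x orig \<le> L"
proof (cases "sdist X x orig \<le> sdist X (\<sigma> x) orig")
  case True
  then have "max (f x) (f (\<sigma> x)) \<noteq> 0" using nz by (simp add: polg_def)
  then have "f x \<noteq> 0 \<or> f (\<sigma> x) \<noteq> 0" by auto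
  then show ?thesis using assms(2)[OF x] assms(2)[OF sig_carr[OF x]] True by auto
next
  case False
  then have "min (f x) (f (\<sigma> x)) \<noteq> 0" using nz by (simp add: polg_def)
  then have "f x \<noteq> 0" using assms(1)[OF x] assms(1)[OF sig_carr[OF x]] by (auto simp: min_def split: if_splits)
  then show ?thesis using assms(2)[OF x] by simp
qed

text \<open>If \<open>x\<close> and \<open>y\<close> are on the same side, two maxima or two minima
  are compared and the pairs \<open>(x, y)\<close> and their images suffice. On opposite sides the
  crossed pairs are no farther apart, so all four differences of values are at most
  \<open>e\<close>.\<close>

lemma polg_modulus:
  assumes m: "\<And>x y. x \<in> carr X \<Longrightarrow> y \<in> carr X \<Longrightarrow> sdist X x y < r \<Longrightarrow> \<bar>f x - f y\<bar> \<le> e"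
    and x: "x \<in> carr X" and y: "y \<in> carr X" and r: "sdist X x y < r"
  shows "\<bar>polg X \<sigma> f x - polg X \<sigma> f y\<bar> \<le> e"
proof -
  have sx: "\<sigma> x \<in> carr X" and sy: "\<sigma> y \<in> carr X" using x y sig_carr by auto
  have 1: "\<bar>f x - f y\<bar> \<le> e" using m x y r by auto
  have 2: "\<bar>f (\<sigma> x) - f (\<sigma> y)\<bar> \<le> e" using m[OF sx sy] sig_iso[OF x y] r by simp
  have 3: "\<bar>f x - f (\<sigma> y)\<bar> \<le> e \<and> \<bar>f (\<sigma> x) - f y\<bar> \<le> e" if "sdist X x (\<sigma> y) \<le> sdist X x y"
    using m[OF x sy] m[OF sx y] sig_swap[OF x y] that r by simp
  have half: "sdist X x (\<sigma> y) \<le> sdist X x y" if "lam X orig p x * lam X orig p y \<le> 0"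
    using sdist_half_space[OF orig_carr p x sy] that sig_sig[of y] lam_rfl[OF orig_carr p, of y]
    by (simp add: \<sigma>_def)
  show ?thesis
  proof (cases "lam X orig p x \<le> 0"; cases "lam X orig p y \<le> 0")
    assume a: "lam X orig p x \<le> 0" "lam X orig p y \<le> 0"
    show ?thesis unfolding polg_def near_iff(1)[OF x] near_iff(1)[OF y] using a 1 2 by (simp add: max_def abs_le_iff)
  next
    assume a: "lam X orig p x \<le> 0" "\<not> lam X orig p y \<le> 0"
    then have "lam X orig p x * lam X orig p y \<le> 0" by (simp add: mult_le_0_iff)
    from 3[OF half[OF this]] show ?thesis
      unfolding polg_def near_iff(1)[OF x] near_iff(1)[OF y] using a 1 2 by (simp add: max_def min_def)
  next
    assume a: "\<not> lam X orig p x \<le> 0" "lam X orig p y \<le> 0"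
    then have "lam X orig p x * lam X orig p y \<le> 0" by (simp add: mult_le_0_iff)
    from 3[OF half[OF this]] show ?thesis
      unfolding polg_def near_iff(1)[OF x] near_iff(1)[OF y] using a 1 2 by (simp add: max_def min_def)
  next
    assume a: "\<not> lam X orig p x \<le> 0" "\<not> lam X orig p y \<le> 0"
    show ?thesis unfolding polg_def near_iff(1)[OF x] near_iff(1)[OF y] using a 1 2 by (simp add: min_def abs_le_iff)
  qed
qed

lemma polg_nonexpansive:
  assumes "\<And>x. x \<in> carr X \<Longrightarrow> \<bar>f x - g x\<bar> \<le> e" and x: "x \<in> carr X"
  shows "\<bar>polg X \<sigma> f x - polg X \<sigma> g x\<bar> \<le> e"
  using assms(1)[OF x] assms(1)[OF sig_carr[OF x]] unfolding polg_def
  by (auto simp: max_def min_def abs_le_iff)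

lemma polg_radial:
  assumes "\<And>x y. x \<in> carr X \<Longrightarrow> y \<in> carr X \<Longrightarrow> sdist X x orig \<le> sdist X y orig \<Longrightarrow> h y \<le> h x"
    and x: "x \<in> carr X"
  shows "polg X \<sigma> h x = (h x :: real)"
proof (cases "sdist X x orig \<le> sdist X (\<sigma> x) orig")
  case True then show ?thesis using assms(1)[OF x sig_carr[OF x]] by (simp add: polg_def max_def)
next
  case False then show ?thesis using assms(1)[OF sig_carr[OF x] x] by (simp add: polg_def min_def)
qed

text \<open>On a mirror pair polarization permutes the two values. Together with invariance of
  volume this yields equimeasurability without cutting integrals along half-spaces.\<close>

lemma polg_level_sum:
  assumes x: "x \<in> carr X"
  shows "indicator {y. polg X \<sigma> f y > t} x + indicator {y. polg X \<sigma> f y > t} (\<sigma> x)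
    = (indicator {y. f y > t} x + indicator {y. f y > t} (\<sigma> x) :: ennreal)"
proof (cases "sdist X x orig \<le> sdist X (\<sigma> x) orig")
  case True
  from polg_pair[OF x this, of f] show ?thesis by (auto simp: indicator_def max_def min_def)
next
  case False
  then have le: "sdist X (\<sigma> x) orig \<le> sdist X (\<sigma> (\<sigma> x)) orig" by (simp add: sig_sig)
  from polg_pair[OF sig_carr[OF x] le, of f] show ?thesis by (auto simp: indicator_def max_def min_def sig_sig)
qed

text \<open>The condition is demanded for \<open>c > 0\<close> only, so that one statement serves
  both the points where a gain is claimed and, with \<open>c = 0\<close>, all others.\<close>

lemma polg_moment_pair:
  assumes x: "x \<in> carr X" 
    and c: "c > 0 \<Longrightarrow> sdist X x orig < sdist X (\<sigma> x) orig \<and> c \<le> (f (\<sigma> x) - f x) * (sdist X (\<sigma> x) orig - sdist X x orig)"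
  shows "polg X \<sigma> f x * sdist X x orig + polg X \<sigma> f (\<sigma> x) * sdist X (\<sigma> x) orig + c
    \<le> f x * sdist X x orig + f (\<sigma> x) * sdist X (\<sigma> x) orig"
proof (cases "sdist X x orig \<le> sdist X (\<sigma> x) orig")
  case True
  have "c \<le> max 0 (f (\<sigma> x) - f x) * (sdist X (\<sigma> x) orig - sdist X x orig)"
  proof (cases "c > 0")
    case c0: True
    have "(f (\<sigma> x) - f x) * (sdist X (\<sigma> x) orig - sdist X x orig)
       \<le> max 0 (f (\<sigma> x) - f x) * (sdist X (\<sigma> x) orig - sdist X x orig)"
      using True by (intro mult_right_mono) auto
    with c[OF c0, THEN conjunct2] show ?thesis by linarith
  next
    case False
    have "0 \<le> max 0 (f (\<sigma> x) - f x) * (sdist X (\<sigma> x) orig - sdist X x orig)"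
      using True by (intro mult_nonneg_nonneg) auto
    with False show ?thesis by simp
  qed
  then show ?thesis
    using exchange_identity[of "f x" "f (\<sigma> x)" "sdist X x orig" "sdist X (\<sigma> x) orig"]
    unfolding polg_pair[OF x True] by linarith
next
  case False
  then have le: "sdist X (\<sigma> x) orig \<le> sdist X (\<sigma> (\<sigma> x)) orig" by (simp add: sig_sig)
  have "c \<le> 0" using c False by fastforce
  moreover have "0 \<le> max 0 (f x - f (\<sigma> x)) * (sdist X x orig - sdist X (\<sigma> x) orig)"
    using False by (intro mult_nonneg_nonneg) auto
  ultimately show ?thesis
    using exchange_identity[of "f (\<sigma> x)" "f x" "sdist X (\<sigma> x) orig" "sdist X x orig"]
      polg_pair[OF sig_carr[OF x] le, of f] by (simp add: sig_sig)
qed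

end

section \<open>Invariance of volume\<close>

lemma emeasure_lborel_open_pos:
  assumes "open U" "U \<noteq> {}"
  shows "emeasure lborel U > 0"
proof (rule ccontr)
  assume "\<not> ?thesis"
  then have "U \<in> null_sets lborel" using assms(1) by (intro null_setsI) auto
  then have "negligible U" by (simp add: negligible_iff_null_sets null_sets_completionI)
  with open_not_negligible[OF assms] show False ..
qed

lemma ennreal_square_cancel:
  fixes a b :: ennreal
  assumes "a * a = b * b" "b < \<infinity>"
  shows "a = b"
proof -
  obtain r where r: "b = ennreal r" "r \<ge> 0" using assms(2) by (cases b) auto
  with assms have "a < \<infinity>" by (cases a) (auto simp: ennreal_mult[symmetric])
  then obtain q where q: "a = ennreal q" "q \<ge> 0" by (cases a) auto
  have "q * q = r * r" using assms(1) r q by (simp add: ennreal_mult[symmetric])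
  then have "q = r" using r q by (simp add: power2_eq_iff_nonneg[unfolded power2_eq_square])
  then show ?thesis by (simp add: r q)
qed

lemma nn_integral_lborel_reflect:
  fixes g :: "'a::euclidean_space \<Rightarrow> ennreal"
  assumes [measurable]: "g \<in> borel_measurable borel"
  shows "(\<integral>\<^sup>+x. g (t - x) \<partial>lborel) = (\<integral>\<^sup>+x. g x \<partial>lborel)"
proof -
  have eq: "lborel = density (distr lborel borel (\<lambda>x. t - x)) (\<lambda>_. 1)"
    using lborel_affine[of "-1" t] by simp
  have "(\<integral>\<^sup>+x. g x \<partial>lborel) = (\<integral>\<^sup>+x. g x \<partial>density (distr lborel borel (\<lambda>x. t - x)) (\<lambda>_. 1))"
    by (rule arg_cong[OF eq, of "\<lambda>M. nn_integral M g"])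
  also have "\<dots> = (\<integral>\<^sup>+x. g (t - x) \<partial>lborel)"
    by (simp add: nn_integral_density nn_integral_distr)
  finally show ?thesis by simp
qed

text \<open>Uniqueness of Haar measure: the image of Lebesgue measure under \<open>T\<close> is a multiple of Lebesgue
  measure, and the factor squares to \<open>1\<close>.\<close>

lemma emeasure_linear_involution:
  fixes T :: "'a::euclidean_space \<Rightarrow> 'a"
  assumes T: "linear T" and inv: "\<And>x. T (T x) = x" and A: "A \<in> sets borel"
  shows "emeasure lborel (T -` A) = emeasure lborel A"
proof -
  have Tm [measurable]: "T \<in> borel_measurable borel"
    by (intro borel_measurable_continuous_onI linear_continuous_on linear_conv_bounded_linear[THEN iffD1] T)
  let ?nu = "\<lambda>A. emeasure lborel (T -` A)"
  have vim [measurable]: "T -` A \<in> sets borel" if "A \<in> sets borel" for A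
    using measurable_sets[OF Tm that] by simp
  have nu: "?nu A = (\<integral>\<^sup>+x. indicator A (T x) \<partial>lborel)" if "A \<in> sets borel" for A
  proof -
    have "?nu A = (\<integral>\<^sup>+x. indicator (T -` A) x \<partial>lborel)" using vim[OF that] by simp
    then show ?thesis by (simp add: indicator_vimage)
  qed
  have nur: "(\<integral>\<^sup>+x. g (y - T x) \<partial>lborel) = (\<integral>\<^sup>+x. g (T x) \<partial>lborel)"
    if [measurable]: "g \<in> borel_measurable borel" for g :: "'a \<Rightarrow> ennreal" and y
  proof -
    have "y - T x = T (T y - x)" for x using inv by (simp add: linear_diff[OF T])
    then show ?thesis using nn_integral_lborel_reflect[of "\<lambda>x. g (T x)" "T y"] by simp
  qed
  \<comment> \<open>Both sides compute the double integral of
    \<open>indicator A (T x) * indicator C (T x - y)\<close>. Between the two uses of Fubini,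
    \<open>T x\<close> is replaced by \<open>y - T x\<close>, which is allowed by
    \<open>nur\<close>.\<close>
  have key: "?nu A * emeasure lborel C = emeasure lborel A * ?nu C"
    if [measurable]: "A \<in> sets borel" "C \<in> sets borel" for A C
  proof -
    have "?nu A * emeasure lborel C = (\<integral>\<^sup>+x. indicator A (T x) * (\<integral>\<^sup>+y. indicator C y \<partial>lborel) \<partial>lborel)"
      by (simp add: nu nn_integral_multc)
    also have "\<dots> = (\<integral>\<^sup>+x. (\<integral>\<^sup>+y. indicator A (T x) * indicator C (T x - y) \<partial>lborel) \<partial>lborel)"
      by (simp add: nn_integral_lborel_reflect nn_integral_cmult)
    also have "\<dots> = (\<integral>\<^sup>+y. (\<integral>\<^sup>+x. indicator A (T x) * indicator C (T x - y) \<partial>lborel) \<partial>lborel)"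
      by (rule lborel_pair.Fubini') measurable
    also have "\<dots> = (\<integral>\<^sup>+y. (\<integral>\<^sup>+x. indicator A (y - T x) * indicator C (- T x) \<partial>lborel) \<partial>lborel)"
      using nur[of "\<lambda>z. indicator A z * indicator C (z - y)" y for y] by simp
    also have "\<dots> = (\<integral>\<^sup>+x. (\<integral>\<^sup>+y. indicator A (y - T x) * indicator C (- T x) \<partial>lborel) \<partial>lborel)"
      by (rule lborel_pair.Fubini') measurable
    also have "\<dots> = (\<integral>\<^sup>+x. emeasure lborel A * indicator C (- T x) \<partial>lborel)"
    proof -
      have "(\<integral>\<^sup>+y. indicator A (y - c) \<partial>lborel) = emeasure lborel A" for c
        using nn_integral_lborel_reflect[of "\<lambda>y. indicator A (y - c)" c]
          nn_integral_lborel_reflect[of "indicator A :: 'a \<Rightarrow> ennreal" 0] by simp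
      then show ?thesis by (simp add: nn_integral_multc)
    qed
    also have "\<dots> = emeasure lborel A * ?nu C"
      using nur[of "indicator C" 0] by (simp add: nn_integral_cmult nu)
    finally show ?thesis .
  qed
  define C :: "'a set" where "C = ball 0 1"
  have C [measurable]: "C \<in> sets borel" by (simp add: C_def)
  have fin: "emeasure lborel C < \<infinity>" unfolding C_def by (rule emeasure_lborel_ball_finite)
  have pos: "emeasure lborel C > 0"
    unfolding C_def by (intro emeasure_lborel_open_pos) auto
  \<comment> \<open>In \<open>key\<close> take the preimage of \<open>C\<close> as the first set: as
    \<open>T\<close> is an involution, the two measures trade places.\<close>
  have "?nu C * ?nu C = emeasure lborel C * emeasure lborel C"
    using key[of "T -` C" C] by (simp add: vimage_def inv)
  then have "?nu C = emeasure lborel C" using fin by (rule ennreal_square_cancel)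
  then show ?thesis using key[OF A C] pos fin
    by (auto simp: ennreal_mult_cancel_left mult.commute[of _ "emeasure lborel C"])
qed

text \<open>Over a fixed \<open>v\<close> of norm \<open>c\<close>, height \<open>t\<close> and cone
  radius \<open>r\<close> satisfy \<open>r\<^sup>2 = t\<^sup>2 + c\<^sup>2\<close> on the sphere and
  \<open>t\<^sup>2 = r\<^sup>2 + c\<^sup>2\<close> on the hyperboloid, so one substitution serves
  both. It is made on compact intervals and extended by monotone convergence.\<close>

lemma nn_integral_sqrt_substitution:
  fixes G :: "real \<Rightarrow> ennreal"
  assumes c: "c > 0" and [measurable]: "G \<in> borel_measurable borel"
  shows "(\<integral>\<^sup>+z. G z * indicator {c..} z \<partial>lborel)
    = (\<integral>\<^sup>+y. G (sqrt (y\<^sup>2 + c\<^sup>2)) * ennreal (y / sqrt (y\<^sup>2 + c\<^sup>2)) * indicator {0..} y \<partial>lborel)"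
proof -
  let ?g = "\<lambda>y. sqrt (y\<^sup>2 + c\<^sup>2)" and ?g' = "\<lambda>y. y / sqrt (y\<^sup>2 + c\<^sup>2)"
  have p: "y\<^sup>2 + c\<^sup>2 > 0" for y using c by (simp add: add_nonneg_pos)
  have *: "(\<integral>\<^sup>+z. G z * indicator {c..?g (real (Suc k))} z \<partial>lborel)
     = (\<integral>\<^sup>+y. G (?g y) * ennreal (?g' y) * indicator {0..real (Suc k)} y \<partial>lborel)" for k
  proof -
    have "(\<integral>\<^sup>+z. G z * indicator {?g 0..?g (real (Suc k))} z \<partial>lborel)
      = (\<integral>\<^sup>+y. G (?g y) * ennreal (?g' y) * indicator {0..real (Suc k)} y \<partial>lborel)"
    proof (rule nn_integral_substitution_aux)
      fix y :: real
      show "(?g has_real_derivative ?g' y) (at y)"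
        using p[of y] by (auto intro!: derivative_eq_intros simp: field_simps)
      show "y \<in> {0..real (Suc k)} \<Longrightarrow> 0 \<le> ?g' y" by simp
    next
      show "continuous_on {0..real (Suc k)} ?g'"
        using p by (intro continuous_intros) (auto simp: less_imp_neq[THEN not_sym])
    qed simp_all
    then show ?thesis using c by simp
  qed
  have inc: "(\<Squnion>k. \<integral>\<^sup>+z. H z * indicator {a..b k} z \<partial>lborel) = (\<integral>\<^sup>+z. H z * indicator {a..} z \<partial>lborel)"
    if [measurable]: "H \<in> borel_measurable borel" and m: "mono b" and l: "\<And>x. \<exists>k. x \<le> b k"
    for H :: "real \<Rightarrow> ennreal" and a :: real and b :: "nat \<Rightarrow> real"
  proof -
    have bs: "b n \<le> b (Suc n)" for n using m by (simp add: monoD)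
    have "(\<integral>\<^sup>+z. (\<Squnion>k. H z * indicator {a..b k} z) \<partial>lborel) = (\<Squnion>k. \<integral>\<^sup>+z. H z * indicator {a..b k} z \<partial>lborel)"
      by (rule nn_integral_monotone_convergence_SUP)
         (auto intro!: incseq_SucI le_funI mult_left_mono simp: indicator_def dest: order_trans[OF _ bs])
    moreover have "(\<Squnion>k. H z * indicator {a..b k} z) = H z * indicator {a..} z" for z
    proof (rule antisym)
      show "(\<Squnion>k. H z * indicator {a..b k} z) \<le> H z * indicator {a..} z"
        by (rule SUP_least) (auto simp: indicator_def)
      obtain k where "z \<le> b k" using l by blast
      then show "H z * indicator {a..} z \<le> (\<Squnion>k. H z * indicator {a..b k} z)"
        by (intro SUP_upper2[of k]) (auto simp: indicator_def)
    qed
    ultimately show ?thesis by simp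
  qed
  have "mono (\<lambda>k. ?g (real (Suc k)))"
    by (intro monoI) (simp add: power_mono)
  moreover have "\<exists>k. x \<le> ?g (real (Suc k))" for x
  proof -
    obtain k where "x \<le> real k" using real_arch_simple by blast
    then have "x \<le> real (Suc k)" by simp
    also have "\<dots> = sqrt ((real (Suc k))\<^sup>2)" by simp
    also have "\<dots> \<le> ?g (real (Suc k))" by (intro real_sqrt_le_mono) simp
    finally show ?thesis by blast
  qed
  ultimately have 1: "(\<integral>\<^sup>+z. G z * indicator {c..} z \<partial>lborel)
     = (\<Squnion>k. \<integral>\<^sup>+z. G z * indicator {c..?g (real (Suc k))} z \<partial>lborel)"
    by (intro inc[symmetric]) simp_all
  have "\<exists>k. x \<le> real (Suc k)" for x using real_arch_simple[of x] by (metis nat_le_real_less less_imp_le order_trans of_nat_Suc of_nat_less_iff lessI)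
  then have 2: "(\<integral>\<^sup>+y. G (?g y) * ennreal (?g' y) * indicator {0..} y \<partial>lborel)
     = (\<Squnion>k. \<integral>\<^sup>+y. G (?g y) * ennreal (?g' y) * indicator {0..real (Suc k)} y \<partial>lborel)"
    by (intro inc[symmetric]) (auto simp: mono_def)
  show ?thesis unfolding 1 2 * ..
qed

section \<open>The cone over the carrier\<close>

lemma nn_integral_lborel_scale:
  fixes g :: "'a::euclidean_space \<Rightarrow> ennreal"
  assumes r: "r > 0" and [measurable]: "g \<in> borel_measurable borel"
  shows "(\<integral>\<^sup>+v. g (v /\<^sub>R r) \<partial>lborel) = ennreal (r ^ DIM('a)) * (\<integral>\<^sup>+v. g v \<partial>lborel)"
proof -
  have eq: "lborel = density (distr lborel borel (\<lambda>x::'a. r *\<^sub>R x)) (\<lambda>_. ennreal (r ^ DIM('a)))"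
    using lborel_affine[of r "0::'a"] r by (simp add: ennreal_power)
  have "(\<integral>\<^sup>+v. g (v /\<^sub>R r) \<partial>lborel)
      = (\<integral>\<^sup>+v. g (v /\<^sub>R r) \<partial>density (distr lborel borel (\<lambda>x. r *\<^sub>R x)) (\<lambda>_. ennreal (r ^ DIM('a))))"
    by (rule arg_cong[OF eq, of "\<lambda>M. nn_integral M (\<lambda>v. g (v /\<^sub>R r))"])
  also have "\<dots> = ennreal (r ^ DIM('a)) * (\<integral>\<^sup>+v. g v \<partial>lborel)"
    using r by (simp add: nn_integral_density nn_integral_distr nn_integral_cmult)
  finally show ?thesis .
qed

text \<open>The gauge of the cone \<open>ocone\<close>: homogeneous of degree 1 there and equal to 1
  on the carrier.\<close>

definition cone_rad :: "space_form \<Rightarrow> 'n::finite point \<Rightarrow> real" where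
  "cone_rad X x = (if X = Euc then snd x else sqrt \<bar>bil X x x\<bar>)"

definition ocone :: "space_form \<Rightarrow> 'n::finite point set" where
  "ocone X = {x. case X of Sph \<Rightarrow> x \<noteq> 0 | Euc \<Rightarrow> snd x > 0 | Hyp \<Rightarrow> bil X x x < 0 \<and> snd x > 0}"

definition prj :: "space_form \<Rightarrow> 'n::finite point \<Rightarrow> 'n point" where
  "prj X x = x /\<^sub>R cone_rad X x"

lemma cone_rad_scale:
  assumes "r > 0" "p \<in> carr X"
  shows "cone_rad X (r *\<^sub>R p) = r"
  using assms by (cases X) (simp_all add: cone_rad_def bil_simps carr_iff abs_mult real_sqrt_mult)

lemma ocone_cone_rad_pos: 
  assumes "x \<in> ocone X" shows "cone_rad X x > 0"
proof (cases X)
  case Sph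
  have "bil Sph x x = x \<bullet> x" by (simp add: bil_def kap_def inner_prod_def)
  then show ?thesis using assms Sph by (simp add: cone_rad_def ocone_def)
qed (use assms in \<open>simp_all add: cone_rad_def ocone_def\<close>)

lemma prj_carr:
  assumes "x \<in> ocone X" shows "prj X x \<in> carr X"
proof -
  have g: "cone_rad X x > 0" using ocone_cone_rad_pos[OF assms] .
  have bp: "bil X (prj X x) (prj X x) = bil X x x / (cone_rad X x * cone_rad X x)"
    by (simp add: prj_def bil_simps divide_inverse ac_simps)
  show ?thesis
  proof (cases X)
    case Euc then show ?thesis using g by (simp add: prj_def cone_rad_def carr_iff)
  next
    case Sph
    have "bil Sph x x = x \<bullet> x" by (simp add: bil_def kap_def inner_prod_def)
    then have "cone_rad X x * cone_rad X x = bil X x x" using Sph by (simp add: cone_rad_def)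
    then have "bil X (prj X x) (prj X x) = 1" using g unfolding bp by (metis divide_self less_irrefl mult_pos_pos)
    then show ?thesis using Sph by (simp add: carr_iff)
  next
    case Hyp
    then have b: "bil X x x < 0" "snd x > 0" using assms by (simp_all add: ocone_def)
    then have "cone_rad X x * cone_rad X x = - bil X x x" using Hyp by (simp add: cone_rad_def)
    then have "bil X (prj X x) (prj X x) = -1" using b unfolding bp by simp
    then show ?thesis using Hyp g b by (simp add: carr_iff prj_def)
  qed
qed

lemma cone_rad_prj: "x \<in> ocone X \<Longrightarrow> cone_rad X x *\<^sub>R prj X x = x"
  using ocone_cone_rad_pos[of x X] by (simp add: prj_def)

lemma ocone_scale:
  assumes "r > 0" "p \<in> carr X"
  shows "r *\<^sub>R p \<in> ocone X"
proof (cases X)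
  case Sph then show ?thesis using assms by (auto simp: ocone_def carr_def)
next
  case Euc then show ?thesis using assms by (simp add: ocone_def carr_iff)
next
  case Hyp then show ?thesis using assms by (simp add: ocone_def carr_iff bil_simps)
qed

lemma prj_scale: "r > 0 \<Longrightarrow> p \<in> carr X \<Longrightarrow> prj X (r *\<^sub>R p) = p"
  by (simp add: prj_def cone_rad_scale)

text \<open>A linear map preserving the carrier acts on a ray by acting on its carrier point, so it
  keeps the gauge and commutes with the projection.\<close>

lemma rfl_cone_rad:
  assumes y: "y \<in> carr X" and z: "z \<in> carr X" and x: "x \<in> ocone X"
  shows "rfl X y z x \<in> ocone X" "cone_rad X (rfl X y z x) = cone_rad X x"
    "prj X (rfl X y z x) = rfl X y z (prj X x)"
proof -
  have g: "cone_rad X x > 0" using ocone_cone_rad_pos[OF x] .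
  have p: "rfl X y z (prj X x) \<in> carr X" using rfl_carr[OF y z prj_carr[OF x]] .
  have eq: "rfl X y z x = cone_rad X x *\<^sub>R rfl X y z (prj X x)"
    using linear_scale[OF linear_rfl, of X y z "cone_rad X x" "prj X x"] cone_rad_prj[OF x] by simp
  show "rfl X y z x \<in> ocone X" "cone_rad X (rfl X y z x) = cone_rad X x"
    "prj X (rfl X y z x) = rfl X y z (prj X x)"
    unfolding eq using ocone_scale[OF g p] cone_rad_scale[OF g p] prj_scale[OF g p] by simp_all
qed

lemma rfl_ocone_iff:
  assumes y: "y \<in> carr X" and z: "z \<in> carr X"
  shows "rfl X y z x \<in> ocone X \<longleftrightarrow> x \<in> ocone X"
  using rfl_cone_rad(1)[OF y z, of x] rfl_cone_rad(1)[OF y z, of "rfl X y z x"] rfl_rfl[OF y z] by auto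

section \<open>Volume in charts and as Lebesgue measure of the cone\<close>

lemma borel_measurable_graph_height [measurable]:
  "graph_height X \<in> borel_measurable (borel :: (real^'n::finite) measure)"
proof -
  have "graph_height X = (\<lambda>v :: real^'n. case X of Sph \<Rightarrow> sqrt (1 - (norm v)\<^sup>2) | Euc \<Rightarrow> 1 | Hyp \<Rightarrow> sqrt (1 + (norm v)\<^sup>2))"
    by (simp add: graph_height_def fun_eq_iff)
  then show ?thesis by (cases X) simp_all
qed

lemma chart_dom_borel [measurable]: "chart_dom X \<in> sets (borel :: (real^'n::finite) measure)"
  by (simp add: chart_dom_def)

lemma finite_sheets: "finite (sheets X)"
  by (simp add: sheets_def)

definition chart_weight :: "space_form \<Rightarrow> (real^'n::finite) \<Rightarrow> ennreal" where
  "chart_weight X v = ennreal (indicator (chart_dom X) v / graph_height X v)"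

lemma borel_measurable_chart_weight [measurable]: "chart_weight X \<in> borel_measurable borel"
  unfolding chart_weight_def by measurable

lemma sets_vol [simp, measurable_cong]: "sets (vol X) = sets borel"
  by (simp add: vol_def)

lemma space_vol [simp]: "space (vol X) = UNIV"
  by (simp add: vol_def)

lemma nn_integral_vol:
  fixes f :: "'n::finite point \<Rightarrow> ennreal"
  assumes [measurable]: "f \<in> borel_measurable borel"
  shows "(\<integral>\<^sup>+x. f x \<partial>vol X)
    = (\<Sum>s\<in>sheets X. \<integral>\<^sup>+v. chart_weight X v * f (v, s * graph_height X v) \<partial>lborel)"
proof -
  let ?S = "count_space (sheets X)" and ?g = "\<lambda>(v, s). (v, s * graph_height X v)"
  interpret S: sigma_finite_measure ?S by (rule sigma_finite_measure_count_space_finite[OF finite_sheets])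
  have s [measurable]: "(\<lambda>s. s) \<in> borel_measurable ?S" by simp
  have g [measurable]: "?g \<in> borel_measurable (lborel \<Otimes>\<^sub>M ?S)"
    by measurable
  have w [measurable]: "(\<lambda>(v, s). ennreal (indicator (chart_dom X) v / graph_height X v)) \<in> borel_measurable (lborel \<Otimes>\<^sub>M ?S)"
    by measurable
  have "(\<integral>\<^sup>+x. f x \<partial>vol X) = (\<integral>\<^sup>+z. chart_weight X (fst z) * f (fst z, snd z * graph_height X (fst z)) \<partial>(lborel \<Otimes>\<^sub>M ?S))"
    unfolding vol_def by (simp add: nn_integral_distr nn_integral_density case_prod_beta' chart_weight_def)
  also have "\<dots> = (\<integral>\<^sup>+v. \<integral>\<^sup>+s. chart_weight X v * f (v, s * graph_height X v) \<partial>?S \<partial>lborel)"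
    by (subst S.nn_integral_fst[symmetric]) (simp_all)
  also have "\<dots> = (\<integral>\<^sup>+v. (\<Sum>s\<in>sheets X. chart_weight X v * f (v, s * graph_height X v)) \<partial>lborel)"
    by (simp add: nn_integral_count_space_finite finite_sheets)
  also have "\<dots> = (\<Sum>s\<in>sheets X. \<integral>\<^sup>+v. chart_weight X v * f (v, s * graph_height X v) \<partial>lborel)"
    by (rule nn_integral_sum) measurable
  finally show ?thesis .
qed

text \<open>The radial factor \<open>1 / (d + 1)\<close>: the slice of the cone at gauge
  \<open>r\<close> scales like \<open>r ^ d\<close>. It enters through positivity and finiteness,
  which allow it to be cancelled.\<close>

definition cone_const :: "'n::finite itself \<Rightarrow> ennreal" where
  "cone_const _ = (\<integral>\<^sup>+r. ennreal (r ^ CARD('n)) * indicator {0<..1} r \<partial>lborel)"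

lemma cone_const_pos: "cone_const TYPE('n::finite) > 0"
proof (rule ccontr)
  let ?f = "\<lambda>r::real. ennreal (r ^ CARD('n)) * indicator {0<..1} r"
  assume "\<not> ?thesis"
  then have "AE r in lborel. ?f r = 0"
    unfolding cone_const_def by (subst nn_integral_0_iff_AE[symmetric]) (auto simp del: mult_eq_0_iff)
  then have ae: "AE r in lborel. r \<notin> {0<..1::real}"
    by eventually_elim (auto simp: indicator_def split: if_splits)
  have m: "{0<..1::real} \<in> sets lborel" "{r \<in> space lborel. \<not> r \<notin> {0<..1::real}} = {0<..1}"
    by auto
  have "emeasure lborel {0<..1::real} = 0"
    by (rule AE_iff_measurable[OF m, THEN iffD1, OF ae])
  then show False by simp
qed

lemma cone_const_finite: "cone_const TYPE('n::finite) < \<infinity>"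
proof -
  have "cone_const TYPE('n) \<le> (\<integral>\<^sup>+r. indicator {0<..1} r \<partial>(lborel :: real measure))"
    unfolding cone_const_def
    by (intro nn_integral_mono) (auto simp: indicator_def intro!: power_le_one)
  also have "\<dots> < \<infinity>" by simp
  finally show ?thesis .
qed

text \<open>One vertical line of the cone: on it, \<open>t = r * graph_height (v / r)\<close> is traded for the cone radius
  \<open>r\<close>, and \<open>dt = dr / graph_height (v / r)\<close>.\<close>

lemma cone_line:
  fixes f :: "'n::finite point \<Rightarrow> ennreal" and v :: "real^'n"
  assumes [measurable]: "f \<in> borel_measurable borel" and v: "v \<noteq> 0"
  shows "(\<integral>\<^sup>+t. f (v /\<^sub>R cone_rad X (v, t), s * (t / cone_rad X (v, t)))
      * indicator {t. t > 0 \<and> (v, t) \<in> ocone X \<and> cone_rad X (v, t) \<le> 1} t \<partial>lborel)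
    = (\<integral>\<^sup>+r. chart_weight X (v /\<^sub>R r) * f (v /\<^sub>R r, s * graph_height X (v /\<^sub>R r)) * indicator {0<..1} r \<partial>lborel)"
proof (cases X)
  case Euc
  then show ?thesis
    by (intro nn_integral_cong)
       (auto simp: cone_rad_def ocone_def chart_weight_def chart_dom_def graph_height_def indicator_def)
next
  case Sph
  define c where "c = norm v"
  have c: "c > 0" using v by (simp add: c_def)
  let ?G = "\<lambda>r. chart_weight X (v /\<^sub>R r) * f (v /\<^sub>R r, s * graph_height X (v /\<^sub>R r)) * indicator {0<..1} r"
  have Gm [measurable]: "?G \<in> borel_measurable borel" by measurable
  have "(\<integral>\<^sup>+r. ?G r \<partial>lborel) = (\<integral>\<^sup>+r. ?G r * indicator {c..} r \<partial>lborel)"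
  proof (intro nn_integral_cong)
    fix r :: real
    \<comment> \<open>Below \<open>c\<close> the point \<open>v / r\<close> leaves the chart, so the
      lower limit of the substitution loses nothing.\<close>
    have "chart_weight X (v /\<^sub>R r) = 0" if "0 < r" "r < c"
    proof -
      have "norm (v /\<^sub>R r) > 1" using that c by (simp add: c_def field_simps)
      then show ?thesis using Sph by (simp add: chart_weight_def chart_dom_def)
    qed
    then show "?G r = ?G r * indicator {c..} r" by (auto simp: indicator_def)
  qed
  also have "\<dots> = (\<integral>\<^sup>+t. ?G (sqrt (t\<^sup>2 + c\<^sup>2)) * ennreal (t / sqrt (t\<^sup>2 + c\<^sup>2)) * indicator {0..} t \<partial>lborel)"
    by (rule nn_integral_sqrt_substitution[OF c Gm])
  also have "\<dots> = (\<integral>\<^sup>+t. f (v /\<^sub>R cone_rad X (v, t), s * (t / cone_rad X (v, t)))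
      * indicator {t. t > 0 \<and> (v, t) \<in> ocone X \<and> cone_rad X (v, t) \<le> 1} t \<partial>lborel)"
  proof (intro nn_integral_cong)
    fix t :: real
    define r where "r = sqrt (t\<^sup>2 + c\<^sup>2)"
    have r0: "r > 0" using c by (simp add: r_def add_nonneg_pos)
    have r2: "r\<^sup>2 = t\<^sup>2 + c\<^sup>2" by (simp add: r_def)
    have g: "cone_rad X (v, t) = r"
      using Sph by (simp add: cone_rad_def bil_def kap_def r_def c_def dot_square_norm power2_eq_square[of t] add.commute)
    have o: "(v, t) \<in> ocone X" using Sph v by (simp add: ocone_def zero_prod_def)
    have nv: "norm (v /\<^sub>R r) = c / r" using r0 by (simp add: c_def divide_inverse mult.commute)
    have "(t / r)\<^sup>2 + (c / r)\<^sup>2 = r\<^sup>2 / r\<^sup>2" by (simp only: power_divide r2 add_divide_distrib)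
    then have "1 - (norm (v /\<^sub>R r))\<^sup>2 = (t / r)\<^sup>2" unfolding nv using r0 by simp
    then have h: "graph_height X (v /\<^sub>R r) = t / r" if "t > 0"
      using that r0 Sph by (simp add: graph_height_def)
    have "c < r" if "t > 0" using that r2 c r0 by (intro power2_less_imp_less[of c r]) auto
    then have "v /\<^sub>R r \<in> chart_dom X" if "t > 0"
      using that r0 Sph by (simp add: chart_dom_def c_def field_simps)
    then have w: "chart_weight X (v /\<^sub>R r) * ennreal (t / r) = 1" if "t > 0"
      using that r0 h by (simp add: chart_weight_def ennreal_mult[symmetric])
    show "?G (sqrt (t\<^sup>2 + c\<^sup>2)) * ennreal (t / sqrt (t\<^sup>2 + c\<^sup>2)) * indicator {0..} t
      = f (v /\<^sub>R cone_rad X (v, t), s * (t / cone_rad X (v, t)))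
      * indicator {t. t > 0 \<and> (v, t) \<in> ocone X \<and> cone_rad X (v, t) \<le> 1} t"
    proof (cases "t > 0")
      case True
      have "?G r * ennreal (t / r) = (chart_weight X (v /\<^sub>R r) * ennreal (t / r)) * (f (v /\<^sub>R r, s * graph_height X (v /\<^sub>R r)) * indicator {0<..1} r)"
        by (simp only: ac_simps)
      also have "\<dots> = f (v /\<^sub>R r, s * (t / r)) * indicator {0<..1} r"
        unfolding w[OF True] h[OF True] by simp
      finally show ?thesis using True r0 o unfolding r_def[symmetric] g by (simp add: indicator_def g)
    next
      case False
      then show ?thesis by (cases "t = 0") (simp_all add: indicator_def)
    qed
  qed
  finally show ?thesis by simp
next
  case Hyp
  define c where "c = norm v"
  have c: "c > 0" using v by (simp add: c_def)
  let ?D = "{t. t > 0 \<and> (v, t) \<in> ocone X \<and> cone_rad X (v, t) \<le> 1}"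
  have D: "?D = {t. t > c \<and> sqrt (t\<^sup>2 - c\<^sup>2) \<le> 1}"
    and g: "\<And>t. t \<ge> c \<Longrightarrow> cone_rad X (v, t) = sqrt (t\<^sup>2 - c\<^sup>2)"
  proof -
    have b: "bil Hyp (v, t) (v, t) = c\<^sup>2 - t\<^sup>2" for t
      by (simp add: bil_def kap_def c_def dot_square_norm power2_eq_square[of t])
    show g: "cone_rad X (v, t) = sqrt (t\<^sup>2 - c\<^sup>2)" if "t \<ge> c" for t
      using power_mono[of c t 2] that c Hyp by (simp add: cone_rad_def b)
    have m: "t > 0 \<and> c\<^sup>2 < t\<^sup>2 \<longleftrightarrow> t > c" for t
      using c power2_less_imp_less[of c t] power_strict_mono[of c t 2] by auto
    show "?D = {t. t > c \<and> sqrt (t\<^sup>2 - c\<^sup>2) \<le> 1}"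
    proof (rule Collect_cong)
      fix t
      have "t > 0 \<and> (v, t) \<in> ocone X \<longleftrightarrow> t > c" using Hyp m[of t] by (auto simp: ocone_def b)
      then show "t > 0 \<and> (v, t) \<in> ocone X \<and> cone_rad X (v, t) \<le> 1 \<longleftrightarrow> t > c \<and> sqrt (t\<^sup>2 - c\<^sup>2) \<le> 1"
        using g[of t] by (cases "t > c") auto
    qed
  qed
  have Dm [measurable]: "?D \<in> sets borel" unfolding D by measurable
  let ?G = "\<lambda>t. f (v /\<^sub>R sqrt (t\<^sup>2 - c\<^sup>2), s * (t / sqrt (t\<^sup>2 - c\<^sup>2))) * indicator ?D t"
  have Gm [measurable]: "?G \<in> borel_measurable borel" by measurable
  have "(\<integral>\<^sup>+t. f (v /\<^sub>R cone_rad X (v, t), s * (t / cone_rad X (v, t))) * indicator ?D t \<partial>lborel)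
     = (\<integral>\<^sup>+t. ?G t * indicator {c..} t \<partial>lborel)"
    by (intro nn_integral_cong) (auto simp: indicator_def g D)
  also have "\<dots> = (\<integral>\<^sup>+r. ?G (sqrt (r\<^sup>2 + c\<^sup>2)) * ennreal (r / sqrt (r\<^sup>2 + c\<^sup>2)) * indicator {0..} r \<partial>lborel)"
    by (rule nn_integral_sqrt_substitution[OF c Gm])
  also have "\<dots> = (\<integral>\<^sup>+r. chart_weight X (v /\<^sub>R r) * f (v /\<^sub>R r, s * graph_height X (v /\<^sub>R r)) * indicator {0<..1} r \<partial>lborel)"
  proof (intro nn_integral_cong)
    fix r :: real
    define t where "t = sqrt (r\<^sup>2 + c\<^sup>2)"
    have t0: "t > 0" using c by (simp add: t_def add_nonneg_pos)
    have t2: "t\<^sup>2 = r\<^sup>2 + c\<^sup>2" by (simp add: t_def)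
    show "?G (sqrt (r\<^sup>2 + c\<^sup>2)) * ennreal (r / sqrt (r\<^sup>2 + c\<^sup>2)) * indicator {0..} r
       = chart_weight X (v /\<^sub>R r) * f (v /\<^sub>R r, s * graph_height X (v /\<^sub>R r)) * indicator {0<..1} r"
    proof (cases "r > 0")
      case True
      have nv: "norm (v /\<^sub>R r) = c / r" using True by (simp add: c_def divide_inverse mult.commute)
      have "(t / r)\<^sup>2 = r\<^sup>2 / r\<^sup>2 + (c / r)\<^sup>2" by (simp only: power_divide t2 add_divide_distrib)
      then have "1 + (norm (v /\<^sub>R r))\<^sup>2 = (t / r)\<^sup>2" unfolding nv using True by simp
      then have h: "graph_height X (v /\<^sub>R r) = t / r"
        using True t0 Hyp by (simp add: graph_height_def)
      have w: "chart_weight X (v /\<^sub>R r) = ennreal (r / t)" using Hyp h by (simp add: chart_weight_def chart_dom_def)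
      have q: "sqrt (t\<^sup>2 - c\<^sup>2) = r" using t2 True by simp
      have "c < t" using True t2 c t0 by (intro power2_less_imp_less[of c t]) auto
      then have "t \<in> ?D \<longleftrightarrow> r \<in> {0<..1}" unfolding D mem_Collect_eq q using True by simp
      then have "indicator ?D t = (indicator {0<..1} r :: ennreal)" by (simp add: indicator_def)
      then show ?thesis using True unfolding t_def[symmetric] q h w by (simp add: ac_simps)
    next
      case False
      then show ?thesis by (cases "r = 0") (simp_all add: indicator_def)
    qed
  qed
  finally show ?thesis .
qed

lemma borel_measurable_fst_snd_point [measurable (raw)]:
  fixes f :: "'a \<Rightarrow> 'n::finite point"
  assumes "f \<in> borel_measurable M"
  shows "(\<lambda>x. fst (f x)) \<in> borel_measurable M" "(\<lambda>x. snd (f x)) \<in> borel_measurable M"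
  by (rule measurable_compose[OF assms], intro borel_measurable_continuous_onI continuous_intros)+

lemma borel_measurable_bil [measurable (raw)]:
  assumes [measurable]: "f \<in> borel_measurable M" "g \<in> borel_measurable M"
  shows "(\<lambda>x. bil X (f x) (g x)) \<in> borel_measurable M"
  unfolding bil_def by measurable

lemma borel_measurable_cone_rad [measurable]: "cone_rad X \<in> borel_measurable borel"
proof -
  have "(\<lambda>x. if X = Euc then snd x else sqrt \<bar>bil X x x\<bar>) \<in> borel_measurable borel"
    by measurable
  then show ?thesis by (simp add: cone_rad_def[abs_def])
qed

lemma ocone_open: "open (ocone X)"
  unfolding ocone_def bil_def
  by (cases X) (auto intro!: open_Collect_neq open_Collect_less open_Collect_conj continuous_intros)

lemma ocone_borel [measurable]: "ocone X \<in> sets borel"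
  by (intro borel_open ocone_open)

lemma borel_measurable_prj [measurable]: "prj X \<in> borel_measurable borel"
  unfolding prj_def by measurable

definition ucone :: "space_form \<Rightarrow> 'n::finite point set" where
  "ucone X = {x \<in> ocone X. cone_rad X x \<le> 1}"

lemma ucone_borel [measurable]: "ucone X \<in> sets borel"
  unfolding ucone_def by measurable

text \<open>After \<open>cone_line\<close> on each vertical line, the integrals are exchanged;
  rescaling \<open>v\<close> by \<open>r\<close> gives the factor \<open>r ^ d\<close>, and the
  radial integral splits off.\<close>

lemma cone_integral_sheet:
  fixes f :: "'n::finite point \<Rightarrow> ennreal"
  assumes [measurable]: "f \<in> borel_measurable borel" and s: "s \<in> sheets X"
  shows "(\<integral>\<^sup>+v. \<integral>\<^sup>+t. f (prj X (v, t)) * indicator (ucone X \<inter> {x. s * snd x > 0}) (v, t) \<partial>lborel \<partial>lborel)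
    = cone_const TYPE('n) * (\<integral>\<^sup>+v. chart_weight X v * f (v, s * graph_height X v) \<partial>lborel)"
proof -
  let ?h = "\<lambda>v. chart_weight X v * f (v, s * graph_height X v)"
  have hm [measurable]: "?h \<in> borel_measurable borel" by measurable
  have s1: "s = 1 \<or> s = -1" "s * s = 1" and sX: "X \<noteq> Sph \<Longrightarrow> s = 1"
    using s by (auto simp: sheets_def split: if_splits)
  \<comment> \<open>Reversing the vertical lines reduces the lower sheet of the sphere to the upper
    one.\<close>
  have refl: "(\<integral>\<^sup>+t. g (s * t) \<partial>lborel) = (\<integral>\<^sup>+t. g t \<partial>lborel)" if [measurable]: "g \<in> borel_measurable borel"
    for g :: "real \<Rightarrow> ennreal"
    using s1(1) nn_integral_lborel_reflect[of g 0] by auto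
  have cr: "cone_rad X (v, s * t) = cone_rad X (v, t)" for v :: "real^'n" and t
  proof -
    have e: "s * t * (s * t) = t * t" using s1(2) by algebra
    have "bil X (v, s * t) (v, s * t) = bil X (v, t) (v, t)" unfolding bil_def fst_conv snd_conv e ..
    then show ?thesis using sX by (cases "X = Euc") (simp_all add: cone_rad_def)
  qed
  have oc: "(v, s * t) \<in> ocone X \<longleftrightarrow> (v, t) \<in> ocone X" for v :: "real^'n" and t
    using sX s1 by (cases X) (auto simp: ocone_def zero_prod_def)
  have inner: "(\<integral>\<^sup>+t. f (prj X (v, t)) * indicator (ucone X \<inter> {x. s * snd x > 0}) (v, t) \<partial>lborel)
     = (\<integral>\<^sup>+r. ?h (v /\<^sub>R r) * indicator {0<..1} r \<partial>lborel)" if "v \<noteq> 0" for v :: "real^'n"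
  proof -
    have [measurable]: "{x :: 'n point. s * snd x > 0} \<in> sets borel" by measurable
    have "(\<integral>\<^sup>+t. f (prj X (v, t)) * indicator (ucone X \<inter> {x. s * snd x > 0}) (v, t) \<partial>lborel)
       = (\<integral>\<^sup>+t. f (prj X (v, s * t)) * indicator (ucone X \<inter> {x. s * snd x > 0}) (v, s * t) \<partial>lborel)"
      by (rule refl[symmetric]) measurable
    also have "\<dots> = (\<integral>\<^sup>+t. f (v /\<^sub>R cone_rad X (v, t), s * (t / cone_rad X (v, t)))
      * indicator {t. t > 0 \<and> (v, t) \<in> ocone X \<and> cone_rad X (v, t) \<le> 1} t \<partial>lborel)"
    proof (intro nn_integral_cong)
      fix t
      have sst: "s * (s * t) = t" using s1(2) by algebra
      have "(v, s * t) \<in> ucone X \<inter> {x. s * snd x > 0} \<longleftrightarrow> t > 0 \<and> (v, t) \<in> ocone X \<and> cone_rad X (v, t) \<le> 1"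
        unfolding ucone_def Int_iff mem_Collect_eq snd_conv oc cr sst by blast
      then show "f (prj X (v, s * t)) * indicator (ucone X \<inter> {x. s * snd x > 0}) (v, s * t)
        = f (v /\<^sub>R cone_rad X (v, t), s * (t / cone_rad X (v, t)))
      * indicator {t. t > 0 \<and> (v, t) \<in> ocone X \<and> cone_rad X (v, t) \<le> 1} t"
        by (simp add: indicator_def prj_def cr divide_inverse ac_simps)
    qed
    also have "\<dots> = (\<integral>\<^sup>+r. ?h (v /\<^sub>R r) * indicator {0<..1} r \<partial>lborel)"
      by (rule cone_line) (use that in simp_all)
    finally show ?thesis .
  qed
  have v0: "AE v in lborel. (v :: real^'n) \<noteq> 0"
    by (rule AE_I[of _ _ "{0}"]) auto
  have "(\<integral>\<^sup>+v. \<integral>\<^sup>+t. f (prj X (v, t)) * indicator (ucone X \<inter> {x. s * snd x > 0}) (v, t) \<partial>lborel \<partial>lborel)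
     = (\<integral>\<^sup>+v. \<integral>\<^sup>+r. ?h (v /\<^sub>R r) * indicator {0<..1} r \<partial>lborel \<partial>lborel)"
    by (intro nn_integral_cong_AE) (rule eventually_mono[OF v0], rule inner)
  also have "\<dots> = (\<integral>\<^sup>+r. \<integral>\<^sup>+v. ?h (v /\<^sub>R r) * indicator {0<..1} r \<partial>lborel \<partial>lborel)"
    by (rule lborel_pair.Fubini'[symmetric]) measurable
  also have "\<dots> = (\<integral>\<^sup>+r. (\<integral>\<^sup>+v. ?h v \<partial>lborel) * (ennreal (r ^ CARD('n)) * indicator {0<..1} r) \<partial>lborel)"
  proof (intro nn_integral_cong)
    fix r :: real
    show "(\<integral>\<^sup>+v. ?h (v /\<^sub>R r) * indicator {0<..1} r \<partial>lborel)
      = (\<integral>\<^sup>+v. ?h v \<partial>lborel) * (ennreal (r ^ CARD('n)) * indicator {0<..1} r)"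
    proof (cases "r \<in> {0<..1}")
      case True
      then show ?thesis using nn_integral_lborel_scale[of r ?h] by (simp add: mult.commute)
    qed simp
  qed
  also have "\<dots> = cone_const TYPE('n) * (\<integral>\<^sup>+v. ?h v \<partial>lborel)"
    by (subst nn_integral_cmult) (simp_all add: cone_const_def mult.commute)
  finally show ?thesis .
qed

text \<open>The sign of the height separates the sheets; the hyperplane of height 0, which contains
  the cone over the equator, is null.\<close>

lemma cone_integral:
  fixes f :: "'n::finite point \<Rightarrow> ennreal"
  assumes [measurable]: "f \<in> borel_measurable borel"
  shows "(\<integral>\<^sup>+x. f (prj X x) * indicator (ucone X) x \<partial>lborel) = cone_const TYPE('n) * (\<integral>\<^sup>+x. f x \<partial>vol X)"
proof -
  have [measurable]: "{x :: 'n point. s * snd x > 0} \<in> sets borel" for s by measurable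
  have sp: "indicator (ucone X) (v, t) = (\<Sum>s\<in>sheets X. indicator (ucone X \<inter> {x. s * snd x > 0}) (v, t) :: ennreal)"
    if "t \<noteq> 0" for v :: "real^'n" and t
  proof (cases "X = Sph")
    case True
    then have "(\<Sum>s\<in>sheets X. g s) = g 1 + g (- 1)" for g :: "real \<Rightarrow> ennreal"
      by (simp add: sheets_def)
    then show ?thesis using that by (cases "t > 0") (simp_all add: indicator_def)
  next
    case False
    then show ?thesis by (cases X) (auto simp: sheets_def indicator_def ucone_def ocone_def)
  qed
  have t0: "AE t in lborel. (t :: real) \<noteq> 0"
    by (rule AE_I[of _ _ "{0}"]) auto
  have "(\<integral>\<^sup>+x. f (prj X x) * indicator (ucone X) x \<partial>lborel)
      = (\<integral>\<^sup>+x. f (prj X x) * indicator (ucone X) x \<partial>(lborel \<Otimes>\<^sub>M lborel))"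
    by (simp only: lborel_prod)
  also have "\<dots> = (\<integral>\<^sup>+v. \<integral>\<^sup>+t. f (prj X (v, t)) * indicator (ucone X) (v, t) \<partial>lborel \<partial>lborel)"
    by (rule lborel.nn_integral_fst[symmetric]) (simp add: lborel_prod)
  also have "\<dots> = (\<integral>\<^sup>+v. \<integral>\<^sup>+t. (\<Sum>s\<in>sheets X. f (prj X (v, t)) * indicator (ucone X \<inter> {x. s * snd x > 0}) (v, t)) \<partial>lborel \<partial>lborel)"
  proof (rule nn_integral_cong, rule nn_integral_cong_AE)
    fix v :: "real^'n"
    show "AE t in lborel. f (prj X (v, t)) * indicator (ucone X) (v, t)
      = (\<Sum>s\<in>sheets X. f (prj X (v, t)) * indicator (ucone X \<inter> {x. s * snd x > 0}) (v, t))"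
      using t0
    proof (rule eventually_mono)
      fix t :: real assume "t \<noteq> 0"
      show "f (prj X (v, t)) * indicator (ucone X) (v, t)
        = (\<Sum>s\<in>sheets X. f (prj X (v, t)) * indicator (ucone X \<inter> {x. s * snd x > 0}) (v, t))"
        unfolding sp[OF \<open>t \<noteq> 0\<close>] sum_distrib_left ..
    qed
  qed
  also have "\<dots> = (\<Sum>s\<in>sheets X. \<integral>\<^sup>+v. \<integral>\<^sup>+t. f (prj X (v, t)) * indicator (ucone X \<inter> {x. s * snd x > 0}) (v, t) \<partial>lborel \<partial>lborel)"
    by (simp add: nn_integral_sum)
  also have "\<dots> = cone_const TYPE('n) * (\<integral>\<^sup>+x. f x \<partial>vol X)"
    by (simp add: cone_integral_sheet nn_integral_vol sum_distrib_left)
  finally show ?thesis .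
qed

lemma borel_measurable_rfl [measurable]: "rfl X y z \<in> borel_measurable borel"
  by (intro borel_measurable_continuous_onI linear_continuous_on linear_conv_bounded_linear[THEN iffD1] linear_rfl)

lemma cone_const_cancel:
  assumes "cone_const TYPE('n::finite) * a = cone_const TYPE('n) * b"
  shows "a = b"
  using assms cone_const_pos[where 'n = 'n] cone_const_finite[where 'n = 'n]
  by (auto simp: ennreal_mult_cancel_left)

lemma vol_rfl:
  fixes f :: "'n::finite point \<Rightarrow> ennreal"
  assumes y: "y \<in> carr X" and z: "z \<in> carr X" and [measurable]: "f \<in> borel_measurable borel"
  shows "(\<integral>\<^sup>+x. f (rfl X y z x) \<partial>vol X) = (\<integral>\<^sup>+x. f x \<partial>vol X)"
proof -
  have d: "distr lborel borel (rfl X y z) = lborel"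
  proof (rule measure_eqI)
    fix A assume "A \<in> sets (distr lborel borel (rfl X y z))"
    then show "emeasure (distr lborel borel (rfl X y z)) A = emeasure lborel A"
      using emeasure_linear_involution[OF linear_rfl rfl_rfl[OF y z], of A] by (simp add: emeasure_distr)
  qed simp
  let ?F = "\<lambda>x. f (prj X x) * indicator (ucone X) x"
  have "cone_const TYPE('n) * (\<integral>\<^sup>+x. f (rfl X y z x) \<partial>vol X)
      = (\<integral>\<^sup>+x. f (rfl X y z (prj X x)) * indicator (ucone X) x \<partial>lborel)"
    by (rule cone_integral[symmetric]) measurable
  also have "\<dots> = (\<integral>\<^sup>+x. ?F (rfl X y z x) \<partial>lborel)"
  proof (intro nn_integral_cong)
    fix x :: "'n point"
    show "f (rfl X y z (prj X x)) * indicator (ucone X) x = ?F (rfl X y z x)"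
    proof (cases "x \<in> ocone X")
      case True
      then show ?thesis using rfl_cone_rad[OF y z True] by (simp add: ucone_def indicator_def)
    next
      case False
      then show ?thesis using rfl_ocone_iff[OF y z] by (simp add: ucone_def indicator_def)
    qed
  qed
  also have "\<dots> = (\<integral>\<^sup>+x. ?F x \<partial>distr lborel borel (rfl X y z))"
    by (subst nn_integral_distr) simp_all
  also have "\<dots> = cone_const TYPE('n) * (\<integral>\<^sup>+x. f x \<partial>vol X)"
    unfolding d by (rule cone_integral) measurable
  finally show ?thesis by (rule cone_const_cancel)
qed

section \<open>Null sets, positivity and finiteness of volume\<close>

lemma carr_borel [measurable]: "carr X \<in> sets borel"
  by (intro borel_closed closed_carr)

lemma chart_carr:
  assumes "v \<in> chart_dom X" "s \<in> sheets X"
  shows "(v, s * graph_height X v) \<in> carr X"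
proof (cases X)
  case Sph
  then have "s * s = 1" "(norm v)\<^sup>2 < 1"
    using assms by (auto simp: sheets_def chart_dom_def abs_square_less_1)
  moreover have "s * graph_height X v * (s * graph_height X v) = s * s * (graph_height X v)\<^sup>2"
    by algebra
  ultimately show ?thesis using Sph
    by (simp add: carr_iff bil_def kap_def graph_height_def dot_square_norm)
next
  case Euc then show ?thesis using assms by (simp add: carr_iff sheets_def graph_height_def)
next
  case Hyp
  have "graph_height Hyp v * graph_height Hyp v = 1 + (norm v)\<^sup>2"
    by (simp add: graph_height_def)
  moreover have "graph_height Hyp v > 0" by (simp add: graph_height_def add_pos_nonneg)
  ultimately show ?thesis using Hyp assms
    by (simp add: carr_iff bil_def kap_def sheets_def dot_square_norm)
qed

lemma emeasure_vol:
  assumes "A \<in> sets borel"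
  shows "emeasure (vol X) A = (\<Sum>s\<in>sheets X. \<integral>\<^sup>+v. chart_weight X v * indicator A (v, s * graph_height X v) \<partial>lborel)"
  using nn_integral_vol[of "indicator A" X] assms by simp

lemma AE_vol_carr: "AE x in vol X. x \<in> carr X"
proof (rule AE_I[where N = "- carr X"])
  show "emeasure (vol X) (- carr X) = 0"
  proof (subst emeasure_vol)
    have z: "chart_weight X v * indicator (- carr X) (v, s * graph_height X v) = 0" if "s \<in> sheets X" for s v
      using chart_carr[of v X s] that by (cases "v \<in> chart_dom X") (simp_all add: chart_weight_def)
    have "(\<integral>\<^sup>+v. chart_weight X v * indicator (- carr X) (v, s * graph_height X v) \<partial>lborel) = 0"
      if "s \<in> sheets X" for s
      unfolding z[OF that] by simp
    then show "(\<Sum>s\<in>sheets X. \<integral>\<^sup>+v. chart_weight X v * indicator (- carr X) (v, s * graph_height X v) \<partial>lborel) = 0"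
      by (intro sum.neutral ballI)
  qed measurable
qed auto

lemma emeasure_vol_cone:
  assumes [measurable]: "A \<in> sets borel"
  shows "cone_const TYPE('n::finite) * emeasure (vol X) A = emeasure lborel {x \<in> ucone X :: 'n point set. prj X x \<in> A}"
proof -
  have "cone_const TYPE('n) * emeasure (vol X) A = cone_const TYPE('n) * (\<integral>\<^sup>+x. indicator A x \<partial>vol X)"
    by simp
  also have "\<dots> = (\<integral>\<^sup>+x. indicator A (prj X x) * indicator (ucone X) x \<partial>lborel)"
    by (rule cone_integral[symmetric]) measurable
  also have "\<dots> = (\<integral>\<^sup>+x. indicator {x \<in> ucone X. prj X x \<in> A} x \<partial>lborel)"
    by (intro nn_integral_cong) (auto simp: indicator_def)
  also have "\<dots> = emeasure lborel {x \<in> ucone X. prj X x \<in> A}"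
    by (rule nn_integral_indicator) measurable
  finally show ?thesis .
qed

lemma continuous_on_cone_rad: "continuous_on UNIV (cone_rad X)"
  unfolding cone_rad_def bil_def by (cases "X = Euc") (auto intro!: continuous_intros)

lemma continuous_on_prj: "continuous_on (ocone X) (prj X)"
  unfolding prj_def
  by (intro continuous_intros continuous_on_subset[OF continuous_on_cone_rad])
     (auto dest: ocone_cone_rad_pos)

text \<open>The open cone over \<open>U\<close>, cut off at gauge 1, is a Euclidean open set
  containing half of \<open>p\<close>.\<close>

lemma emeasure_vol_open_pos:
  fixes U :: "'n::finite point set"
  assumes U: "open U" and p: "p \<in> U" "p \<in> carr X"
  shows "emeasure (vol X) U > 0"
proof -
  let ?V = "{x \<in> ocone X. cone_rad X x < 1} \<inter> (prj X -` U \<inter> ocone X)"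
  have "open ?V"
  proof (rule open_Int)
    have "open (cone_rad X -` {..<1})"
      by (rule open_vimage[OF _ continuous_on_cone_rad]) simp
    then have "open (ocone X \<inter> cone_rad X -` {..<1})" by (intro open_Int ocone_open)
    then show "open {x \<in> ocone X. cone_rad X x < 1}" by (simp add: Int_def vimage_def)
    show "open (prj X -` U \<inter> ocone X)"
      using continuous_on_open_vimage[OF ocone_open] continuous_on_prj U by blast
  qed
  moreover have "(1/2) *\<^sub>R p \<in> ?V"
    using p ocone_scale[of "1/2" p X] cone_rad_scale[of "1/2" p X] prj_scale[of "1/2" p X] by simp
  ultimately have "emeasure lborel ?V > 0" by (intro emeasure_lborel_open_pos) auto
  also have "emeasure lborel ?V \<le> emeasure lborel {x \<in> ucone X. prj X x \<in> U}"
  proof (rule emeasure_mono)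
    have [measurable]: "U \<in> sets borel" using U by (rule borel_open)
    show "{x \<in> ucone X. prj X x \<in> U} \<in> sets lborel" by measurable
  qed (auto simp: ucone_def)
  also have "\<dots> = cone_const TYPE('n) * emeasure (vol X) U"
    using U by (intro emeasure_vol_cone[symmetric]) auto
  finally show ?thesis by (simp add: ennreal_zero_less_mult_iff)
qed

lemma emeasure_vol_cball_finite:
  "emeasure (vol X) {x \<in> carr X :: 'n::finite point set. sdist X x orig \<le> R} < \<infinity>"
proof -
  let ?B = "{x \<in> carr X :: 'n point set. sdist X x orig \<le> R}"
  obtain b where b: "\<And>x. x \<in> ?B \<Longrightarrow> norm x \<le> b"
    using compact_imp_bounded[OF compact_cball, of X R] unfolding bounded_iff by blast
  have "{x \<in> ucone X. prj X x \<in> ?B} \<subseteq> cball 0 (max b 0)"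
  proof
    fix x :: "'n point" assume x: "x \<in> {x \<in> ucone X. prj X x \<in> ?B}"
    then have o: "x \<in> ocone X" "cone_rad X x \<le> 1" "norm (prj X x) \<le> b" using b by (auto simp: ucone_def)
    have "norm x = cone_rad X x * norm (prj X x)"
      using arg_cong[OF cone_rad_prj[OF o(1)], of norm] ocone_cone_rad_pos[OF o(1)] by simp
    also have "\<dots> \<le> 1 * max b 0"
      using o ocone_cone_rad_pos[OF o(1)] by (intro mult_mono) auto
    finally show "x \<in> cball 0 (max b 0)" by simp
  qed
  then have "emeasure lborel {x \<in> ucone X. prj X x \<in> ?B} \<le> emeasure lborel (cball 0 (max b 0) :: 'n point set)"
    by (intro emeasure_mono) auto
  also have "\<dots> < \<infinity>" by (rule emeasure_lborel_cball_finite)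
  finally have "cone_const TYPE('n) * emeasure (vol X) ?B < \<infinity>"
    by (subst emeasure_vol_cone) (rule borel_closed[OF closed_cball])
  then show ?thesis using cone_const_pos[where 'n = 'n] by (auto simp: ennreal_mult_less_top)
qed

lemma sdist_borel [measurable]: 
  assumes "y \<in> carr X" shows "{x \<in> carr X. sdist X x y \<le> R} \<in> sets borel"
proof -
  have "closed (carr X \<inter> (\<lambda>x. sdist X x y) -` {..R})"
    by (rule continuous_closed_preimage) (auto intro!: continuous_on_sdist continuous_intros closed_carr assms)
  then show ?thesis by (simp add: Int_def vimage_def borel_closed)
qed

text \<open>In a chart a geodesic sphere about the origin projects into a Euclidean sphere, which is
  Lebesgue null.\<close>

lemma sphere_null: "emeasure (vol X) {x \<in> carr X :: 'n::finite point set. sdist X x orig = R} = 0"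
proof -
  let ?S = "{x \<in> carr X :: 'n point set. sdist X x orig = R}"
  have c: "closed ?S"
  proof -
    have "closed (carr X \<inter> (\<lambda>x :: 'n point. sdist X x orig) -` {R})"
      by (rule continuous_closed_preimage) (auto intro!: continuous_on_sdist continuous_intros closed_carr)
    then show ?thesis by (simp add: Int_def vimage_def)
  qed
  define k where "k = \<bar>case X of Sph \<Rightarrow> sin R | Euc \<Rightarrow> R | Hyp \<Rightarrow> sinh R\<bar>"
  have k: "norm (fst x) = k" if "x \<in> ?S" for x :: "'n point"
  proof -
    have x: "x \<in> carr X" using that by simp
    obtain u where "norm u = 1" "x = polar_point X (sdist X x orig, u)"
      by (rule polar_ex[OF x])
    then have "norm u = 1" "x = polar_point X (R, u)" using that by simp_all
    then show ?thesis by (cases X) (simp_all add: polar_point_def k_def)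
  qed
  have ae: "AE v in lborel. norm (v :: real^'n) \<noteq> k"
  proof (rule AE_I[where N = "sphere 0 k"])
    have "sphere (0 :: real^'n) k \<in> null_sets lebesgue"
      using negligible_sphere[of "0 :: real^'n" k] by (simp add: negligible_iff_null_sets)
    then show "emeasure lborel (sphere (0 :: real^'n) k) = 0" by (simp add: null_sets_def)
  qed auto
  show ?thesis
  proof (subst emeasure_vol)
    show "?S \<in> sets borel" using c by (rule borel_closed)
    show "(\<Sum>s\<in>sheets X. \<integral>\<^sup>+v. chart_weight X v * indicator ?S (v, s * graph_height X v) \<partial>lborel) = 0"
    proof (intro sum.neutral ballI)
      fix s
      have "(\<integral>\<^sup>+v. chart_weight X v * indicator ?S (v, s * graph_height X v) \<partial>lborel) = (\<integral>\<^sup>+v. 0 \<partial>(lborel :: (real^'n) measure))"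
      proof (rule nn_integral_cong_AE, rule eventually_mono[OF ae])
        fix v :: "real^'n" assume "norm v \<noteq> k"
        then have "(v, s * graph_height X v) \<notin> ?S" using k[of "(v, s * graph_height X v)"] by auto
        then show "chart_weight X v * indicator ?S (v, s * graph_height X v) = 0" by (simp del: mem_Collect_eq)
      qed
      then show "(\<integral>\<^sup>+v. chart_weight X v * indicator ?S (v, s * graph_height X v) \<partial>lborel) = 0" by simp
    qed
  qed
qed

lemma sball_borel [measurable]: 
  assumes a: "a \<in> carr X" shows "sball X a r \<in> sets borel"
proof -
  have "sball X a r = (\<Union>n. {x \<in> carr X. sdist X x a \<le> r - 1 / real (Suc n)})"
  proof (intro set_eqI iffI)
    fix x assume x: "x \<in> sball X a r"
    then have "r - sdist X x a > 0" by (simp add: sball_def sdist_commute)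
    then obtain n where "inverse (real (Suc n)) < r - sdist X x a" using reals_Archimedean by blast
    then show "x \<in> (\<Union>n. {x \<in> carr X. sdist X x a \<le> r - 1 / real (Suc n)})"
      using x by (auto simp: sball_def inverse_eq_divide intro!: exI[of _ n])
  next
    fix x assume "x \<in> (\<Union>n. {x \<in> carr X. sdist X x a \<le> r - 1 / real (Suc n)})"
    then obtain n where "x \<in> carr X" "sdist X x a \<le> r - 1 / real (Suc n)" by blast
    moreover have "1 / real (Suc n) > 0" by simp
    ultimately have "x \<in> carr X" "sdist X x a < r" by linarith+
    then show "x \<in> sball X a r" by (simp add: sball_def sdist_commute)
  qed
  then show ?thesis using sdist_borel[OF a] by simp
qed

lemma emeasure_vol_sball:
  fixes a :: "'n::finite point"
  assumes a: "a \<in> carr X"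
  shows "emeasure (vol X) (sball X a r) = emeasure (vol X) (sball X orig r :: 'n point set)"
proof -
  have "emeasure (vol X) (sball X a r) = (\<integral>\<^sup>+x. indicator (sball X a r) x \<partial>vol X)"
    using sball_borel[OF a] by simp
  also have "\<dots> = (\<integral>\<^sup>+x. indicator (sball X orig r :: 'n point set) (rfl X orig a x) \<partial>vol X)"
  proof (rule nn_integral_cong_AE, rule eventually_mono[OF AE_vol_carr])
    fix x :: "'n point" assume x: "x \<in> carr X"
    have "sdist X orig (rfl X orig a x) = sdist X a x"
      using sdist_rfl_rfl[OF orig_carr a orig_carr rfl_carr[OF orig_carr a x]] a
      by (simp add: rfl_y)
    then show "indicator (sball X a r) x = indicator (sball X orig r :: 'n point set) (rfl X orig a x)"
      using x rfl_carr[OF orig_carr a x] by (simp add: sball_def indicator_def)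
  qed
  also have "\<dots> = (\<integral>\<^sup>+x. indicator (sball X orig r :: 'n point set) x \<partial>vol X)"
    using vol_rfl[OF orig_carr a, of "indicator (sball X orig r :: 'n point set)"] sball_borel[OF orig_carr, of X r]
    by simp
  also have "\<dots> = emeasure (vol X) (sball X orig r :: 'n point set)"
    by (simp add: sball_borel)
  finally show ?thesis .
qed

section \<open>Rearrangement of sets and functions\<close>

lemma openin_carr_sdist:
  "openin (top_of_set (carr X)) {x \<in> carr X :: 'n::finite point set. r < sdist X x orig}"
  "openin (top_of_set (carr X)) {x \<in> carr X :: 'n point set. sdist X x orig < r}"
proof -
  have c: "continuous_on (carr X) (\<lambda>x :: 'n point. sdist X x orig)"
    by (intro continuous_on_sdist continuous_intros) simp_all
  show "openin (top_of_set (carr X)) {x \<in> carr X :: 'n point set. r < sdist X x orig}"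
    using continuous_openin_preimage_gen[OF c, of "{r<..}"] by (simp add: Int_def vimage_def)
  show "openin (top_of_set (carr X)) {x \<in> carr X :: 'n point set. sdist X x orig < r}"
    using continuous_openin_preimage_gen[OF c, of "{..<r}"] by (simp add: Int_def vimage_def)
qed

lemma openin_carr_borel:
  assumes "openin (top_of_set (carr X)) A" shows "A \<in> sets borel"
proof -
  obtain U where "open U" "A = carr X \<inter> U" using assms by (auto simp: openin_open)
  then show ?thesis using sets.Int[OF carr_borel borel_open] by simp
qed

lemma emeasure_vol_openin_pos:
  assumes A: "openin (top_of_set (carr X)) A" and ne: "A \<noteq> {}"
  shows "emeasure (vol X) A > 0"
proof -
  obtain U where U: "open U" "A = carr X \<inter> U" using A by (auto simp: openin_open)
  have "emeasure (vol X) U = emeasure (vol X) A"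
  proof (rule emeasure_eq_AE)
    show "AE x in vol X. x \<in> U \<longleftrightarrow> x \<in> A"
      by (rule eventually_mono[OF AE_vol_carr]) (simp add: U(2))
    show "U \<in> sets (vol X)" using U(1) by simp
    show "A \<in> sets (vol X)" using openin_carr_borel[OF A] by simp
  qed
  moreover obtain p where "p \<in> A" using ne by blast
  ultimately show ?thesis using emeasure_vol_open_pos[OF U(1), of p X] U(2) by simp
qed

lemma sball_orig: "sball X orig r = {x \<in> carr X. sdist X x orig < r}"
  by (simp add: sball_def sdist_commute)

lemma sball_mono: "r \<le> r' \<Longrightarrow> sball X orig r \<subseteq> sball X orig r'"
  by (auto simp: sball_def)

lemma sball_empty: "r \<le> 0 \<Longrightarrow> (sball X orig r :: 'n::finite point set) = {}"
  using sdist_nonneg[OF _ orig_carr, of _ X] by (force simp: sball_orig)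

lemma sball_borel': "sball X orig r \<in> sets (vol X)"
  by (simp add: sball_borel)

lemma emeasure_sball_mono:
  "r \<le> r' \<Longrightarrow> emeasure (vol X) (sball X orig r :: 'n::finite point set) \<le> emeasure (vol X) (sball X orig r' :: 'n point set)"
  by (intro emeasure_mono sball_mono sball_borel')

lemma emeasure_sball_finite: "emeasure (vol X) (sball X orig r :: 'n::finite point set) < \<infinity>"
proof -
  have "emeasure (vol X) (sball X orig r :: 'n point set) \<le> emeasure (vol X) {x \<in> carr X :: 'n point set. sdist X x orig \<le> r}"
    by (rule emeasure_mono) (auto simp: sball_orig sdist_borel)
  then show ?thesis using emeasure_vol_cball_finite by (rule le_less_trans)
qed

lemma emeasure_sball_pos:
  assumes "r > 0" shows "emeasure (vol X) (sball X orig r :: 'n::finite point set) > 0"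
  unfolding sball_orig
proof (rule emeasure_vol_openin_pos[OF openin_carr_sdist(2)])
  have "orig \<in> {x \<in> carr X :: 'n point set. sdist X x orig < r}" using assms by simp
  then show "{x \<in> carr X :: 'n point set. sdist X x orig < r} \<noteq> {}" by blast
qed

text \<open>A nonempty relatively open gap has positive volume; strict comparisons of ball volumes
  and of level sets are all reduced to this.\<close>

lemma emeasure_vol_subset_strict:
  assumes A: "A \<in> sets borel" and B: "B \<in> sets borel" and fin: "emeasure (vol X) A < \<infinity>"
    and U: "openin (top_of_set (carr X)) U" "U \<noteq> {}" and sub: "A \<subseteq> B" "U \<subseteq> B" "A \<inter> U = {}"
  shows "emeasure (vol X) A < emeasure (vol X) B"
proof -
  have U': "U \<in> sets borel" by (rule openin_carr_borel[OF U(1)])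
  have "emeasure (vol X) A + emeasure (vol X) U = emeasure (vol X) (A \<union> U)"
    using A U' sub by (intro plus_emeasure) simp_all
  also have "\<dots> \<le> emeasure (vol X) B"
    using B sub by (intro emeasure_mono) simp_all
  finally have "emeasure (vol X) A + emeasure (vol X) U \<le> emeasure (vol X) B" .
  moreover have "emeasure (vol X) A < emeasure (vol X) A + emeasure (vol X) U"
    using fin emeasure_vol_openin_pos[OF U] by (simp add: ennreal_add_left_cancel_less[of _ 0, simplified])
  ultimately show ?thesis by (rule less_le_trans[rotated])
qed

lemma sdist_orig_attained:
  assumes "r \<ge> 0" "X = Sph \<Longrightarrow> r \<le> pi"
  obtains x :: "'n::finite point" where "x \<in> carr X" "sdist X x orig = r"
proof -
  have "norm (axis undefined 1 :: real^'n) = 1" by (simp add: norm_axis_1)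
  then show ?thesis
    using that[of "polar_point X (r, axis undefined 1)"]
      polar_point_carr[of "(r, axis undefined 1 :: real^'n)" X]
      sdist_polar_point[of "(r, axis undefined 1 :: real^'n)" X] assms by simp
qed

lemma emeasure_sball_strict:
  assumes r: "0 \<le> r" "r < r'" and pi: "X = Sph \<Longrightarrow> r < pi"
  shows "emeasure (vol X) (sball X orig r :: 'n::finite point set) < emeasure (vol X) (sball X orig r' :: 'n point set)"
proof -
  \<comment> \<open>On the sphere no distance exceeds \<pi>, so the point in the shell is sought
    below \<open>min r' pi\<close>.\<close>
  define q where "q = (if X = Sph then min r' pi else r')"
  have q: "r < q" "q \<le> r'" "X = Sph \<Longrightarrow> q \<le> pi" using r pi by (auto simp: q_def)
  obtain x :: "'n point" where x: "x \<in> carr X" "sdist X x orig = (r + q) / 2"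
    by (rule sdist_orig_attained[of "(r + q) / 2" X]) (use r q pi in auto)
  let ?U = "{x \<in> carr X :: 'n point set. r < sdist X x orig} \<inter> {x \<in> carr X. sdist X x orig < r'}"
  show ?thesis
  proof (rule emeasure_vol_subset_strict)
    show "openin (top_of_set (carr X)) ?U" by (intro openin_Int openin_carr_sdist)
    have "x \<in> ?U" using x q by (simp add: field_simps)
    then show "?U \<noteq> {}" by blast
    show "sball X orig r \<subseteq> (sball X orig r' :: 'n point set)" using r by (intro sball_mono) simp
    show "?U \<subseteq> sball X orig r'" "sball X orig r \<inter> ?U = {}" by (auto simp: sball_orig)
  qed (intro sball_borel orig_carr emeasure_sball_finite)+
qed

lemma emeasure_cball_eq_sball:
  "emeasure (vol X) {x \<in> carr X :: 'n::finite point set. sdist X x orig \<le> r} = emeasure (vol X) (sball X orig r :: 'n point set)"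
proof (rule emeasure_eq_AE)
  let ?S = "{x \<in> carr X :: 'n point set. sdist X x orig = r}"
  have "?S = {x \<in> carr X. sdist X x orig \<le> r} - sball X orig r"
    by (auto simp: sball_orig)
  also have "\<dots> \<in> sets borel" by (intro sets.Diff sdist_borel sball_borel orig_carr)
  finally have "AE x in vol X. x \<notin> ?S"
    using sphere_null[of X r] by (intro AE_not_in null_setsI) simp_all
  then show "AE x in vol X. x \<in> {x \<in> carr X :: 'n point set. sdist X x orig \<le> r} \<longleftrightarrow> x \<in> sball X orig r"
    by (rule eventually_mono) (auto simp: sball_orig)
qed (simp_all add: sdist_borel sball_borel)

text \<open>An intermediate value argument: the volume of balls is continuous from the left through
  increasing unions, and from the right because decreasing balls shrink to a closed ball whose
  boundary is null.\<close>

lemma sball_with_measure: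
  assumes R: "R \<ge> 0" and t: "t \<le> emeasure (vol X) (sball X orig R :: 'n::finite point set)"
  obtains r where "r \<ge> 0" "emeasure (vol X) (sball X orig r :: 'n point set) = t"
proof -
  let ?V = "\<lambda>r. emeasure (vol X) (sball X orig r :: 'n point set)"
  define S where "S = {r. 0 \<le> r \<and> r \<le> R \<and> ?V r \<le> t}"
  have S0: "0 \<in> S" using R by (simp add: S_def sball_empty)
  have bdd: "bdd_above S" by (auto simp: S_def bdd_above_def)
  define r where "r = Sup S"
  have r0: "r \<ge> 0" unfolding r_def by (rule cSup_upper[OF S0 bdd])
  have rR: "r \<le> R" unfolding r_def by (rule cSup_least) (use S0 in \<open>auto simp: S_def\<close>)
  have le: "?V r \<le> t"
  proof -
    let ?A = "\<lambda>n. sball X orig (r - 1 / real (Suc n)) :: 'n point set"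
    have inc: "incseq ?A"
      by (intro incseq_SucI sball_mono) (simp add: frac_le)
    have "(\<Union>n. ?A n) = sball X orig r"
    proof (intro equalityI subsetI)
      fix x :: "'n point" assume x: "x \<in> sball X orig r"
      then have "r - sdist X x orig > 0" by (simp add: sball_orig)
      then obtain n where "inverse (real (Suc n)) < r - sdist X x orig" using reals_Archimedean by blast
      then have "x \<in> ?A n" using x by (simp add: sball_orig inverse_eq_divide)
      then show "x \<in> (\<Union>n. ?A n)" by blast
    next
      fix x :: "'n point" assume "x \<in> (\<Union>n. ?A n)"
      then obtain n where "x \<in> ?A n" by blast
      then have x: "x \<in> carr X" "sdist X x orig < r - 1 / real (Suc n)" by (simp_all add: sball_orig)
      have "1 / real (Suc n) > 0" by simp
      with x have "x \<in> carr X" "sdist X x orig < r" by linarith+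
      then show "x \<in> sball X orig r" by (simp add: sball_orig)
    qed
    then have "?V r = (SUP n. ?V (r - 1 / real (Suc n)))"
      using SUP_emeasure_incseq[OF _ inc, of "vol X"] sball_borel' by (simp add: image_subset_iff)
    also have "\<dots> \<le> t"
    proof (rule SUP_least)
      fix n :: nat
      have "r - 1 / real (Suc n) < Sup S" by (simp add: r_def)
      then obtain s where s: "s \<in> S" "r - 1 / real (Suc n) < s"
        using less_cSup_iff[OF _ bdd] S0 by blast
      then have "?V (r - 1 / real (Suc n)) \<le> ?V s" by (intro emeasure_sball_mono) simp
      also have "\<dots> \<le> t" using s by (simp add: S_def)
      finally show "?V (r - 1 / real (Suc n)) \<le> t" .
    qed
    finally show ?thesis .
  qed
  have ge: "t \<le> ?V r"
  proof -
    let ?A = "\<lambda>n. sball X orig (r + 1 / real (Suc n)) :: 'n point set"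
    have dec: "decseq ?A"
      by (intro decseq_SucI sball_mono) (simp add: frac_le)
    have "(\<Inter>n. ?A n) = {x \<in> carr X. sdist X x orig \<le> r}"
    proof (intro equalityI subsetI)
      fix x :: "'n point" assume x: "x \<in> (\<Inter>n. ?A n)"
      have "sdist X x orig \<le> r"
      proof (rule ccontr)
        assume "\<not> ?thesis"
        then have "sdist X x orig - r > 0" by simp
        then obtain n where "inverse (real (Suc n)) < sdist X x orig - r" using reals_Archimedean by blast
        moreover have "x \<in> ?A n" using x by blast
        ultimately show False by (simp add: sball_orig inverse_eq_divide)
      qed
      then show "x \<in> {x \<in> carr X. sdist X x orig \<le> r}" using x by (simp add: sball_orig)
    next
      fix x :: "'n point" assume x: "x \<in> {x \<in> carr X. sdist X x orig \<le> r}"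
      have "x \<in> ?A n" for n
      proof -
        have "1 / real (Suc n) > 0" by simp
        then show ?thesis using x unfolding sball_orig mem_Collect_eq by linarith
      qed
      then show "x \<in> (\<Inter>n. ?A n)" by blast
    qed
    moreover have "(INF n. ?V (r + 1 / real (Suc n))) = emeasure (vol X) (\<Inter>n. ?A n)"
    proof (rule INF_emeasure_decseq[OF _ dec])
      show "?V (r + 1 / real (Suc i)) \<noteq> \<infinity>" for i
        by (rule less_imp_neq[OF emeasure_sball_finite])
    qed (use sball_borel' in blast)
    ultimately have "emeasure (vol X) {x \<in> carr X :: 'n point set. sdist X x orig \<le> r} = (INF n. ?V (r + 1 / real (Suc n)))"
      by (simp only:)
    moreover have "t \<le> (INF n. ?V (r + 1 / real (Suc n)))"
    proof (rule INF_greatest)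
      fix n :: nat
      let ?s = "r + 1 / real (Suc n)"
      have s: "r < ?s" by simp
      show "t \<le> ?V ?s"
      proof (cases "?s \<le> R")
        case True
        have "?s \<notin> S" using cSup_upper[OF _ bdd, of ?s] s unfolding r_def[symmetric] by auto
        then show ?thesis using True r0 s unfolding S_def by (simp add: not_le) 
      next
        case False
        then have "?V R \<le> ?V ?s" by (intro emeasure_sball_mono) simp
        with t show ?thesis by (rule order_trans)
      qed
    qed
    ultimately show ?thesis by (simp add: emeasure_cball_eq_sball)
  qed
  show ?thesis using that[OF r0] le ge by simp
qed

lemma sball_eq_carr:
  assumes "X = Sph" "r > pi" shows "sball X orig r = (carr X :: 'n::finite point set)"
  using assms sdist_orig_le_pi by (force simp: sball_orig)

lemma emeasure_sball_full:
  assumes "X = Sph" "r \<ge> pi" shows "emeasure (vol X) (sball X orig r :: 'n::finite point set) = emeasure (vol X) (carr X :: 'n point set)"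
proof -
  have "{x \<in> carr X :: 'n point set. sdist X x orig \<le> r} = carr X"
    using assms sdist_orig_le_pi by force
  then show ?thesis using emeasure_cball_eq_sball[of X r, where 'n = 'n] by simp
qed

text \<open>Ball volumes increase strictly up to radius \<pi> on the sphere. The excluded case is
  genuine: the open ball of radius \<pi> misses the antipode and still has full volume.\<close>

lemma sball_eq_of_measure_eq:
  assumes V: "emeasure (vol X) (sball X orig r :: 'n::finite point set) = emeasure (vol X) (sball X orig r' :: 'n point set)"
    and nf: "X = Sph \<Longrightarrow> emeasure (vol X) (sball X orig r :: 'n point set) \<noteq> emeasure (vol X) (carr X :: 'n point set)"
  shows "(sball X orig r :: 'n point set) = sball X orig r'"
proof -
  have *: "(sball X orig r :: 'n point set) = sball X orig r'"
    if V: "emeasure (vol X) (sball X orig r :: 'n point set) = emeasure (vol X) (sball X orig r' :: 'n point set)"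
    and nf: "X = Sph \<Longrightarrow> emeasure (vol X) (sball X orig r :: 'n point set) \<noteq> emeasure (vol X) (carr X :: 'n point set)"
    and lt: "r < r'" for r r'
  proof (cases "r' \<le> 0")
    case True then show ?thesis using lt by (simp add: sball_empty)
  next
    case False
    have e: "(sball X orig (max r 0) :: 'n point set) = sball X orig r"
      by (cases "r \<le> 0") (simp_all add: sball_empty)
    have "X = Sph \<Longrightarrow> max r 0 < pi"
      using nf emeasure_sball_full[of X r, where 'n = 'n] pi_gt_zero by (force simp: not_le[symmetric])
    then have "emeasure (vol X) (sball X orig (max r 0) :: 'n point set) < emeasure (vol X) (sball X orig r' :: 'n point set)"
      using lt False by (intro emeasure_sball_strict) auto
    with V e show ?thesis by simp
  qed
  show ?thesis
  proof (cases r r' rule: linorder_cases)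
    case less
    show ?thesis by (rule *[OF V _ less]) (rule nf)
  next
    case greater
    show ?thesis by (rule *[OF V[symmetric] _ greater, symmetric]) (use nf V in metis)
  qed simp
qed

lemma set_star_ball:
  assumes A: "A \<in> sets borel" and L: "\<And>x. x \<in> A \<Longrightarrow> x \<in> carr X \<and> sdist X x orig \<le> L"
  obtains r where "r \<ge> 0" "set_star X A = sball X orig r"
    "emeasure (vol X) (sball X orig r :: 'n point set) = emeasure (vol X) (A :: 'n::finite point set)"
proof (cases "X = Sph \<and> emeasure (vol X) A = emeasure (vol X) (carr X :: 'n point set)")
  case True
  then have "set_star X A = carr X" unfolding set_star_def by (rule if_P)
  \<comment> \<open>Any radius above \<pi> gives the whole sphere.\<close>
  moreover have c: "sball X orig 4 = (carr X :: 'n point set)"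
    by (rule sball_eq_carr) (use True pi_less_4 in auto)
  ultimately have "set_star X A = sball X orig 4" by (simp only:)
  moreover have "emeasure (vol X) (sball X orig 4 :: 'n point set) = emeasure (vol X) A"
    unfolding c by (rule True[THEN conjunct2, symmetric])
  ultimately show ?thesis using that[of 4] by simp
next
  case False
  have "A \<subseteq> sball X orig (max L 0 + 1)" using L by (force simp: sball_orig)
  then have le: "emeasure (vol X) A \<le> emeasure (vol X) (sball X orig (max L 0 + 1) :: 'n point set)"
    by (intro emeasure_mono sball_borel')
  have "max L 0 + 1 \<ge> 0" by simp
  then obtain r where r: "r \<ge> 0" "emeasure (vol X) (sball X orig r :: 'n point set) = emeasure (vol X) A"
    by (rule sball_with_measure[OF _ le])
  have "(THE B. (\<exists>r. B = sball X orig r) \<and> emeasure (vol X) B = emeasure (vol X) A) = (sball X orig r :: 'n point set)"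
  proof (rule the_equality)
    fix B :: "'n point set" assume "(\<exists>r. B = sball X orig r) \<and> emeasure (vol X) B = emeasure (vol X) A"
    then obtain r' where r': "B = sball X orig r'" "emeasure (vol X) B = emeasure (vol X) A" by blast
    have e: "emeasure (vol X) (sball X orig r' :: 'n point set) = emeasure (vol X) A"
      using r'(2) unfolding r'(1) .
    show "B = sball X orig r" unfolding r'(1)
    proof (rule sball_eq_of_measure_eq)
      show "emeasure (vol X) (sball X orig r' :: 'n point set) = emeasure (vol X) (sball X orig r :: 'n point set)"
        unfolding e r(2) ..
      show "emeasure (vol X) (sball X orig r' :: 'n point set) \<noteq> emeasure (vol X) (carr X :: 'n point set)" if "X = Sph"
        unfolding e using False that by blast
    qed
  qed (use r in auto)
  then have "set_star X A = sball X orig r" unfolding set_star_def using False by auto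
  then show ?thesis using that r by blast
qed

lemma set_star_cong:
  assumes "emeasure (vol X) A = emeasure (vol X) B" shows "set_star X A = set_star X B"
  unfolding set_star_def assms ..

lemma set_star_mono:
  fixes A B :: "'n::finite point set"
  assumes A: "A \<in> sets borel" and B: "B \<in> sets borel" and sub: "A \<subseteq> B"
    and L: "\<And>x. x \<in> B \<Longrightarrow> x \<in> carr X \<and> sdist X x orig \<le> L"
  shows "set_star X A \<subseteq> set_star X B"
proof -
  obtain r where r: "set_star X A = sball X orig r" "emeasure (vol X) (sball X orig r :: 'n point set) = emeasure (vol X) A"
    by (rule set_star_ball[OF A, of X L]) (use L sub in auto)
  obtain q where q: "set_star X B = sball X orig q" "emeasure (vol X) (sball X orig q :: 'n point set) = emeasure (vol X) B"
    by (rule set_star_ball[OF B L])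
  show ?thesis
  proof (cases "r \<le> q")
    case True then show ?thesis using r q sball_mono by simp
  next
    case False
    \<comment> \<open>In the wrong order of radii the two volumes agree, and \<open>set_star\<close>
      depends on the volume alone.\<close>
    then have "emeasure (vol X) B \<le> emeasure (vol X) A"
      using emeasure_sball_mono[of q r X, where 'n = 'n] r q by simp
    moreover have "emeasure (vol X) A \<le> emeasure (vol X) B" using B sub by (intro emeasure_mono) simp_all
    ultimately show ?thesis using set_star_cong[of X A B] by simp
  qed
qed

text \<open>The class kept by polarization: compact support is replaced by a radius
  \<open>L\<close>, which stays the same along the whole random sequence.\<close>

definition radial_support :: "space_form \<Rightarrow> real \<Rightarrow> ('n::finite point \<Rightarrow> real) \<Rightarrow> bool" where
  "radial_support X L f \<longleftrightarrow> continuous_on (carr X) f \<and> (\<forall>x\<in>carr X. 0 \<le> f x) \<and>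
     (\<forall>x\<in>carr X. f x \<noteq> 0 \<longrightarrow> sdist X x orig \<le> L)"

definition level :: "space_form \<Rightarrow> ('n::finite point \<Rightarrow> real) \<Rightarrow> real \<Rightarrow> 'n point set" where
  "level X f t = {x \<in> carr X. f x > t}"

lemma radial_supportD:
  assumes "radial_support X L f"
  shows "continuous_on (carr X) f" "\<And>x. x \<in> carr X \<Longrightarrow> 0 \<le> f x"
    "\<And>x. x \<in> carr X \<Longrightarrow> f x \<noteq> 0 \<Longrightarrow> sdist X x orig \<le> L"
  using assms unfolding radial_support_def by blast+

lemma radial_support_bounded:
  fixes f :: "'n::finite point \<Rightarrow> real"
  assumes f: "radial_support X L f"
  obtains M where "M > 0" "\<And>x. x \<in> carr X \<Longrightarrow> f x \<le> M"
proof -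
  let ?K = "{x \<in> carr X :: 'n point set. sdist X x orig \<le> L}"
  have "continuous_on ?K f" by (rule continuous_on_subset[OF radial_supportD(1)[OF f]]) auto
  then have "compact (f ` ?K)" using compact_cball by (rule compact_continuous_image)
  then have "bdd_above (f ` ?K)" by (intro bounded_imp_bdd_above compact_imp_bounded)
  then obtain B where B: "\<And>x. x \<in> ?K \<Longrightarrow> f x \<le> B" unfolding bdd_above_def by blast
  show ?thesis
  proof (rule that[of "max B 1"])
    fix x :: "'n point" assume x: "x \<in> carr X"
    show "f x \<le> max B 1" 
      using B[of x] radial_supportD(3)[OF f x] x by (cases "f x = 0") auto
  qed simp
qed

lemma level_openin:
  assumes "continuous_on (carr X) f" shows "openin (top_of_set (carr X)) (level X f t)"
  using continuous_openin_preimage_gen[OF assms, of "{t<..}"] by (simp add: level_def Int_def vimage_def)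

lemma level_borel:
  assumes f: "radial_support X L f" shows "level X f t \<in> sets borel"
  by (rule openin_carr_borel[OF level_openin[OF radial_supportD(1)[OF f]]])

lemma level_support:
  assumes f: "radial_support X L f" and "t \<ge> 0" "x \<in> level X f t"
  shows "x \<in> carr X \<and> sdist X x orig \<le> L"
  using assms(2,3) radial_supportD(3)[OF f, of x] by (auto simp: level_def)

lemma fun_star_level: "fun_star X f x = (LINT t:{0<..}|lborel. indicator (set_star X (level X f t)) x)"
  by (simp add: fun_star_def level_def)

lemma set_star_level_mono:
  assumes f: "radial_support X L f" and g: "radial_support X L' g"
    and "0 \<le> s" and sub: "level X f t \<subseteq> level X g s"
  shows "set_star X (level X f t) \<subseteq> set_star X (level X g s)"
  by (rule set_star_mono[OF level_borel[OF f] level_borel[OF g] sub level_support[OF g assms(3)]])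

lemma set_star_level_antimono:
  assumes f: "radial_support X L f" and "0 \<le> s" "s \<le> t"
  shows "set_star X (level X f t) \<subseteq> set_star X (level X f s)"
  by (rule set_star_level_mono[OF f f \<open>0 \<le> s\<close>]) (use assms(3) in \<open>auto simp: level_def\<close>)

lemma set_star_level_ball:
  assumes f: "radial_support X L (f :: 'n::finite point \<Rightarrow> real)" and "0 \<le> t"
  obtains r where "r \<ge> 0" "set_star X (level X f t) = sball X orig r"
    "emeasure (vol X) (sball X orig r :: 'n point set) = emeasure (vol X) (level X f t)"
  by (rule set_star_ball[OF level_borel[OF f] level_support[OF f assms(2)]])

lemma level_eq_empty:
  assumes M: "\<And>x. x \<in> carr X \<Longrightarrow> f x \<le> M" and t: "t \<ge> M"
  shows "level X f t = {}"
proof (rule equals0I)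
  fix x assume "x \<in> level X f t"
  then have "x \<in> carr X" "f x > t" by (simp_all add: level_def)
  with M[of x] t show False by simp
qed

lemma set_star_empty: "set_star X ({} :: 'n::finite point set) = {}"
proof -
  obtain r where r: "r \<ge> 0" "set_star X ({} :: 'n point set) = sball X orig r"
     "emeasure (vol X) (sball X orig r :: 'n point set) = emeasure (vol X) ({} :: 'n point set)"
    by (rule set_star_ball[of "{} :: 'n point set" X 0]) auto
  then have "r \<le> 0" using emeasure_sball_pos[of r X, where 'n = 'n] by (cases "r \<le> 0") auto
  then show ?thesis using r(2) sball_empty[of r X, where 'n = 'n] by simp
qed

text \<open>The parameters \<open>t\<close> for which \<open>x\<close> lies in the rearranged level
  set form an interval starting at 0, and \<open>fun_star X f x\<close> is its length. Whether the
  right end belongs to it is left open, hence the strict and the weak inequality. All later facts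
  about \<open>fun_star\<close> come from here.\<close>

lemma fun_star_props:
  fixes f :: "'n::finite point \<Rightarrow> real"
  assumes f: "radial_support X L f" and M: "\<And>x. x \<in> carr X \<Longrightarrow> f x \<le> M" "M \<ge> 0"
  shows "0 \<le> fun_star X f x" "fun_star X f x \<le> M"
    and "\<And>t. 0 < t \<Longrightarrow> t < fun_star X f x \<Longrightarrow> x \<in> set_star X (level X f t)"
    and "\<And>t. 0 < t \<Longrightarrow> x \<in> set_star X (level X f t) \<Longrightarrow> t \<le> fun_star X f x"
proof -
  define T where "T = {t. 0 < t \<and> x \<in> set_star X (level X f t)}"
  have TM: "t < M" if "t \<in> T" for t
  proof (rule ccontr)
    assume "\<not> t < M"
    then have "level X f t = {}" by (intro level_eq_empty[OF M(1)]) simp_all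
    with that show False by (simp add: T_def set_star_empty)
  qed
  have down: "s \<in> T" if "t \<in> T" "0 < s" "s \<le> t" for s t
    using that set_star_level_antimono[OF f, of s t] by (auto simp: T_def)
  \<comment> \<open>The supremum of the empty set is unspecified, while the integral is then
    0.\<close>
  define c where "c = (if T = {} then 0 else Sup T)"
  have bdd: "bdd_above T" using TM by (auto simp: bdd_above_def intro: less_imp_le)
  have up: "t \<le> c" if "t \<in> T" for t using cSup_upper[OF that bdd] that by (auto simp: c_def)
  have low: "t \<in> T" if "0 < t" "t < c" for t
  proof -
    have ne: "T \<noteq> {}" "c = Sup T" using that by (auto simp: c_def split: if_splits)
    have "t < Sup T" using that(2) ne(2) by simp
    then obtain s where "s \<in> T" "t < s" unfolding less_cSup_iff[OF ne(1) bdd] by blast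
    then show ?thesis using down[of s t] that by simp
  qed
  have c0: "c \<ge> 0"
  proof (cases "T = {}")
    case False
    then obtain t where "t \<in> T" by blast
    then show ?thesis using up[of t] by (simp add: T_def)
  qed (simp add: c_def)
  have cM: "c \<le> M"
  proof (cases "T = {}")
    case False
    have "Sup T \<le> M" by (rule cSup_least[OF False]) (rule less_imp_le[OF TM])
    then show ?thesis using False by (simp add: c_def)
  qed (use M in \<open>simp add: c_def\<close>)
  have T: "T = {0<..<c} \<or> T = {0<..c}"
  proof (cases "c \<in> T")
    case True
    have "T = {0<..c}"
    proof (intro equalityI subsetI)
      fix t assume "t \<in> {0<..c}" then show "t \<in> T" using down[OF True, of t] by simp
    qed (use up in \<open>auto simp: T_def\<close>)
    then show ?thesis ..
  next
    case False
    have "T = {0<..<c}"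
    proof (intro equalityI subsetI)
      fix t assume t: "t \<in> T"
      then have "t \<le> c" "t \<noteq> c" "0 < t" using up[of t] False by (auto simp: T_def)
      then show "t \<in> {0<..<c}" by simp
    qed (use low in auto)
    then show ?thesis ..
  qed
  have "fun_star X f x = (LINT t|lborel. indicator T t)"
    unfolding fun_star_level set_lebesgue_integral_def
    by (intro Bochner_Integration.integral_cong) (auto simp: T_def indicator_def)
  also have "\<dots> = c" using T c0 by auto
  finally have fc: "fun_star X f x = c" .
  show "0 \<le> fun_star X f x" "fun_star X f x \<le> M" using c0 cM fc by simp_all
  show "x \<in> set_star X (level X f t)" if "0 < t" "t < fun_star X f x" for t
    using low[of t] that fc by (simp add: T_def)
  show "t \<le> fun_star X f x" if "0 < t" "x \<in> set_star X (level X f t)" for t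
    using up[of t] that fc by (simp add: T_def)
qed

lemma fun_star_radial:
  fixes f :: "'n::finite point \<Rightarrow> real"
  assumes f: "radial_support X L f" and x: "x \<in> carr X" and y: "y \<in> carr X"
    and le: "sdist X x orig \<le> sdist X y orig"
  shows "fun_star X f y \<le> fun_star X f x"
proof (rule ccontr)
  assume neg: "\<not> ?thesis"
  obtain M where M: "M > 0" "\<And>x. x \<in> carr X \<Longrightarrow> f x \<le> M" by (rule radial_support_bounded[OF f]) blast
  note P = fun_star_props[OF f M(2) less_imp_le[OF M(1)]]
  define t where "t = (fun_star X f x + fun_star X f y) / 2"
  have t: "0 < t" "t < fun_star X f y" "fun_star X f x < t"
    using neg P(1)[of x] by (auto simp: t_def field_simps)
  have "y \<in> set_star X (level X f t)" using P(3) t by blast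
  moreover obtain r where "set_star X (level X f t) = sball X orig r"
    by (rule set_star_level_ball[OF f, of t]) (use t in auto)
  ultimately have "x \<in> set_star X (level X f t)" using x le by (simp add: sball_orig)
  then have "t \<le> fun_star X f x" using P(4) t by blast
  with t show False by simp
qed

text \<open>Adding a constant only shifts the levels, and rearrangement of sets is monotone. Used in
  both directions, this makes rearrangement a contraction for the supremum norm.\<close>

lemma fun_star_le_add:
  fixes f g :: "'n::finite point \<Rightarrow> real"
  assumes f: "radial_support X L f" and g: "radial_support X L' g" and e: "e \<ge> 0"
    and le: "\<And>x. x \<in> carr X \<Longrightarrow> f x \<le> g x + e"
  shows "fun_star X f x \<le> fun_star X g x + e"
proof (rule ccontr)
  assume neg: "\<not> ?thesis"
  obtain M where M: "M > 0" "\<And>x. x \<in> carr X \<Longrightarrow> f x \<le> M" by (rule radial_support_bounded[OF f]) blast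
  obtain N where N: "N > 0" "\<And>x. x \<in> carr X \<Longrightarrow> g x \<le> N" by (rule radial_support_bounded[OF g]) blast
  note P = fun_star_props[OF f M(2) less_imp_le[OF M(1)]] and Q = fun_star_props[OF g N(2) less_imp_le[OF N(1)]]
  define t where "t = (fun_star X f x + (fun_star X g x + e)) / 2"
  have t: "0 < t - e" "0 < t" "t < fun_star X f x" "fun_star X g x < t - e"
    using neg Q(1)[of x] e by (auto simp: t_def field_simps)
  have "level X f t \<subseteq> level X g (t - e)" using le by (force simp: level_def)
  then have "set_star X (level X f t) \<subseteq> set_star X (level X g (t - e))"
    using t by (intro set_star_level_mono[OF f g]) simp_all
  moreover have "x \<in> set_star X (level X f t)" using P(3) t by blast
  ultimately have "t - e \<le> fun_star X g x" using Q(4) t by blast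
  with t show False by simp
qed

section \<open>Strict comparison of level sets and disordered pairs\<close>

lemma connected_carr: "connected (carr X :: 'n::finite point set)"
proof (cases X)
  case Sph
  have "2 \<le> DIM('n point)" by (simp add: Suc_leI)
  then have "connected (sphere (0 :: 'n point) 1)" by (rule connected_sphere)
  moreover have "sphere (0 :: 'n point) 1 = carr Sph" by (auto simp: carr_def)
  ultimately show ?thesis using Sph by simp
next
  case Euc
  have "carr Euc = (\<lambda>v :: real^'n. (v, 1 :: real)) ` UNIV" by (auto simp: carr_def)
  then show ?thesis unfolding Euc
    by (auto intro!: connected_continuous_image continuous_intros connected_UNIV)
next
  case Hyp
  have "carr Hyp = (\<lambda>v :: real^'n. (v, sqrt (1 + (norm v)\<^sup>2))) ` UNIV"
  proof (intro equalityI subsetI)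
    fix x :: "'n point" assume "x \<in> carr Hyp"
    then have "(snd x)\<^sup>2 = 1 + (norm (fst x))\<^sup>2" "snd x > 0" by (auto simp: carr_def)
    then have "x = (fst x, sqrt (1 + (norm (fst x))\<^sup>2))" by (metis less_imp_le prod.collapse real_sqrt_unique)
    then show "x \<in> (\<lambda>v :: real^'n. (v, sqrt (1 + (norm v)\<^sup>2))) ` UNIV" by blast
  qed (auto simp: carr_def add_pos_nonneg)
  then show ?thesis unfolding Hyp
    by (auto intro!: connected_continuous_image continuous_intros connected_UNIV)
qed

text \<open>The carrier is connected, so \<open>g\<close> takes the value halfway between
  \<open>s\<close> and \<open>t\<close>; the points with values strictly between them form a
  nonempty relatively open gap.\<close>

lemma level_measure_strict:
  fixes g :: "'n::finite point \<Rightarrow> real"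
  assumes g: "radial_support X L g" and st: "0 \<le> s" "s < t"
    and x: "x \<in> carr X" "g x \<le> s" and y: "y \<in> carr X" "g y > t"
  shows "emeasure (vol X) (level X g t) < emeasure (vol X) (level X g s)"
proof (rule emeasure_vol_subset_strict)
  have c: "continuous_on (carr X) g" by (rule radial_supportD(1)[OF g])
  let ?U = "level X g s \<inter> {z \<in> carr X. g z < t}"
  have "openin (top_of_set (carr X)) {z \<in> carr X. g z < t}"
    using continuous_openin_preimage_gen[OF c, of "{..<t}"] by (simp add: Int_def vimage_def)
  then show "openin (top_of_set (carr X)) ?U" by (intro openin_Int level_openin c)
  have "connected (g ` carr X)" by (intro connected_continuous_image c connected_carr)
  moreover have "g x \<in> g ` carr X" "g y \<in> g ` carr X" using x y by auto
  moreover have "g x \<le> (s + t) / 2" "(s + t) / 2 \<le> g y" using x y st by (auto simp: field_simps)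
  ultimately have "(s + t) / 2 \<in> g ` carr X" by (meson connectedD_interval)
  then obtain z where "z \<in> carr X" "g z = (s + t) / 2" by force
  then have "z \<in> ?U" using st by (simp add: level_def field_simps)
  then show "?U \<noteq> {}" by blast
  show "level X g t \<subseteq> level X g s" using st by (auto simp: level_def)
  obtain r where "emeasure (vol X) (sball X orig r :: 'n point set) = emeasure (vol X) (level X g t)"
    by (rule set_star_level_ball[OF g, of t]) (use st in auto)
  then show "emeasure (vol X) (level X g t) < \<infinity>"
    using emeasure_sball_finite[of X r, where 'n = 'n] by simp
  show "?U \<subseteq> level X g s" "level X g t \<inter> ?U = {}" by (auto simp: level_def)
qed (rule level_borel[OF g])+

text \<open>Equal volumes forbid an inclusion whose gap contains a relatively open set: points of
  the level set beyond radius \<open>r\<close> in the first case, points of the ball with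
  \<open>g < t\<close> in the second.\<close>

lemma level_subset_strict:
  fixes g :: "'n::finite point \<Rightarrow> real"
  assumes B: "emeasure (vol X) (level X g t) = emeasure (vol X) (sball X orig r :: 'n point set)"
    and g: "radial_support X L g"
  shows "x \<in> level X g t \<Longrightarrow> sdist X x orig > r \<Longrightarrow> \<not> sball X orig r \<subseteq> level X g t"
    and "x \<in> carr X \<Longrightarrow> g x < t \<Longrightarrow> sdist X x orig < r \<Longrightarrow> \<not> level X g t \<subseteq> sball X orig r"
proof -
  have c: "continuous_on (carr X) g" by (rule radial_supportD(1)[OF g])
  assume x: "x \<in> level X g t" "sdist X x orig > r"
  show "\<not> sball X orig r \<subseteq> level X g t"
  proof
    assume sub: "sball X orig r \<subseteq> level X g t"
    let ?U = "level X g t \<inter> {x \<in> carr X. r < sdist X x orig}"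
    have "emeasure (vol X) (sball X orig r :: 'n point set) < emeasure (vol X) (level X g t)"
    proof (rule emeasure_vol_subset_strict[OF _ level_borel[OF g] emeasure_sball_finite _ _ sub])
      show "openin (top_of_set (carr X)) ?U" by (intro openin_Int level_openin c openin_carr_sdist)
      have "x \<in> ?U" using x by (simp add: level_def)
      then show "?U \<noteq> {}" by blast
      show "sball X orig r \<inter> ?U = {}" by (auto simp: sball_orig)
    qed (auto simp: sball_borel)
    with B show False by simp
  qed
next
  have c: "continuous_on (carr X) g" by (rule radial_supportD(1)[OF g])
  assume x: "x \<in> carr X" "g x < t" "sdist X x orig < r"
  show "\<not> level X g t \<subseteq> sball X orig r"
  proof
    assume sub: "level X g t \<subseteq> sball X orig r"
    let ?U = "{z \<in> carr X. g z < t} \<inter> {x \<in> carr X. sdist X x orig < r}"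
    have "emeasure (vol X) (level X g t) < emeasure (vol X) (sball X orig r :: 'n point set)"
    proof (rule emeasure_vol_subset_strict[OF level_borel[OF g] _ _ _ _ sub])
      have "openin (top_of_set (carr X)) {z \<in> carr X. g z < t}"
        using continuous_openin_preimage_gen[OF c, of "{..<t}"] by (simp add: Int_def vimage_def)
      then show "openin (top_of_set (carr X)) ?U" by (intro openin_Int openin_carr_sdist)
      have "x \<in> ?U" using x by simp
      then show "?U \<noteq> {}" by blast
      show "level X g t \<inter> ?U = {}" "?U \<subseteq> sball X orig r" by (auto simp: sball_orig level_def)
      show "emeasure (vol X) (level X g t) < \<infinity>" unfolding B by (rule emeasure_sball_finite)
    qed (rule sball_borel[OF orig_carr])
    with B show False by simp
  qed
qed

text \<open>Only finitely many levels \<open>k * e / 4\<close> below the maximum matter; the radii of the balls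
  rearranging consecutive level sets are separated by a uniform gap whenever they differ.\<close>

lemma disorder_pair:
  fixes f :: "'n::finite point \<Rightarrow> real"
  assumes f: "radial_support X L f" and e: "e > 0"
  obtains \<eta> where "\<eta> > 0"
    "\<And>g x. radial_support X L g \<Longrightarrow> (\<And>t. t > 0 \<Longrightarrow> emeasure (vol X) (level X g t) = emeasure (vol X) (level X f t)) \<Longrightarrow>
      x \<in> carr X \<Longrightarrow> \<bar>g x - fun_star X f x\<bar> > e \<Longrightarrow>
      \<exists>a\<in>carr X. \<exists>b\<in>carr X. sdist X b orig \<ge> sdist X a orig + \<eta> \<and> g b \<ge> g a + e / 2"
proof -
  obtain M where M: "M > 0" "\<And>x. x \<in> carr X \<Longrightarrow> f x \<le> M" by (rule radial_support_bounded[OF f]) blast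
  have P: "0 \<le> fun_star X f y" "fun_star X f y \<le> M"
    "0 < t \<Longrightarrow> t < fun_star X f y \<Longrightarrow> y \<in> set_star X (level X f t)"
    "0 < t \<Longrightarrow> y \<in> set_star X (level X f t) \<Longrightarrow> t \<le> fun_star X f y" for t y
    using fun_star_props[OF f M(2) less_imp_le[OF M(1)]] by blast+
  have "\<exists>r. r \<ge> 0 \<and> set_star X (level X f t) = sball X orig r \<and>
    emeasure (vol X) (sball X orig r :: 'n point set) = emeasure (vol X) (level X f t)" if "t \<ge> 0" for t
    by (rule set_star_level_ball[OF f that]) blast
  then obtain \<rho> where \<rho>: "\<And>t. t \<ge> 0 \<Longrightarrow> \<rho> t \<ge> 0"
     "\<And>t. t \<ge> 0 \<Longrightarrow> set_star X (level X f t) = sball X orig (\<rho> t)"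
     "\<And>t. t \<ge> 0 \<Longrightarrow> emeasure (vol X) (sball X orig (\<rho> t) :: 'n point set) = emeasure (vol X) (level X f t)"
    by metis
  \<comment> \<open>Steps of \<open>e / 4\<close> place two consecutive levels within
    \<open>e / 2\<close> of \<open>fun_star X f x\<close>, leaving \<open>e / 2\<close> for the
    difference of values.\<close>
  define tt where "tt k = real k * (e / 4)" for k :: nat
  have tt: "tt k \<ge> 0" "tt (Suc k) = tt k + e / 4" "k > 0 \<Longrightarrow> tt k > 0" for k
    using e by (simp_all add: tt_def algebra_simps)
  obtain K where K: "M < tt K"
    using reals_Archimedean3[of "e / 4"] e unfolding tt_def by (metis divide_pos_pos zero_less_numeral)
  define gap where "gap k = \<rho> (tt k) - \<rho> (tt (Suc k))" for k
  \<comment> \<open>The element 1 keeps the set nonempty when no gap is positive.\<close>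
  define D where "D = insert 1 {gap k | k. k \<le> K \<and> gap k > 0}"
  have "{gap k | k. k \<le> K \<and> gap k > 0} \<subseteq> gap ` {..K}" by auto
  then have fin: "finite D" unfolding D_def by (intro finite.insertI) (rule finite_subset, auto)
  define \<eta> where "\<eta> = Min D"
  have "\<eta> \<in> D" unfolding \<eta>_def using fin by (intro Min_in) (auto simp: D_def)
  then have \<eta>0: "\<eta> > 0" by (auto simp: D_def)
  have \<eta>gap: "\<rho> (tt k) \<ge> \<rho> (tt (Suc k)) + \<eta>" if "k \<le> K" "\<rho> (tt (Suc k)) < \<rho> (tt k)" for k
  proof -
    have "gap k \<in> D" using that by (auto simp: D_def gap_def)
    then have "\<eta> \<le> gap k" unfolding \<eta>_def using fin by (intro Min_le)
    then show ?thesis by (simp add: gap_def)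
  qed
  show ?thesis
  proof (rule that[OF \<eta>0])
    fix g :: "'n point \<Rightarrow> real" and x
    assume g: "radial_support X L g"
      and eq: "\<And>t. t > 0 \<Longrightarrow> emeasure (vol X) (level X g t) = emeasure (vol X) (level X f t)"
      and x: "x \<in> carr X" and far: "\<bar>g x - fun_star X f x\<bar> > e"
    have B: "emeasure (vol X) (level X g t) = emeasure (vol X) (sball X orig (\<rho> t) :: 'n point set)" if "t > 0" for t
      using eq[OF that] \<rho>(3)[of t] that by simp
    have gM: "g y \<le> M" if y: "y \<in> carr X" for y
    proof (rule ccontr)
      assume "\<not> g y \<le> M"
      then have "y \<in> level X g M" using y by (simp add: level_def)
      then have "emeasure (vol X) (level X g M) > 0"
        by (intro emeasure_vol_openin_pos level_openin radial_supportD(1)[OF g]) blast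
      moreover have "level X f M = {}" by (rule level_eq_empty[OF M(2)]) simp_all
      ultimately show False using eq[OF M(1)] by simp
    qed
    \<comment> \<open>Two levels are used so that their radii differ: a value below and one above
      force the volumes, and so the radii, to differ strictly.\<close>
    have radii: "\<rho> (tt (Suc k)) < \<rho> (tt k)"
      if "k > 0" "y \<in> carr X" "g y \<le> tt k" "z \<in> carr X" "g z > tt (Suc k)" for k y z
    proof (rule ccontr)
      assume "\<not> \<rho> (tt (Suc k)) < \<rho> (tt k)"
      then have "emeasure (vol X) (sball X orig (\<rho> (tt k)) :: 'n point set) \<le> emeasure (vol X) (sball X orig (\<rho> (tt (Suc k))) :: 'n point set)"
        by (intro emeasure_sball_mono) simp
      moreover have "emeasure (vol X) (level X g (tt (Suc k))) < emeasure (vol X) (level X g (tt k))"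
        by (rule level_measure_strict[OF g _ _ that(2,3,4,5)]) (use e tt in auto)
      ultimately show False using B[of "tt k"] B[of "tt (Suc k)"] tt(3) that(1) by simp
    qed
    have kK: "k \<le> K" if "tt k < M" for k
    proof -
      have "tt k < tt K" using that K by simp
      then show ?thesis using e by (simp add: tt_def)
    qed
    let ?s = "fun_star X f x"
    have s0: "0 \<le> ?s" "?s \<le> M" by (simp_all add: P(1,2))
    show "\<exists>a\<in>carr X. \<exists>b\<in>carr X. sdist X b orig \<ge> sdist X a orig + \<eta> \<and> g b \<ge> g a + e / 2"
    proof (cases "g x > ?s + e")
      case True
      \<comment> \<open>\<open>tt k\<close> is the first level above \<open>fun_star X f x\<close>,
        so \<open>x\<close> lies outside the ball belonging to it.\<close>
      define k where "k = nat \<lfloor>?s / (e / 4)\<rfloor> + 1"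
      have k: "k > 0" "?s < tt k" "tt k \<le> ?s + e / 4"
      proof -
        have fl: "0 \<le> \<lfloor>?s / (e / 4)\<rfloor>" using s0 e by simp
        then have rk: "real k = real_of_int \<lfloor>?s / (e / 4)\<rfloor> + 1" by (simp add: k_def)
        have "?s / (e / 4) < real k" "real k \<le> ?s / (e / 4) + 1" unfolding rk by linarith+
        then show "?s < tt k" "tt k \<le> ?s + e / 4" using e by (simp_all add: tt_def field_simps)
      qed (simp add: k_def)
      have gx: "g x > tt (Suc k)" using True k(3) tt(2)[of k] e by simp
      have xnot: "x \<notin> set_star X (level X f (tt k))" using P(4)[OF tt(3)[OF k(1)], of x] k(2) by auto
      then have rx: "sdist X x orig \<ge> \<rho> (tt k)" using \<rho>(2)[OF tt(1), of k] x by (simp add: sball_orig)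
      \<comment> \<open>Otherwise the level set is the whole carrier. On the sphere its
        rearrangement then contains \<open>x\<close>; in the other models points beyond the support
        radius contradict this.\<close>
      have "\<exists>y\<in>carr X. g y \<le> tt k"
      proof (rule ccontr)
        assume "\<not> ?thesis"
        then have "level X g (tt k) = carr X" by (force simp: level_def)
        then have full: "emeasure (vol X) (level X f (tt k)) = emeasure (vol X) (carr X :: 'n point set)"
          using eq[OF tt(3)[OF k(1)]] by simp
        show False
        proof (cases "X = Sph")
          case True
          then have "set_star X (level X f (tt k)) = carr X" using full unfolding set_star_def by simp
          with xnot x show False by simp
        next
          case False
          obtain y :: "'n point" where y: "y \<in> carr X" "sdist X y orig = \<bar>L\<bar> + 1"
            by (rule sdist_orig_attained[of "\<bar>L\<bar> + 1" X]) (use False in auto)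
          have "g y = 0"
          proof (rule ccontr)
            assume "g y \<noteq> 0"
            then have "\<bar>L\<bar> + 1 \<le> L" using radial_supportD(3)[OF g y(1)] y(2) by simp
            then show False by linarith
          qed
          with \<open>\<not> (\<exists>y\<in>carr X. g y \<le> tt k)\<close> y(1) tt(1)[of k] show False by force
        qed
      qed
      then obtain y where y: "y \<in> carr X" "g y \<le> tt k" by blast
      have r: "\<rho> (tt (Suc k)) < \<rho> (tt k)" by (rule radii[OF k(1) y x gx])
      have "tt k < M" using gx gM[OF x] tt(2)[of k] e by simp
      then have gp: "\<rho> (tt k) \<ge> \<rho> (tt (Suc k)) + \<eta>" using \<eta>gap kK r by blast
      \<comment> \<open>The level set reaches \<open>x\<close>, beyond the ball of its own volume,
        so it must miss a point \<open>a\<close> of that ball; the other radius supplies the gap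
        between \<open>a\<close> and \<open>x\<close>.\<close>
      have "\<not> sball X orig (\<rho> (tt (Suc k))) \<subseteq> level X g (tt (Suc k))"
        by (rule level_subset_strict(1)[OF B g, of _ x]) (use gx x r rx tt(3)[of "Suc k"] in \<open>auto simp: level_def\<close>)
      then obtain a where a: "a \<in> sball X orig (\<rho> (tt (Suc k)))" "a \<notin> level X g (tt (Suc k))" by blast
      then have a': "a \<in> carr X" "sdist X a orig < \<rho> (tt (Suc k))" "g a \<le> tt (Suc k)"
        by (auto simp: sball_orig level_def)
      have "sdist X x orig \<ge> sdist X a orig + \<eta>" using rx gp a' by simp
      moreover have "g x \<ge> g a + e / 2" using True k(3) tt(2)[of k] a' by simp
      ultimately show ?thesis using a'(1) x by blast
    next
      case False
      then have lt: "g x < ?s - e" using far by linarith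
      have "g x \<ge> 0" by (rule radial_supportD(2)[OF g x])
      then have se: "?s > e" using lt by simp
      \<comment> \<open>Now \<open>tt (Suc k)\<close> is the last level strictly below
        \<open>fun_star X f x\<close>, and \<open>tt k\<close> lies one step lower;
        \<open>?s > e\<close> keeps \<open>k\<close> positive.\<close>
      define k where "k = nat (\<lceil>?s / (e / 4)\<rceil> - 2)"
      have k: "k > 0" "tt (Suc k) < ?s" "?s \<le> tt (Suc k) + e / 4"
      proof -
        have "?s / (e / 4) > 4" using se e by (simp add: field_simps)
        then have "\<lceil>?s / (e / 4)\<rceil> > 4" by linarith
        then have k4: "real (Suc k) = real_of_int \<lceil>?s / (e / 4)\<rceil> - 1" and "k > 0" by (simp_all add: k_def)
        have "real (Suc k) < ?s / (e / 4)" "?s / (e / 4) \<le> real (Suc k) + 1" unfolding k4 by linarith+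
        then show "tt (Suc k) < ?s" "?s \<le> tt (Suc k) + e / 4" using e by (simp_all add: tt_def field_simps del: of_nat_Suc)
        show "k > 0" by fact
      qed
      have gx: "g x < tt k" using lt k(3) tt(2)[of k] e by simp
      have xin: "x \<in> set_star X (level X f (tt (Suc k)))" using P(3)[OF tt(3) k(2)] by simp
      then have rx: "sdist X x orig < \<rho> (tt (Suc k))" using \<rho>(2)[OF tt(1), of "Suc k"] by (simp add: sball_orig)
      have "\<exists>z\<in>carr X. g z > tt (Suc k)"
      proof (rule ccontr)
        assume "\<not> ?thesis"
        then have "level X g (tt (Suc k)) = {}" by (auto simp: level_def)
        then have "emeasure (vol X) (sball X orig (\<rho> (tt (Suc k))) :: 'n point set) = 0"
          using B[OF tt(3), of "Suc k"] by simp
        moreover have "\<rho> (tt (Suc k)) > 0" using rx sdist_nonneg[OF x orig_carr] by linarith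
        ultimately show False using emeasure_sball_pos[of "\<rho> (tt (Suc k))" X, where 'n = 'n] by simp
      qed
      then obtain z where z: "z \<in> carr X" "g z > tt (Suc k)" by blast
      have r: "\<rho> (tt (Suc k)) < \<rho> (tt k)" by (rule radii[OF k(1) x less_imp_le[OF gx] z])
      have "tt k < M" using k(2) s0(2) tt(2)[of k] e by simp
      then have gp: "\<rho> (tt k) \<ge> \<rho> (tt (Suc k)) + \<eta>" using \<eta>gap kK r by blast
      \<comment> \<open>The mirror argument: the level set omits a neighbourhood of \<open>x\<close>
        inside the ball of its own volume, so it has a point \<open>b\<close> outside that
        ball.\<close>
      have "\<not> level X g (tt k) \<subseteq> sball X orig (\<rho> (tt k))"
        by (rule level_subset_strict(2)[OF B g x gx]) (use r rx k tt(3) in auto)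
      then obtain b where "b \<in> level X g (tt k)" "b \<notin> sball X orig (\<rho> (tt k))" by blast
      then have b: "b \<in> carr X" "g b > tt k" "sdist X b orig \<ge> \<rho> (tt k)"
        by (simp_all add: level_def sball_orig)
      have "sdist X b orig \<ge> sdist X x orig + \<eta>" using b gp rx by simp
      moreover have "g b \<ge> g x + e / 2" using b lt k(3) tt(2)[of k] by simp
      ultimately show ?thesis using x b(1) by blast
    qed
  qed
qed

section \<open>First moment of a polarized function\<close>

context
  fixes X :: space_form and p :: "'n::finite point" and \<sigma> :: "'n point \<Rightarrow> 'n point"
  assumes p: "p \<in> carr X"
  defines "\<sigma> \<equiv> rfl X orig p"
begin

lemma polg_radial_support:
  assumes g: "radial_support X L g"
  shows "radial_support X L (polg X \<sigma> g)"
  unfolding radial_support_def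
proof (intro conjI ballI impI)
  show "continuous_on (carr X) (polg X \<sigma> g)"
  proof (rule continuous_on_of_modulus)
    fix e :: real assume "e > 0"
    then obtain r where r: "r > 0" "\<forall>x\<in>carr X. \<forall>y\<in>carr X. sdist X x y < r \<longrightarrow> \<bar>g x - g y\<bar> \<le> e"
      using uniformly_continuous_of_support[OF radial_supportD(1,3)[OF g]] by blast
    show "\<exists>r>0. \<forall>x\<in>carr X. \<forall>y\<in>carr X. sdist X x y < r \<longrightarrow> \<bar>polg X \<sigma> g x - polg X \<sigma> g y\<bar> \<le> e"
    proof (intro exI[of _ r] conjI r(1) ballI impI)
      fix x y :: "'n point" assume xy: "x \<in> carr X" "y \<in> carr X" "sdist X x y < r"
      show "\<bar>polg X \<sigma> g x - polg X \<sigma> g y\<bar> \<le> e"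
        unfolding \<sigma>_def by (rule polg_modulus[OF p _ xy]) (use r(2) in blast)
    qed
  qed
  fix x :: "'n point" assume x: "x \<in> carr X"
  have sx: "\<sigma> x \<in> carr X" unfolding \<sigma>_def by (rule sig_carr[OF p x])
  have "polg X \<sigma> g x = g x \<or> polg X \<sigma> g x = g (\<sigma> x)" by (simp add: polg_def max_def min_def)
  then show "0 \<le> polg X \<sigma> g x"
    using radial_supportD(2)[OF g x] radial_supportD(2)[OF g sx] by auto
  assume nz: "polg X \<sigma> g x \<noteq> 0"
  show "sdist X x orig \<le> L"
    by (rule polg_support[OF p radial_supportD(2,3)[OF g] x nz[unfolded \<sigma>_def]])
qed

lemma level_polg_measure:
  assumes g: "radial_support X L g"
  shows "emeasure (vol X) (level X (polg X \<sigma> g) t) = emeasure (vol X) (level X g t)"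
proof -
  let ?A = "level X (polg X \<sigma> g) t" and ?B = "level X g t"
  have A: "?A \<in> sets borel" by (rule level_borel[OF polg_radial_support[OF g]])
  have B: "?B \<in> sets borel" by (rule level_borel[OF g])
  have two: "(\<integral>\<^sup>+x. indicator S x + indicator S (\<sigma> x) \<partial>vol X) = 2 * emeasure (vol X) S" 
    if S: "S \<in> sets borel" for S :: "'n point set"
  proof -
    have [measurable]: "indicator S \<in> borel_measurable borel" using S by simp
    have "(\<integral>\<^sup>+x. indicator S x + indicator S (\<sigma> x) \<partial>vol X)
      = (\<integral>\<^sup>+x. indicator S x \<partial>vol X) + (\<integral>\<^sup>+x. indicator S (\<sigma> x) \<partial>vol X)"
      unfolding \<sigma>_def by (rule nn_integral_add) measurable
    also have "(\<integral>\<^sup>+x. indicator S (\<sigma> x) \<partial>vol X) = (\<integral>\<^sup>+x. indicator S x \<partial>vol X)"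
      unfolding \<sigma>_def using vol_rfl[OF orig_carr p, of "indicator S"] by simp
    also have "(\<integral>\<^sup>+x. indicator S x \<partial>vol X) = emeasure (vol X) S" using S by simp
    finally show ?thesis by (simp add: mult_2)
  qed
  have "(\<integral>\<^sup>+x. indicator ?A x + indicator ?A (\<sigma> x) \<partial>vol X) = (\<integral>\<^sup>+x. indicator ?B x + indicator ?B (\<sigma> x) \<partial>vol X)"
  proof (rule nn_integral_cong_AE, rule eventually_mono[OF AE_vol_carr])
    fix x :: "'n point" assume x: "x \<in> carr X"
    have sx: "\<sigma> x \<in> carr X" unfolding \<sigma>_def by (rule sig_carr[OF p x])
    have ind: "indicator (level X h t) y = (indicator {y. h y > t} y :: ennreal)" if "y \<in> carr X" for h y
      using that by (simp add: level_def indicator_def)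
    show "indicator ?A x + indicator ?A (\<sigma> x) = (indicator ?B x + indicator ?B (\<sigma> x) :: ennreal)"
      unfolding ind[OF x] ind[OF sx] unfolding \<sigma>_def by (rule polg_level_sum[OF p x])
  qed
  then have "2 * emeasure (vol X) ?A = 2 * emeasure (vol X) ?B" unfolding two[OF A] two[OF B] .
  then show ?thesis by (simp add: ennreal_mult_cancel_left)
qed

end

text \<open>Functions are arbitrary off the carrier; the indicator makes the density Borel when
  \<open>g\<close> is continuous on the carrier.\<close>

definition moment_density :: "space_form \<Rightarrow> ('n::finite point \<Rightarrow> real) \<Rightarrow> 'n point \<Rightarrow> ennreal" where
  "moment_density X g x = ennreal (indicator (carr X) x * (g x * sdist X x orig))"

definition moment :: "space_form \<Rightarrow> ('n::finite point \<Rightarrow> real) \<Rightarrow> ennreal" where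
  "moment X g = (\<integral>\<^sup>+x. moment_density X g x \<partial>vol X)"

lemma moment_density_borel:
  assumes "continuous_on (carr X) g"
  shows "moment_density X g \<in> borel_measurable borel"
proof -
  have "continuous_on (carr X) (\<lambda>x. g x * sdist X x orig)"
    using assms by (intro continuous_intros continuous_on_sdist) simp_all
  then have "(\<lambda>x. indicator (carr X) x *\<^sub>R (g x * sdist X x orig)) \<in> borel_measurable borel"
    by (rule borel_measurable_continuous_on_indicator[OF carr_borel])
  then show ?thesis unfolding moment_density_def[abs_def] by simp
qed

text \<open>The pointwise inequality holds for the sum over a mirror pair, not at single points.
  Integrating that sum counts each moment twice, hence the factors 2.\<close>

lemma moment_polg:
  fixes p :: "'n::finite point"
  assumes p: "p \<in> carr X" and g: "radial_support X L g" and a: "a \<in> carr X" and c: "c \<ge> 0"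
    and gain: "\<And>x. c > 0 \<Longrightarrow> x \<in> sball X a r \<Longrightarrow> sdist X x orig < sdist X (rfl X orig p x) orig \<and>
      c \<le> (g (rfl X orig p x) - g x) * (sdist X (rfl X orig p x) orig - sdist X x orig)"
  shows "2 * moment X (polg X (rfl X orig p) g) + ennreal c * emeasure (vol X) (sball X orig r :: 'n point set) \<le> 2 * moment X g"
proof -
  let ?s = "rfl X orig p" and ?h = "polg X (rfl X orig p) g"
  have h: "radial_support X L ?h" by (rule polg_radial_support[OF p g])
  note cg = radial_supportD(1)[OF g] and ch = radial_supportD(1)[OF h]
  have [measurable]: "moment_density X g \<in> borel_measurable borel" "moment_density X ?h \<in> borel_measurable borel"
    by (rule moment_density_borel[OF cg], rule moment_density_borel[OF ch])
  have Bm: "sball X a r \<in> sets borel" by (rule sball_borel[OF a])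
  have [measurable]: "(indicator (sball X a r) :: 'n point \<Rightarrow> ennreal) \<in> borel_measurable borel"
    using Bm by simp
  have two: "(\<integral>\<^sup>+x. F x + F (?s x) \<partial>vol X) = 2 * (\<integral>\<^sup>+x. F x \<partial>vol X)"
    if [measurable]: "F \<in> borel_measurable borel" for F :: "'n point \<Rightarrow> ennreal"
    by (subst nn_integral_add) (simp_all add: vol_rfl[OF orig_carr p] mult_2)
  have "2 * moment X ?h + ennreal c * emeasure (vol X) (sball X orig r :: 'n point set)
     = (\<integral>\<^sup>+x. moment_density X ?h x + moment_density X ?h (?s x) \<partial>vol X) + (\<integral>\<^sup>+x. ennreal c * indicator (sball X a r) x \<partial>vol X)"
    unfolding moment_def by (simp add: two nn_integral_cmult Bm emeasure_vol_sball[OF a])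
  also have "\<dots> = (\<integral>\<^sup>+x. (moment_density X ?h x + moment_density X ?h (?s x)) + ennreal c * indicator (sball X a r) x \<partial>vol X)"
    by (rule nn_integral_add[symmetric]) measurable
  also have "\<dots> \<le> (\<integral>\<^sup>+x. moment_density X g x + moment_density X g (?s x) \<partial>vol X)"
  proof (rule nn_integral_mono_AE, rule eventually_mono[OF AE_vol_carr])
    fix x :: "'n point" assume x: "x \<in> carr X"
    have sx: "?s x \<in> carr X" by (rule sig_carr[OF p x])
    let ?c = "if x \<in> sball X a r then c else 0"
    have "?h x * sdist X x orig + ?h (?s x) * sdist X (?s x) orig + ?c
      \<le> g x * sdist X x orig + g (?s x) * sdist X (?s x) orig"
      by (rule polg_moment_pair[OF p x]) (use gain in \<open>auto split: if_splits\<close>)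
    moreover have nn: "0 \<le> u y * sdist X y orig" if "y \<in> carr X" "radial_support X L u" for y u
      by (intro mult_nonneg_nonneg radial_supportD(2)[OF that(2,1)] sdist_nonneg[OF that(1) orig_carr])
    moreover have comb: "ennreal A + ennreal B + ennreal q \<le> ennreal C + ennreal D"
      if "0 \<le> A" "0 \<le> B" "0 \<le> q" "0 \<le> C" "0 \<le> D" "A + B + q \<le> C + D" for A B C D q
    proof -
      have "ennreal A + ennreal B + ennreal q = ennreal (A + B + q)" using that by simp
      also have "\<dots> \<le> ennreal (C + D)" by (rule ennreal_leI) fact
      finally show ?thesis using that by simp
    qed
    ultimately have "ennreal (?h x * sdist X x orig) + ennreal (?h (?s x) * sdist X (?s x) orig) + ennreal ?c
      \<le> ennreal (g x * sdist X x orig) + ennreal (g (?s x) * sdist X (?s x) orig)"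
      by (intro comb nn x sx g h) (use c in simp_all)
    moreover have "ennreal c * indicator (sball X a r) x = ennreal ?c" by simp
    ultimately show "(moment_density X ?h x + moment_density X ?h (?s x)) + ennreal c * indicator (sball X a r) x
       \<le> moment_density X g x + moment_density X g (?s x)"
      using x sx unfolding moment_density_def by (simp only: indicator_simps mult_1)
  qed
  also have "\<dots> = 2 * moment X g" unfolding moment_def by (rule two) measurable
  finally show ?thesis .
qed

text \<open>For \<open>x\<close> in the ball about \<open>a\<close>, one \<rho> is lost from
  \<open>a\<close> to \<open>x\<close> and two from \<open>b\<close> to the image of
  \<open>x\<close>, so \<open>4 * \<rho>\<close> leaves a difference of distances of at least
  \<rho>. Likewise three oscillations of \<open>e / 16\<close> are subtracted from
  \<open>e / 4\<close>, leaving \<open>e / 16\<close>.\<close>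

lemma moment_polg_decrease:
  fixes p :: "'n::finite point"
  assumes p: "p \<in> carr X" and g: "radial_support X L g" and e: "e > 0" and \<rho>: "\<rho> > 0"
    and m: "\<And>x y. x \<in> carr X \<Longrightarrow> y \<in> carr X \<Longrightarrow> sdist X x y < \<rho> \<Longrightarrow> \<bar>g x - g y\<bar> \<le> e / 16"
    and a: "a \<in> carr X" and b: "b \<in> carr X"
    and d: "sdist X b orig \<ge> sdist X a orig + 4 * \<rho>" and ab: "g b \<ge> g a + e / 4"
    and near: "sdist X (rfl X orig p a) b < \<rho>"
  shows "2 * moment X (polg X (rfl X orig p) g) + ennreal (e / 16 * \<rho>) * emeasure (vol X) (sball X orig \<rho> :: 'n point set) \<le> 2 * moment X g"
proof (rule moment_polg[OF p g a])
  let ?s = "rfl X orig p"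
  fix x assume xx: "x \<in> sball X a \<rho>"
  then have x: "x \<in> carr X" and ax: "sdist X a x < \<rho>" by (simp_all add: sball_def)
  have sx: "?s x \<in> carr X" and sa: "?s a \<in> carr X" using sig_carr[OF p] x a by auto
  have sax: "sdist X (?s a) (?s x) < \<rho>" using sig_iso[OF p a x] ax by simp
  have 1: "sdist X x orig < sdist X a orig + \<rho>"
    using sdist_triangle[OF x a orig_carr] ax sdist_commute[of X a x] by linarith
  have 2: "sdist X b orig < sdist X (?s x) orig + 2 * \<rho>"
    using sdist_triangle[OF b sa orig_carr] sdist_triangle[OF sa sx orig_carr] sax near
      sdist_commute[of X "?s a" b] by linarith
  have A: "sdist X (?s x) orig - sdist X x orig \<ge> \<rho>" using 1 2 d by linarith
  have 3: "\<bar>g a - g x\<bar> \<le> e / 16" by (rule m[OF a x ax])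
  have 4: "\<bar>g (?s a) - g (?s x)\<bar> \<le> e / 16" by (rule m[OF sa sx sax])
  have 5: "\<bar>g (?s a) - g b\<bar> \<le> e / 16" by (rule m[OF sa b near])
  have B: "g (?s x) - g x \<ge> e / 16" using 3 4 5 ab by linarith
  show "sdist X x orig < sdist X (?s x) orig \<and>
      e / 16 * \<rho> \<le> (g (?s x) - g x) * (sdist X (?s x) orig - sdist X x orig)"
  proof
    show "sdist X x orig < sdist X (?s x) orig" using A \<rho> by linarith
    show "e / 16 * \<rho> \<le> (g (?s x) - g x) * (sdist X (?s x) orig - sdist X x orig)"
      by (rule mult_mono[OF B A]) (use B e \<rho> in linarith)+
  qed
qed (use e \<rho> in simp)

lemma moment_polg_le:
  fixes p :: "'n::finite point"
  assumes p: "p \<in> carr X" and g: "radial_support X L g"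
  shows "moment X (polg X (rfl X orig p) g) \<le> moment X g"
proof -
  have "2 * moment X (polg X (rfl X orig p) g) \<le> 2 * moment X g"
    using moment_polg[OF p g orig_carr, of 0 1] by simp
  then show ?thesis by (simp add: ennreal_mult_le_mult_iff)
qed

lemma moment_finite:
  fixes f :: "'n::finite point \<Rightarrow> real"
  assumes f: "radial_support X L f"
  shows "moment X f < \<infinity>"
proof -
  obtain M where M: "M > 0" "\<And>x. x \<in> carr X \<Longrightarrow> f x \<le> M" by (rule radial_support_bounded[OF f]) blast
  let ?B = "{x \<in> carr X :: 'n point set. sdist X x orig \<le> L}"
  have "moment X f \<le> (\<integral>\<^sup>+x. ennreal (M * \<bar>L\<bar>) * indicator ?B x \<partial>vol X)"
    unfolding moment_def
  proof (rule nn_integral_mono_AE, rule eventually_mono[OF AE_vol_carr])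
    fix x :: "'n point" assume x: "x \<in> carr X"
    have d: "0 \<le> sdist X x orig" by (rule sdist_nonneg[OF x orig_carr])
    show "moment_density X f x \<le> ennreal (M * \<bar>L\<bar>) * indicator ?B x"
    proof (cases "f x = 0")
      case False
      then have xL: "sdist X x orig \<le> L" by (rule radial_supportD(3)[OF f x])
      have "f x * sdist X x orig \<le> M * \<bar>L\<bar>"
        using M(1) M(2)[OF x] d xL by (intro mult_mono) auto
      then show ?thesis using x xL by (simp add: moment_density_def ennreal_leI)
    qed (simp add: moment_density_def)
  qed
  also have "\<dots> = ennreal (M * \<bar>L\<bar>) * emeasure (vol X) ?B"
    by (rule nn_integral_cmult_indicator) (simp add: sdist_borel)
  also have "\<dots> < \<infinity>" using emeasure_vol_cball_finite[of X L, where 'n = 'n] by (simp add: ennreal_mult_less_top)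
  finally show ?thesis .
qed

text \<open>Required for the moment to be measurable as an integral depending on the random
  parameter.\<close>

lemma sigma_finite_vol: "sigma_finite_measure (vol X :: 'n::finite point measure)"
proof (rule sigma_finite_measure.intro)
  let ?A = "insert (- carr X) (range (\<lambda>n. sball X orig (real n))) :: 'n point set set"
  show "\<exists>A::'n point set set. countable A \<and> A \<subseteq> sets (vol X) \<and> \<Union> A = space (vol X) \<and> (\<forall>a\<in>A. emeasure (vol X) a \<noteq> \<infinity>)"
  proof (intro exI[of _ ?A] conjI ballI)
    show "countable ?A" by simp
    show "?A \<subseteq> sets (vol X)" using sball_borel' by auto
    have "x \<in> \<Union> ?A" for x :: "'n point"
    proof (cases "x \<in> carr X")
      case True
      obtain n where "sdist X x orig < real n" using reals_Archimedean2 by blast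
      then have "x \<in> sball X orig (real n)" using True by (simp add: sball_orig)
      then show ?thesis by blast
    qed simp
    then show "\<Union> ?A = space (vol X)" by auto
    fix a assume "a \<in> ?A"
    then consider "a = - carr X" | n where "a = sball X orig (real n)" by blast
    then show "emeasure (vol X) a \<noteq> \<infinity>"
    proof cases
      case 1
      have "emeasure (vol X) a = emeasure (vol X) ({} :: 'n point set)"
        by (rule emeasure_eq_AE, rule eventually_mono[OF AE_vol_carr]) (auto simp: 1)
      then show ?thesis by simp
    next
      case 2
      show ?thesis unfolding 2 by (rule less_imp_neq[OF emeasure_sball_finite])
    qed
  qed
qed

section \<open>Random polarizations\<close>

text \<open>An explicit and jointly measurable substitute for \<open>refl_at\<close>, with which it
  agrees on the carrier almost surely.\<close>

definition tau :: "space_form \<Rightarrow> real \<times> (real^'n) \<Rightarrow> 'n::finite point \<Rightarrow> 'n point" where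
  "tau X \<omega> = rfl X orig (polar_point X \<omega>)"

text \<open>The value 0 off the carrier makes the iterates Borel on the ambient space.\<close>

definition pstep :: "space_form \<Rightarrow> real \<times> (real^'n) \<Rightarrow> ('n::finite point \<Rightarrow> real) \<Rightarrow> 'n point \<Rightarrow> real" where
  "pstep X \<omega> g x = (if x \<in> carr X then polg X (tau X \<omega>) g x else 0)"

primrec pseq :: "space_form \<Rightarrow> ('n::finite point \<Rightarrow> real) \<Rightarrow> (nat \<Rightarrow> real \<times> (real^'n)) \<Rightarrow> nat \<Rightarrow> 'n point \<Rightarrow> real" where
  "pseq X f w 0 = (\<lambda>x. if x \<in> carr X then f x else 0)"
| "pseq X f w (Suc n) = pstep X (w n) (pseq X f w n)"

lemma polar_point_Omega: "\<omega> \<in> Omega \<Longrightarrow> polar_point X \<omega> \<in> carr X"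
  by (rule polar_point_carr) (auto simp: Omega_def)

lemma radial_support_cong:
  assumes "\<And>x. x \<in> carr X \<Longrightarrow> f x = g x" "radial_support X L f"
  shows "radial_support X L g"
  using assms(2) unfolding radial_support_def
  by (simp add: assms(1) cong: continuous_on_cong)

lemma pstep_radial_support:
  assumes "\<omega> \<in> Omega" "radial_support X L g" shows "radial_support X L (pstep X \<omega> g)"
  by (rule radial_support_cong[OF _ polg_radial_support[OF polar_point_Omega[OF assms(1)] assms(2)]])
     (simp add: pstep_def tau_def)

lemma pseq_cong: "(\<And>i. i < n \<Longrightarrow> w i = w' i) \<Longrightarrow> pseq X f w n = pseq X f w' n"
  by (induction n) auto

context
  fixes X :: space_form and w :: "nat \<Rightarrow> real \<times> (real^'n::finite)" and f :: "'n point \<Rightarrow> real" and L :: real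
  assumes w: "\<And>i. w i \<in> Omega" and f: "radial_support X L f"
begin

lemma pseq_radial_support: "radial_support X L (pseq X f w n)"
proof (induction n)
  case 0 show ?case by (rule radial_support_cong[OF _ f]) simp
next
  case (Suc n) then show ?case using pstep_radial_support[OF w] by simp
qed

lemma pseq_modulus:
  assumes m: "\<And>x y. x \<in> carr X \<Longrightarrow> y \<in> carr X \<Longrightarrow> sdist X x y < r \<Longrightarrow> \<bar>f x - f y\<bar> \<le> e"
  shows "x \<in> carr X \<Longrightarrow> y \<in> carr X \<Longrightarrow> sdist X x y < r \<Longrightarrow> \<bar>pseq X f w n x - pseq X f w n y\<bar> \<le> e"
proof (induction n arbitrary: x y)
  case 0 then show ?case using m by simp
next
  case (Suc n)
  then show ?case
    using polg_modulus[OF polar_point_Omega[OF w[of n]], of X r "pseq X f w n" e x y]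
    by (simp add: pstep_def tau_def)
qed

lemma pseq_level: "emeasure (vol X) (level X (pseq X f w n) t) = emeasure (vol X) (level X f t)"
proof (induction n)
  case 0
  have "level X (pseq X f w 0) t = level X f t" by (auto simp: level_def)
  then show ?case by simp
next
  case (Suc n)
  have "level X (pseq X f w (Suc n)) t = level X (polg X (tau X (w n)) (pseq X f w n)) t"
    by (auto simp: level_def pstep_def)
  then show ?case
    using level_polg_measure[OF polar_point_Omega[OF w] pseq_radial_support] Suc
    by (simp add: tau_def)
qed

lemma pseq_close_mono:
  assumes "\<And>x. x \<in> carr X \<Longrightarrow> \<bar>pseq X f w n x - fun_star X f x\<bar> \<le> e" and "n \<le> m" and "x \<in> carr X"
  shows "\<bar>pseq X f w m x - fun_star X f x\<bar> \<le> e"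
  using assms(2,3)
proof (induction m arbitrary: x rule: dec_induct)
  case base then show ?case by (rule assms(1))
next
  case (step m)
  note p = polar_point_Omega[OF w[of m], of X]
  have "polg X (rfl X orig (polar_point X (w m))) (fun_star X f) x = fun_star X f x"
    by (rule polg_radial[OF p fun_star_radial[OF f] step.prems])
  moreover have "\<bar>polg X (rfl X orig (polar_point X (w m))) (pseq X f w m) x
      - polg X (rfl X orig (polar_point X (w m))) (fun_star X f) x\<bar> \<le> e"
    by (rule polg_nonexpansive[OF p step.IH step.prems])
  ultimately show ?case using step.prems by (simp add: pstep_def tau_def)
qed

end

lemma polarize_seq_pseq:
  assumes w: "\<And>i. w i \<in> Omega \<and> fst (w i) > 0 \<and> (X = Sph \<longrightarrow> fst (w i) \<le> pi)"
  shows "x \<in> carr X \<Longrightarrow> polarize_seq X w n f x = pseq X f w n x"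
proof (induction n arbitrary: x)
  case (Suc n)
  have "norm (snd (w n)) = 1" using w[of n] by (auto simp: Omega_def)
  then have r: "refl_at X (w n) = restrict (tau X (w n)) (carr X)"
    unfolding tau_def using w[of n] by (intro refl_at_eq) auto
  have c: "tau X (w n) x \<in> carr X"
    unfolding tau_def using w[of n] Suc.prems by (intro sig_carr polar_point_Omega) auto
  show ?case using Suc.IH[OF Suc.prems] Suc.IH[OF c] Suc.prems
    by (simp add: polarize_polg polg_def r pstep_def)
qed simp

lemma borel_measurable_polar_point [measurable]: "polar_point X \<in> borel_measurable borel"
  by (rule borel_measurable_continuous_onI[OF continuous_on_polar_point])

lemma borel_measurable_qd [measurable (raw)]:
  assumes [measurable]: "f \<in> borel_measurable M" "g \<in> borel_measurable M"
  shows "(\<lambda>x. qd X (f x) (g x)) \<in> borel_measurable M"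
  unfolding qd_def by measurable

lemma borel_measurable_tau [measurable (raw)]:
  assumes [measurable]: "f \<in> borel_measurable M" "g \<in> borel_measurable M"
  shows "(\<lambda>x. tau X (f x) (g x)) \<in> borel_measurable M"
proof -
  have [measurable]: "(\<lambda>x. polar_point X (f x)) \<in> borel_measurable M"
    by (rule measurable_compose[OF assms(1) borel_measurable_polar_point])
  show ?thesis unfolding tau_def rfl_def lam_def by measurable
qed

text \<open>With the polynomial \<open>qd\<close> instead of \<open>sdist\<close>, the case
  distinction is visibly measurable in the reflection and the point.\<close>

lemma pstep_qd:
  assumes "\<omega> \<in> Omega"
  shows "pstep X \<omega> g x = (if x \<in> carr X then
    (if qd X x orig \<le> qd X (tau X \<omega> x) orig then max (g x) (g (tau X \<omega> x)) else min (g x) (g (tau X \<omega> x))) else 0)"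
proof (cases "x \<in> carr X")
  case True
  then have "tau X \<omega> x \<in> carr X" unfolding tau_def by (rule sig_carr[OF polar_point_Omega[OF assms]])
  with True show ?thesis by (simp add: pstep_def polg_def sdist_le_iff)
qed (simp add: pstep_def)

section \<open>The product space and measurability of the iterates\<close>

locale random_polarizations =
  fixes X :: space_form and \<mu> :: "nat \<Rightarrow> (real \<times> (real^'n::finite)) measure"
  assumes law: "\<And>i. polarization_law X (\<mu> i)"
begin

abbreviation "P \<equiv> PiM UNIV \<mu>"

lemma prob_mu: "prob_space (\<mu> i)"
  using law[of i] by (simp add: polarization_law_def)

lemma sets_mu: "sets (\<mu> i) = sets (restrict_space borel Omega)"
  using law[of i] by (simp add: polarization_law_def)

lemma space_mu: "space (\<mu> i) = Omega"
  using sets_eq_imp_space_eq[OF sets_mu[of i]] by (simp add: space_restrict_space)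

lemma prob_P: "prob_space P"
  by (rule prob_space_PiM) (rule prob_mu)

lemma id_mu [measurable]: "(\<lambda>\<omega>. \<omega>) \<in> measurable (\<mu> i) borel"
  unfolding measurable_cong_sets[OF sets_mu refl] by (rule measurable_restrict_space1) simp

lemma coord_borel [measurable]: "(\<lambda>w. w i) \<in> measurable P borel"
proof -
  have "(\<lambda>w. w i) \<in> measurable P (\<mu> i)" by (rule measurable_component_singleton) simp
  from measurable_compose[OF this id_mu] show ?thesis .
qed

lemma space_P: "w \<in> space P \<longleftrightarrow> (\<forall>i. w i \<in> Omega)"
  by (simp add: space_PiM space_mu PiE_iff)

lemma AE_good: "AE w in P. \<forall>i. w i \<in> Omega \<and> fst (w i) > 0 \<and> (X = Sph \<longrightarrow> fst (w i) \<le> pi)"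
  unfolding AE_all_countable
proof
  fix i
  have [measurable]: "fst \<in> borel_measurable (\<mu> i)" "(\<lambda>\<omega>. fst \<omega>) \<in> borel_measurable (\<mu> i)"
    using borel_measurable_continuous_onI[OF continuous_on_fst[OF continuous_on_id], THEN measurable_compose[OF id_mu]]
    by simp_all
  have m: "{\<omega> \<in> Omega. fst \<omega> = 0} \<in> sets (\<mu> i)" "{\<omega> \<in> Omega. fst \<omega> > pi} \<in> sets (\<mu> i)"
    unfolding space_mu[of i, symmetric] by measurable
  have "AE \<omega> in \<mu> i. \<omega> \<notin> {\<omega> \<in> Omega. fst \<omega> = 0}"
    using law[of i] m by (intro AE_not_in null_setsI) (simp_all add: polarization_law_def)
  moreover have "AE \<omega> in \<mu> i. X = Sph \<longrightarrow> \<omega> \<notin> {\<omega> \<in> Omega. fst \<omega> > pi}"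
  proof (cases "X = Sph")
    case True
    then have "AE \<omega> in \<mu> i. \<omega> \<notin> {\<omega> \<in> Omega. fst \<omega> > pi}"
      using law[of i] m by (intro AE_not_in null_setsI) (simp_all add: polarization_law_def)
    then show ?thesis by (rule eventually_mono) simp
  qed simp
  moreover have "AE \<omega> in \<mu> i. \<omega> \<in> Omega" using AE_space[of "\<mu> i"] by (simp add: space_mu)
  ultimately have "AE \<omega> in \<mu> i. \<omega> \<in> Omega \<and> fst \<omega> > 0 \<and> (X = Sph \<longrightarrow> fst \<omega> \<le> pi)"
    by eventually_elim (auto simp: Omega_def)
  then show "AE w in P. w i \<in> Omega \<and> fst (w i) > 0 \<and> (X = Sph \<longrightarrow> fst (w i) \<le> pi)"
    by (rule AE_PiM_component[OF prob_mu UNIV_I])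
qed

text \<open>Joint measurability is what the induction needs: the next step evaluates the iterate at
  a reflected point that itself depends on \<open>w\<close>.\<close>

lemma pseq_measurable:
  assumes f: "continuous_on (carr X) f"
  shows "(\<lambda>z. pseq X f (fst z) n (snd z)) \<in> borel_measurable (P \<Otimes>\<^sub>M borel)"
proof (induction n)
  case 0
  have "(\<lambda>x. indicator (carr X) x *\<^sub>R f x) \<in> borel_measurable borel"
    by (rule borel_measurable_continuous_on_indicator[OF carr_borel f])
  moreover have "(\<lambda>x. indicator (carr X) x *\<^sub>R f x) = (\<lambda>x. if x \<in> carr X then f x else 0)"
    by (rule ext) (simp add: indicator_def)
  ultimately have "(\<lambda>x. if x \<in> carr X then f x else 0) \<in> borel_measurable borel" by (simp only:)
  from measurable_compose[OF measurable_snd this] show ?case by simp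
next
  case (Suc n)
  note [measurable] = Suc
  have wn [measurable]: "(\<lambda>z. fst z n) \<in> borel_measurable (P \<Otimes>\<^sub>M (borel :: 'n point measure))"
    by (rule measurable_compose[OF measurable_fst coord_borel])
  have x [measurable]: "(\<lambda>z. snd z) \<in> borel_measurable (P \<Otimes>\<^sub>M (borel :: 'n point measure))"
    by (rule measurable_snd)
  have t [measurable]: "(\<lambda>z. tau X (fst z n) (snd z)) \<in> borel_measurable (P \<Otimes>\<^sub>M (borel :: 'n point measure))"
    by (rule borel_measurable_tau[OF wn x])
  have "(\<lambda>z. (fst z, tau X (fst z n) (snd z))) \<in> measurable (P \<Otimes>\<^sub>M borel) (P \<Otimes>\<^sub>M borel)"
    by (rule measurable_Pair[OF measurable_fst t])
  from measurable_compose[OF this Suc]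
  have [measurable]: "(\<lambda>z. pseq X f (fst z) n (tau X (fst z n) (snd z))) \<in> borel_measurable (P \<Otimes>\<^sub>M borel)"
    by simp
  have c [measurable]: "{z \<in> space (P \<Otimes>\<^sub>M (borel :: 'n point measure)). snd z \<in> carr X} \<in> sets (P \<Otimes>\<^sub>M borel)"
    using measurable_sets[OF x carr_borel[of X]] by (simp add: vimage_def Int_def conj_commute)
  have q [measurable]: "(\<lambda>z. qd X (snd z) orig) \<in> borel_measurable (P \<Otimes>\<^sub>M (borel :: 'n point measure))"
     "(\<lambda>z. qd X (tau X (fst z n) (snd z)) orig) \<in> borel_measurable (P \<Otimes>\<^sub>M (borel :: 'n point measure))"
    by (intro borel_measurable_qd x t borel_measurable_const)+
  have "(\<lambda>z. if snd z \<in> carr X then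
      (if qd X (snd z) orig \<le> qd X (tau X (fst z n) (snd z)) orig
       then max (pseq X f (fst z) n (snd z)) (pseq X f (fst z) n (tau X (fst z n) (snd z)))
       else min (pseq X f (fst z) n (snd z)) (pseq X f (fst z) n (tau X (fst z n) (snd z)))) else 0)
    \<in> borel_measurable (P \<Otimes>\<^sub>M borel)"
    by (intro measurable_If borel_measurable_max borel_measurable_min Suc c borel_measurable_const) measurable
  then show ?case
  proof (rule measurable_cong[THEN iffD1, rotated])
    fix z :: "(nat \<Rightarrow> real \<times> (real^'n)) \<times> 'n point" assume "z \<in> space (P \<Otimes>\<^sub>M borel)"
    then have "fst z n \<in> Omega" by (auto simp: space_pair_measure space_P)
    then show "(if snd z \<in> carr X then
      (if qd X (snd z) orig \<le> qd X (tau X (fst z n) (snd z)) orig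
       then max (pseq X f (fst z) n (snd z)) (pseq X f (fst z) n (tau X (fst z n) (snd z)))
       else min (pseq X f (fst z) n (snd z)) (pseq X f (fst z) n (tau X (fst z n) (snd z)))) else 0)
      = pseq X f (fst z) (Suc n) (snd z)"
      by (simp add: pstep_qd)
  qed
qed

end

section \<open>Hitting probabilities and the expected drop of the moment\<close>

context random_polarizations
begin

definition hit :: "nat \<Rightarrow> real \<Rightarrow> 'n point \<Rightarrow> 'n point \<Rightarrow> ennreal" where
  "hit n \<rho> a b = emeasure (\<mu> n) {\<omega> \<in> Omega. sdist X (tau X \<omega> a) b < \<rho>}"

lemma tau_carr: "\<omega> \<in> Omega \<Longrightarrow> x \<in> carr X \<Longrightarrow> tau X \<omega> x \<in> carr X"
  unfolding tau_def by (intro sig_carr polar_point_Omega)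

lemma hit_set_measurable:
  assumes a: "a \<in> carr X" and b: "b \<in> carr X"
  shows "{\<omega> \<in> Omega. sdist X (tau X \<omega> a) b < \<rho>} \<in> sets (\<mu> n)"
proof -
  have t: "(\<lambda>\<omega>. tau X \<omega> a) \<in> borel_measurable (\<mu> n)"
    by (rule borel_measurable_tau[OF id_mu]) simp
  have "(\<lambda>\<omega>. tau X \<omega> a) -` sball X b \<rho> \<inter> space (\<mu> n) \<in> sets (\<mu> n)"
    by (rule measurable_sets[OF t sball_borel[OF b]])
  moreover have "(\<lambda>\<omega>. tau X \<omega> a) -` sball X b \<rho> \<inter> space (\<mu> n) = {\<omega> \<in> Omega. sdist X (tau X \<omega> a) b < \<rho>}"
    using tau_carr[OF _ a] by (auto simp: space_mu sball_def sdist_commute)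
  ultimately show ?thesis by simp
qed

text \<open>\<open>refl_at\<close> equals \<open>tau\<close> outside the null set of degenerate
  radii. The inequality has the direction that is safe for the event on the left, which is not shown
  to be measurable.\<close>

lemma prob_le_hit:
  assumes a: "a \<in> carr X" and b: "b \<in> carr X"
  shows "emeasure P {w \<in> space P. sdist X (refl_at X (w n) a) b < \<rho>} \<le> hit n \<rho> a b"
proof -
  have m: "(\<lambda>w. w n) \<in> measurable P (\<mu> n)" by (rule measurable_component_singleton) simp
  let ?E = "(\<lambda>w. w n) -` {\<omega> \<in> Omega. sdist X (tau X \<omega> a) b < \<rho>} \<inter> space P"
  have E: "?E \<in> sets P" by (rule measurable_sets[OF m hit_set_measurable[OF a b]])
  have "emeasure P {w \<in> space P. sdist X (refl_at X (w n) a) b < \<rho>} \<le> emeasure P ?E"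
  proof (rule emeasure_mono_AE[OF _ E])
    show "AE w in P. w \<in> {w \<in> space P. sdist X (refl_at X (w n) a) b < \<rho>} \<longrightarrow> w \<in> ?E"
    proof (rule eventually_mono[OF AE_good], intro impI)
      fix w assume good: "\<forall>i. w i \<in> Omega \<and> fst (w i) > 0 \<and> (X = Sph \<longrightarrow> fst (w i) \<le> pi)"
        and w: "w \<in> {w \<in> space P. sdist X (refl_at X (w n) a) b < \<rho>}"
      have "w n \<in> Omega" using good by blast
      then have "norm (snd (w n)) = 1" by (auto simp: Omega_def)
      then have "refl_at X (w n) = restrict (tau X (w n)) (carr X)"
        unfolding tau_def using good by (intro refl_at_eq) auto
      then show "w \<in> ?E" using w good a by simp
    qed
  qed
  also have "\<dots> = emeasure (distr P (\<mu> n) (\<lambda>w. w n)) {\<omega> \<in> Omega. sdist X (tau X \<omega> a) b < \<rho>}"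
    by (rule emeasure_distr[OF m hit_set_measurable[OF a b], symmetric])
  also have "distr P (\<mu> n) (\<lambda>w. w n) = \<mu> n"
    by (rule distr_PiM_component[OF prob_mu UNIV_I])
  finally show ?thesis by (simp add: hit_def)
qed

text \<open>The bound \<open>L\<close> makes every sequence of such pairs bounded, as the hypothesis
  demands; the separation \<open>4 * \<rho>\<close> is the one consumed by
  \<open>moment_polg_decrease\<close>.\<close>

definition far_pairs :: "real \<Rightarrow> real \<Rightarrow> ('n point \<times> 'n point) set" where
  "far_pairs L \<rho> = {z \<in> carr X \<times> carr X. sdist X (fst z) orig \<le> L \<and> sdist X (snd z) orig \<le> L \<and>
     sdist X (snd z) orig \<ge> sdist X (fst z) orig + 4 * \<rho>}"

definition min_hit :: "real \<Rightarrow> real \<Rightarrow> nat \<Rightarrow> ennreal" where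
  "min_hit L \<rho> n = (INF z\<in>far_pairs L \<rho>. hit n \<rho> (fst z) (snd z))"

text \<open>Pairs chosen within \<open>(1/2) ^ Suc n\<close> of the infimum form admissible
  deterministic sequences, and the errors have total 1, so divergence passes to the infima.\<close>

lemma min_hit_sum:
  assumes div: "\<And>(\<rho>::real) (a :: nat \<Rightarrow> 'n point) (b :: nat \<Rightarrow> 'n point).
        \<rho> > 0 \<Longrightarrow> bounded_seq X a \<Longrightarrow> bounded_seq X b \<Longrightarrow>
        (\<And>i. sdist X (b i) orig \<ge> sdist X (a i) orig + 2 * \<rho>) \<Longrightarrow>
        (\<Sum>i. emeasure P {w \<in> space P. sdist X (refl_at X (w i) (a i)) (b i) < \<rho>}) = \<infinity>"
    and \<rho>: "\<rho> > 0" and ne: "far_pairs L \<rho> \<noteq> {}"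
  shows "(\<Sum>n. min_hit L \<rho> n) = \<infinity>"
proof -
  \<comment> \<open>Adding a positive term is strict only below infinity; an infimum over no pairs
    would be infinite.\<close>
  have fin: "min_hit L \<rho> n < \<infinity>" for n
  proof -
    interpret prob_space "\<mu> n" by (rule prob_mu)
    obtain z where z: "z \<in> far_pairs L \<rho>" using ne by blast
    have "min_hit L \<rho> n \<le> hit n \<rho> (fst z) (snd z)" unfolding min_hit_def by (rule INF_lower[OF z])
    also have "\<dots> \<le> 1" unfolding hit_def by (rule emeasure_le_1)
    finally show ?thesis by (rule le_less_trans) simp
  qed
  have "\<exists>z\<in>far_pairs L \<rho>. hit n \<rho> (fst z) (snd z) < min_hit L \<rho> n + ennreal ((1/2) ^ Suc n)" for n
  proof -
    have "min_hit L \<rho> n < min_hit L \<rho> n + ennreal ((1/2) ^ Suc n)"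
      using fin[of n] by (simp add: ennreal_add_left_cancel_less[of _ 0, simplified])
    then show ?thesis unfolding min_hit_def[of L \<rho> n] INF_less_iff by simp
  qed
  then obtain z where z: "\<And>n. z n \<in> far_pairs L \<rho>"
    "\<And>n. hit n \<rho> (fst (z n)) (snd (z n)) < min_hit L \<rho> n + ennreal ((1/2) ^ Suc n)"
    by metis
  let ?a = "\<lambda>n. fst (z n)" and ?b = "\<lambda>n. snd (z n)"
  have zc: "?a n \<in> carr X" "?b n \<in> carr X" "sdist X (?a n) orig \<le> L" "sdist X (?b n) orig \<le> L"
    "sdist X (?b n) orig \<ge> sdist X (?a n) orig + 4 * \<rho>" for n
    using z(1)[of n] by (auto simp: far_pairs_def)
  have "sdist X (?b n) orig \<ge> sdist X (?a n) orig + 2 * \<rho>" for n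
    using zc(5)[of n] \<rho> by linarith
  then have "(\<Sum>i. emeasure P {w \<in> space P. sdist X (refl_at X (w i) (?a i)) (?b i) < \<rho>}) = \<infinity>"
    by (intro div \<rho>) (use zc in \<open>auto simp: bounded_seq_def\<close>)
  moreover have "(\<Sum>i. emeasure P {w \<in> space P. sdist X (refl_at X (w i) (?a i)) (?b i) < \<rho>})
     \<le> (\<Sum>n. min_hit L \<rho> n + ennreal ((1/2) ^ Suc n))"
    by (intro suminf_le summableI order_trans[OF prob_le_hit[OF zc(1,2)] less_imp_le[OF z(2)]])
  moreover have "(\<Sum>n. min_hit L \<rho> n + ennreal ((1/2) ^ Suc n)) = (\<Sum>n. min_hit L \<rho> n) + (\<Sum>n. ennreal ((1/2) ^ Suc n))"
    by (intro suminf_add[symmetric] summableI)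
  moreover have "(\<Sum>n. ennreal ((1/2) ^ Suc n)) = ennreal 1"
    by (rule suminf_ennreal_eq[OF _ power_half_series]) simp
  ultimately have "(\<Sum>n. min_hit L \<rho> n) + ennreal 1 = \<infinity>" by (simp add: top_unique)
  then show ?thesis by (simp add: ennreal_add_eq_top)
qed

text \<open>\<open>D\<close> will be a countable dense set, which makes the event measurable.\<close>

definition bad :: "'n point set \<Rightarrow> real \<Rightarrow> real \<Rightarrow> real \<Rightarrow> ('n point \<Rightarrow> real) \<Rightarrow> nat \<Rightarrow> (nat \<Rightarrow> real \<times> (real^'n)) set" where
  "bad D L \<rho> e f n = {w \<in> space P. \<exists>z\<in>far_pairs L \<rho> \<inter> D \<times> D. pseq X f w n (snd z) \<ge> pseq X f w n (fst z) + e / 4}"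

lemma pseq_point_measurable:
  assumes f: "continuous_on (carr X) f"
  shows "(\<lambda>w. pseq X f w n x) \<in> borel_measurable P"
proof -
  have "(\<lambda>w. (w, x)) \<in> measurable P (P \<Otimes>\<^sub>M borel)" by simp
  from measurable_compose[OF this pseq_measurable[OF f]] show ?thesis by simp
qed

lemma bad_measurable:
  assumes f: "continuous_on (carr X) f" and D: "countable D"
  shows "bad D L \<rho> e f n \<in> sets P"
proof -
  have "bad D L \<rho> e f n = (\<Union>z\<in>far_pairs L \<rho> \<inter> D \<times> D. {w \<in> space P. pseq X f w n (fst z) + e / 4 \<le> pseq X f w n (snd z)})"
    by (auto simp: bad_def)
  also have "\<dots> \<in> sets P"
  proof (rule sets.countable_UN'')
    show "countable (far_pairs L \<rho> \<inter> D \<times> D)" using D by (intro countable_Int2 countable_SIGMA)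
    fix z
    have [measurable]: "(\<lambda>w. pseq X f w n x) \<in> borel_measurable P" for x by (rule pseq_point_measurable[OF f])
    show "{w \<in> space P. pseq X f w n (fst z) + e / 4 \<le> pseq X f w n (snd z)} \<in> sets P" by measurable
  qed
  finally show ?thesis .
qed

lemma moment_measurable:
  assumes f: "continuous_on (carr X) f"
  shows "(\<lambda>w. moment X (pseq X f w n)) \<in> borel_measurable P"
proof -
  interpret V: sigma_finite_measure "vol X :: 'n point measure" by (rule sigma_finite_vol)
  have "continuous_on (carr X) (\<lambda>x :: 'n point. sdist X x orig)"
    by (intro continuous_on_sdist continuous_intros) simp_all
  from borel_measurable_continuous_on_indicator[OF carr_borel this]
  have d: "(\<lambda>x :: 'n point. indicator (carr X) x *\<^sub>R sdist X x orig) \<in> borel_measurable borel" .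
  have s: "sets (P \<Otimes>\<^sub>M (vol X :: 'n point measure)) = sets (P \<Otimes>\<^sub>M (borel :: 'n point measure))"
    by (intro sets_pair_measure_cong refl sets_vol)
  have "(\<lambda>z. ennreal (pseq X f (fst z) n (snd z) * (indicator (carr X) (snd z) *\<^sub>R sdist X (snd z) orig)))
      \<in> borel_measurable (P \<Otimes>\<^sub>M borel)"
    by (intro measurable_compose[OF _ measurable_ennreal] borel_measurable_times pseq_measurable[OF f]
        measurable_compose[OF measurable_snd d])
  moreover have "(\<lambda>z. ennreal (pseq X f (fst z) n (snd z) * (indicator (carr X) (snd z) *\<^sub>R sdist X (snd z) orig)))
     = (\<lambda>(w, x). moment_density X (pseq X f w n) x)"
    by (auto simp: fun_eq_iff moment_density_def indicator_def)
  ultimately have "(\<lambda>(w, x). moment_density X (pseq X f w n) x) \<in> borel_measurable (P \<Otimes>\<^sub>M vol X)"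
    by (simp add: measurable_cong_sets[OF s refl])
  then show ?thesis unfolding moment_def by (rule V.borel_measurable_nn_integral)
qed

text \<open>Independence in the form used here: replacing coordinate \<open>n\<close> by a fresh
  sample of its law does not change the product measure.\<close>

lemma resample:
  fixes F :: "(nat \<Rightarrow> real \<times> (real^'n)) \<Rightarrow> ennreal"
  assumes F: "F \<in> borel_measurable P"
  shows "(\<integral>\<^sup>+w. F w \<partial>P) = (\<integral>\<^sup>+w. \<integral>\<^sup>+\<omega>. F (w(n := \<omega>)) \<partial>\<mu> n \<partial>P)"
    and "w \<in> space P \<Longrightarrow> (\<lambda>\<omega>. F (w(n := \<omega>))) \<in> borel_measurable (\<mu> n)"
    and "(\<lambda>w. \<integral>\<^sup>+\<omega>. F (w(n := \<omega>)) \<partial>\<mu> n) \<in> borel_measurable P"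
proof -
  interpret mn: prob_space "\<mu> n" by (rule prob_mu)
  interpret P: prob_space P by (rule prob_P)
  interpret pp: pair_sigma_finite "\<mu> n" P ..
  have u: "(\<lambda>(x, w). w(n := x)) \<in> measurable (\<mu> n \<Otimes>\<^sub>M P) P"
  proof -
    have "(\<lambda>z. (snd z)(n := fst z)) \<in> measurable (\<mu> n \<Otimes>\<^sub>M P) (PiM (insert n UNIV) \<mu>)"
      by (rule measurable_fun_upd[where J = UNIV]) auto
    then show ?thesis by (simp add: case_prod_beta')
  qed
  have Fm: "(\<lambda>(x, w). F (w(n := x))) \<in> borel_measurable (\<mu> n \<Otimes>\<^sub>M P)"
    using measurable_compose[OF u F] by (simp add: case_prod_beta')
  have "distr (\<mu> n \<Otimes>\<^sub>M P) P (\<lambda>(x, w). w(n := x)) = P"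
    using distr_pair_PiM_eq_PiM[of UNIV \<mu> n] prob_mu by simp
  then have "(\<integral>\<^sup>+w. F w \<partial>P) = (\<integral>\<^sup>+w. F w \<partial>distr (\<mu> n \<Otimes>\<^sub>M P) P (\<lambda>(x, w). w(n := x)))" by simp
  also have "\<dots> = (\<integral>\<^sup>+z. F ((\<lambda>(x, w). w(n := x)) z) \<partial>(\<mu> n \<Otimes>\<^sub>M P))"
    by (rule nn_integral_distr[OF u]) (simp add: F)
  also have "\<dots> = (\<integral>\<^sup>+z. (\<lambda>(x, w). F (w(n := x))) z \<partial>(\<mu> n \<Otimes>\<^sub>M P))"
    by (simp add: case_prod_beta')
  also have "\<dots> = (\<integral>\<^sup>+w. \<integral>\<^sup>+\<omega>. F (w(n := \<omega>)) \<partial>\<mu> n \<partial>P)"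
    using pp.nn_integral_snd[OF Fm] by simp
  finally show "(\<integral>\<^sup>+w. F w \<partial>P) = (\<integral>\<^sup>+w. \<integral>\<^sup>+\<omega>. F (w(n := \<omega>)) \<partial>\<mu> n \<partial>P)" .
  show "(\<lambda>\<omega>. F (w(n := \<omega>))) \<in> borel_measurable (\<mu> n)" if "w \<in> space P"
  proof -
    have "(\<lambda>\<omega>. (\<omega>, w)) \<in> measurable (\<mu> n) (\<mu> n \<Otimes>\<^sub>M P)" using that by simp
    from measurable_compose[OF this Fm] show ?thesis by simp
  qed
  have "(\<lambda>z. (snd z, fst z)) \<in> measurable (P \<Otimes>\<^sub>M \<mu> n) (\<mu> n \<Otimes>\<^sub>M P)" by measurable
  from measurable_compose[OF this Fm]
  have "(\<lambda>(w, \<omega>). F (w(n := \<omega>))) \<in> borel_measurable (P \<Otimes>\<^sub>M \<mu> n)" by (simp add: case_prod_beta')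
  then show "(\<lambda>w. \<integral>\<^sup>+\<omega>. F (w(n := \<omega>)) \<partial>\<mu> n) \<in> borel_measurable P"
    by (rule mn.borel_measurable_nn_integral)
qed

lemma moment_cong: "(\<And>x. x \<in> carr X \<Longrightarrow> f x = g x) \<Longrightarrow> moment X f = moment X g"
  unfolding moment_def moment_density_def
  by (intro nn_integral_cong) (auto simp: indicator_def)

text \<open>For a fixed past in the bad event choose the pair it provides. The fresh reflection hits
  this pair with probability at least \<open>min_hit\<close>, and each hit costs the moment
  \<delta>; a reflection that misses does no harm.\<close>

lemma expected_moment_step:
  assumes f: "radial_support X L f" and e: "e > 0" and \<rho>: "\<rho> > 0" and D: "countable D"
    and m: "\<And>x y. x \<in> carr X \<Longrightarrow> y \<in> carr X \<Longrightarrow> sdist X x y < \<rho> \<Longrightarrow> \<bar>f x - f y\<bar> \<le> e / 16"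
  defines "\<delta> \<equiv> ennreal (e / 16 * \<rho>) * emeasure (vol X) (sball X orig \<rho> :: 'n point set)"
  shows "2 * (\<integral>\<^sup>+w. moment X (pseq X f w (Suc n)) \<partial>P) + \<delta> * min_hit L' \<rho> n * emeasure P (bad D L' \<rho> e f n)
    \<le> 2 * (\<integral>\<^sup>+w. moment X (pseq X f w n) \<partial>P)"
proof -
  note fc = radial_supportD(1)[OF f]
  let ?F = "\<lambda>w. moment X (pseq X f w (Suc n))" and ?B = "bad D L' \<rho> e f n"
  have Fm: "?F \<in> borel_measurable P" by (rule moment_measurable[OF fc])
  have Bm: "?B \<in> sets P" by (rule bad_measurable[OF fc D])
  interpret mn: prob_space "\<mu> n" by (rule prob_mu)
  have "2 * (\<integral>\<^sup>+w. ?F w \<partial>P) + \<delta> * min_hit L' \<rho> n * emeasure P ?B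
      = (\<integral>\<^sup>+w. 2 * (\<integral>\<^sup>+\<omega>. ?F (w(n := \<omega>)) \<partial>\<mu> n) \<partial>P) + (\<integral>\<^sup>+w. \<delta> * min_hit L' \<rho> n * indicator ?B w \<partial>P)"
    unfolding resample(1)[OF Fm, of n]
    by (simp only: nn_integral_cmult[OF resample(3)[OF Fm]] nn_integral_cmult_indicator[OF Bm])
  also have "\<dots> = (\<integral>\<^sup>+w. 2 * (\<integral>\<^sup>+\<omega>. ?F (w(n := \<omega>)) \<partial>\<mu> n) + \<delta> * min_hit L' \<rho> n * indicator ?B w \<partial>P)"
    by (intro nn_integral_add[symmetric] borel_measurable_times_ennreal borel_measurable_const resample(3)[OF Fm] borel_measurable_indicator Bm)
  also have "\<dots> \<le> (\<integral>\<^sup>+w. 2 * moment X (pseq X f w n) \<partial>P)"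
  proof (rule nn_integral_mono)
    fix w assume wP: "w \<in> space P"
    then have w: "\<And>i. w i \<in> Omega" by (simp add: space_P)
    let ?g = "pseq X f w n"
    have g: "radial_support X L ?g" by (rule pseq_radial_support[OF w f])
    have gm: "\<bar>?g x - ?g y\<bar> \<le> e / 16" if "x \<in> carr X" "y \<in> carr X" "sdist X x y < \<rho>" for x y
      using pseq_modulus[OF w f m that] .
    have step: "?F (w(n := \<omega>)) = moment X (polg X (rfl X orig (polar_point X \<omega>)) ?g)" if "\<omega> \<in> Omega" for \<omega>
    proof -
      \<comment> \<open>The iterate \<open>n\<close> depends on the coordinates below
        \<open>n\<close> only, so resampling coordinate \<open>n\<close> leaves it fixed.\<close>
      have "pseq X f (w(n := \<omega>)) n = ?g" by (rule pseq_cong) simp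
      then show ?thesis by (intro moment_cong) (simp add: pstep_def tau_def)
    qed
    have om: "\<omega> \<in> Omega" if "\<omega> \<in> space (\<mu> n)" for \<omega> using that by (simp add: space_mu)
    have wm: "(\<lambda>\<omega>. ?F (w(n := \<omega>))) \<in> borel_measurable (\<mu> n)" by (rule resample(2)[OF Fm wP])
    show "2 * (\<integral>\<^sup>+\<omega>. ?F (w(n := \<omega>)) \<partial>\<mu> n) + \<delta> * min_hit L' \<rho> n * indicator ?B w \<le> 2 * moment X ?g"
    proof (cases "w \<in> ?B")
      case False
      have "(\<integral>\<^sup>+\<omega>. ?F (w(n := \<omega>)) \<partial>\<mu> n) \<le> (\<integral>\<^sup>+\<omega>. moment X ?g \<partial>\<mu> n)"
        by (intro nn_integral_mono) (simp only: step om moment_polg_le[OF polar_point_Omega g])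
      also have "\<dots> = moment X ?g" by (simp add: mn.emeasure_space_1)
      finally show ?thesis using False by (simp add: mult_left_mono)
    next
      case True
      then obtain a b where ab: "(a, b) \<in> far_pairs L' \<rho>" "?g b \<ge> ?g a + e / 4"
        by (auto simp: bad_def)
      then have ac: "a \<in> carr X" "b \<in> carr X" "sdist X b orig \<ge> sdist X a orig + 4 * \<rho>"
        by (auto simp: far_pairs_def)
      let ?H = "{\<omega> \<in> Omega. sdist X (tau X \<omega> a) b < \<rho>}"
      have Hm: "?H \<in> sets (\<mu> n)" by (rule hit_set_measurable[OF ac(1,2)])
      have "\<delta> * min_hit L' \<rho> n \<le> \<delta> * hit n \<rho> a b"
        unfolding min_hit_def by (intro mult_left_mono INF_lower2[OF ab(1)]) simp_all
      then have "2 * (\<integral>\<^sup>+\<omega>. ?F (w(n := \<omega>)) \<partial>\<mu> n) + \<delta> * min_hit L' \<rho> n * indicator ?B w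
         \<le> 2 * (\<integral>\<^sup>+\<omega>. ?F (w(n := \<omega>)) \<partial>\<mu> n) + \<delta> * emeasure (\<mu> n) ?H"
        using True by (simp add: hit_def add_left_mono)
      also have "\<dots> = (\<integral>\<^sup>+\<omega>. 2 * ?F (w(n := \<omega>)) \<partial>\<mu> n) + (\<integral>\<^sup>+\<omega>. \<delta> * indicator ?H \<omega> \<partial>\<mu> n)"
        by (simp only: nn_integral_cmult[OF wm] nn_integral_cmult_indicator[OF Hm])
      also have "\<dots> = (\<integral>\<^sup>+\<omega>. 2 * ?F (w(n := \<omega>)) + \<delta> * indicator ?H \<omega> \<partial>\<mu> n)"
        by (intro nn_integral_add[symmetric] borel_measurable_times_ennreal borel_measurable_const wm borel_measurable_indicator Hm)
      also have "\<dots> \<le> (\<integral>\<^sup>+\<omega>. 2 * moment X ?g \<partial>\<mu> n)"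
      proof (rule nn_integral_mono)
        fix \<omega> assume "\<omega> \<in> space (\<mu> n)"
        then have o: "\<omega> \<in> Omega" by (rule om)
        note p = polar_point_Omega[OF o, of X]
        show "2 * ?F (w(n := \<omega>)) + \<delta> * indicator ?H \<omega> \<le> 2 * moment X ?g"
        proof (cases "\<omega> \<in> ?H")
          case True
          then have near: "sdist X (rfl X orig (polar_point X \<omega>) a) b < \<rho>" by (simp add: tau_def)
          show ?thesis unfolding step[OF o] \<delta>_def
            using moment_polg_decrease[OF p g e \<rho> gm ac(1,2,3) ab(2) near] True by simp
        next
          case False
          then show ?thesis unfolding step[OF o] using moment_polg_le[OF p g] by (simp add: mult_left_mono)
        qed
      qed
      also have "\<dots> = 2 * moment X ?g" by (simp add: mn.emeasure_space_1)
      finally show ?thesis .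
    qed
  qed
  also have "\<dots> = 2 * (\<integral>\<^sup>+w. moment X (pseq X f w n) \<partial>P)"
    by (rule nn_integral_cmult[OF moment_measurable[OF fc]])
  finally show ?thesis .
qed

text \<open>On the event of being bad at all times the expected drops add up to a divergent series
  times its probability, but they are bounded by the finite initial moment. If no far pairs exist,
  nothing is ever bad.\<close>

lemma AE_not_always_bad:
  assumes f: "radial_support X L f" and e: "e > 0" and \<rho>: "\<rho> > 0" and D: "countable D"
    and m: "\<And>x y. x \<in> carr X \<Longrightarrow> y \<in> carr X \<Longrightarrow> sdist X x y < \<rho> \<Longrightarrow> \<bar>f x - f y\<bar> \<le> e / 16"
    and div: "far_pairs L' \<rho> \<noteq> {} \<Longrightarrow> (\<Sum>n. min_hit L' \<rho> n) = \<infinity>"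
  shows "AE w in P. \<exists>n. w \<notin> bad D L' \<rho> e f n"
proof (cases "far_pairs L' \<rho> = {}")
  case True
  then show ?thesis by (simp add: bad_def)
next
  case False
  note fc = radial_supportD(1)[OF f]
  let ?B = "\<Inter>n. bad D L' \<rho> e f n"
  define \<delta> where "\<delta> = ennreal (e / 16 * \<rho>) * emeasure (vol X) (sball X orig \<rho> :: 'n point set)"
  let ?E = "\<lambda>n. \<integral>\<^sup>+w. moment X (pseq X f w n) \<partial>P"
  have Bm: "?B \<in> sets P" by (rule sets.countable_INT') (use bad_measurable[OF fc D] in auto)
  have \<delta>0: "\<delta> > 0"
    unfolding \<delta>_def using emeasure_sball_pos[OF \<rho>, of X, where 'n = 'n] e \<rho>
    by (simp add: ennreal_zero_less_mult_iff)
  have step: "2 * ?E (Suc n) + min_hit L' \<rho> n * (\<delta> * emeasure P ?B) \<le> 2 * ?E n" for n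
  proof -
    have "emeasure P ?B \<le> emeasure P (bad D L' \<rho> e f n)"
      by (intro emeasure_mono bad_measurable[OF fc D]) auto
    then have "2 * ?E (Suc n) + \<delta> * min_hit L' \<rho> n * emeasure P ?B
      \<le> 2 * ?E (Suc n) + \<delta> * min_hit L' \<rho> n * emeasure P (bad D L' \<rho> e f n)"
      by (intro add_left_mono mult_left_mono) simp_all
    also have "\<dots> \<le> 2 * ?E n"
      unfolding \<delta>_def by (rule expected_moment_step[OF f e \<rho> D m])
    finally show ?thesis by (simp add: ac_simps)
  qed
  \<comment> \<open>The remaining moment is kept on the left, which avoids subtraction of extended
    reals.\<close>
  have tot: "2 * ?E N + (\<Sum>n<N. min_hit L' \<rho> n) * (\<delta> * emeasure P ?B) \<le> 2 * ?E 0" for N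
  proof (induction N)
    case (Suc N)
    have "2 * ?E (Suc N) + (\<Sum>n<Suc N. min_hit L' \<rho> n) * (\<delta> * emeasure P ?B)
       = (2 * ?E (Suc N) + min_hit L' \<rho> N * (\<delta> * emeasure P ?B)) + (\<Sum>n<N. min_hit L' \<rho> n) * (\<delta> * emeasure P ?B)"
    proof -
      have "A + (S + q) * c = (A + q * c) + S * c" for A S q c :: ennreal
        unfolding distrib_right by (simp only: add.assoc add.commute[of "q * c" "S * c"])
      then show ?thesis by (simp only: sum.lessThan_Suc)
    qed
    also have "\<dots> \<le> 2 * ?E N + (\<Sum>n<N. min_hit L' \<rho> n) * (\<delta> * emeasure P ?B)"
      by (rule add_right_mono[OF step])
    finally show ?case using Suc by (rule order_trans)
  qed simp
  have le: "(\<Sum>n<N. min_hit L' \<rho> n) * (\<delta> * emeasure P ?B) \<le> 2 * ?E 0" for N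
    by (rule order_trans[OF _ tot[of N]]) simp
  have "(\<Sum>n. min_hit L' \<rho> n) * (\<delta> * emeasure P ?B) = (\<Sum>n. min_hit L' \<rho> n * (\<delta> * emeasure P ?B))"
    by (rule ennreal_suminf_multc[symmetric])
  also have "\<dots> \<le> 2 * ?E 0"
    by (rule suminf_le_const[OF summableI]) (use le in \<open>simp add: sum_distrib_right\<close>)
  also have "?E 0 = moment X f"
  proof -
    have "moment X (pseq X f w 0) = moment X f" for w by (rule moment_cong) simp
    then show ?thesis by (simp add: prob_space.emeasure_space_1[OF prob_P])
  qed
  also have "2 * moment X f < \<infinity>"
    using moment_finite[OF f] by (simp add: ennreal_mult_less_top)
  finally have "\<infinity> * (\<delta> * emeasure P ?B) < \<infinity>" unfolding div[OF False] .
  then have "\<delta> * emeasure P ?B = 0" by (simp add: ennreal_top_mult split: if_splits)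
  then have "emeasure P ?B = 0" using \<delta>0 by auto
  then have "AE w in P. w \<notin> ?B" by (intro AE_not_in null_setsI Bm)
  then show ?thesis by (rule eventually_mono) simp
qed

end

section \<open>Convergence\<close>

lemma dense_sdist:
  assumes D: "carr X \<subseteq> closure D" "D \<subseteq> carr X" and a: "a \<in> carr X" and r: "r > 0"
  obtains y where "y \<in> D" "y \<in> carr X" "sdist X a y < r"
proof -
  have "continuous_on (carr X) (\<lambda>y. sdist X y a)"
    using a by (intro continuous_on_sdist continuous_intros)
  then obtain d where d: "d > 0" "\<And>y. y \<in> carr X \<Longrightarrow> dist y a < d \<Longrightarrow> dist (sdist X y a) (sdist X a a) < r"
    using a r unfolding continuous_on_iff by blast
  have "a \<in> closure D" using D a by blast
  then obtain y where y: "y \<in> D" "dist y a < d" using d(1) unfolding closure_approachable by blast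
  then have "y \<in> carr X" using D by blast
  with d(2)[OF this y(2)] a have "sdist X a y < r" by (simp add: dist_real_def sdist_commute)
  with y \<open>y \<in> carr X\<close> show ?thesis using that by blast
qed

lemma Cc_plus_radial_support:
  assumes "f \<in> Cc_plus X" obtains L where "radial_support X L f"
proof -
  obtain L where "\<And>x. x \<in> carr X \<Longrightarrow> f x \<noteq> 0 \<Longrightarrow> sdist X x orig \<le> L"
    by (rule Cc_plus_bounded_support[OF assms]) blast
  then have "radial_support X L f" using assms by (simp add: radial_support_def Cc_plus_def)
  then show ?thesis by (rule that)
qed

lemma pseq_nonexpansive:
  assumes w: "\<And>i. w i \<in> Omega" and fg: "\<And>x. x \<in> carr X \<Longrightarrow> \<bar>f x - g x\<bar> \<le> e"
  shows "x \<in> carr X \<Longrightarrow> \<bar>pseq X f w n x - pseq X g w n x\<bar> \<le> e"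
proof (induction n arbitrary: x)
  case 0 then show ?case using fg by simp
next
  case (Suc n)
  have "\<bar>polg X (rfl X orig (polar_point X (w n))) (pseq X f w n) x
      - polg X (rfl X orig (polar_point X (w n))) (pseq X g w n) x\<bar> \<le> e"
    by (rule polg_nonexpansive[OF polar_point_Omega[OF w] Suc.IH Suc.prems])
  then show ?case using Suc.prems by (simp add: pstep_def tau_def)
qed

text \<open>The maximum of 0 and finitely many cones of common slope. Lists of heights and apexes
  make the family countable once both are taken from countable sets.\<close>

primrec tent :: "space_form \<Rightarrow> real \<Rightarrow> (real \<times> 'n point) list \<Rightarrow> 'n::finite point \<Rightarrow> real" where
  "tent X k [] x = 0"
| "tent X k (z # l) x = max (fst z - k * sdist X x (snd z)) (tent X k l x)"

lemma tent_le_iff: "tent X k l x \<le> c \<longleftrightarrow> 0 \<le> c \<and> (\<forall>z\<in>set l. fst z - k * sdist X x (snd z) \<le> c)"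
  by (induction l) auto

lemma tent_continuous: "set l \<subseteq> UNIV \<times> carr X \<Longrightarrow> continuous_on (carr X) (tent X k l)"
proof (induction l)
  case (Cons z l)
  have "continuous_on (carr X) (\<lambda>x. max (fst z - k * sdist X x (snd z)) (tent X k l x))"
    using Cons by (intro continuous_intros continuous_on_sdist) auto
  then show ?case by simp
qed simp

text \<open>Rational tents supply a countable set that is uniformly dense from below.\<close>

lemma tent_approximation:
  fixes f :: "'n::finite point \<Rightarrow> real"
  assumes f: "radial_support X L f" and e: "e > 0" and D: "carr X \<subseteq> closure D" "D \<subseteq> carr X"
  obtains k l where "set l \<subseteq> \<rat> \<times> D" "radial_support X L (tent X (real k) l)"
    "\<And>x. x \<in> carr X \<Longrightarrow> tent X (real k) l x \<le> f x" "\<And>x. x \<in> carr X \<Longrightarrow> f x \<le> tent X (real k) l x + 4 * e"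
proof -
  obtain M where M: "M > 0" "\<And>x. x \<in> carr X \<Longrightarrow> f x \<le> M" by (rule radial_support_bounded[OF f]) blast
  obtain r where r: "r > 0" "\<And>x y. x \<in> carr X \<Longrightarrow> y \<in> carr X \<Longrightarrow> sdist X x y < r \<Longrightarrow> \<bar>f x - f y\<bar> \<le> e"
    using uniformly_continuous_of_support[OF radial_supportD(1,3)[OF f] e] by blast
  \<comment> \<open>A slope above \<open>M / r\<close> brings every cone below 0 outside radius
    \<open>r\<close> of its apex.\<close>
  obtain k :: nat where k: "M < real k * r" using reals_Archimedean3[OF r(1)] by blast
  have k0: "real k > 0"
  proof (rule ccontr)
    assume "\<not> real k > 0"
    then have "real k * r = 0" by simp
    with k M show False by simp
  qed
  \<comment> \<open>Within distance \<open>s\<close> of the apex a cone loses at most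
    \<open>e\<close>.\<close>
  define s where "s = min r (e / real k)"
  have s: "s > 0" "s \<le> r" "real k * s \<le> e"
    using r e k0 by (auto simp: s_def min_def field_simps)
  let ?K = "{x \<in> carr X :: 'n point set. sdist X x orig \<le> L}"
  have "\<forall>p\<in>D. \<exists>V. open V \<and> {y \<in> carr X. sdist X y p < s} = carr X \<inter> V"
  proof
    fix p assume "p \<in> D"
    have "continuous_on (carr X) (\<lambda>y. sdist X y p)"
      using \<open>p \<in> D\<close> D by (intro continuous_on_sdist continuous_intros) auto
    from continuous_openin_preimage_gen[OF this, of "{..<s}"]
    have "openin (top_of_set (carr X)) {y \<in> carr X. sdist X y p < s}" by (simp add: Int_def vimage_def)
    then show "\<exists>V. open V \<and> {y \<in> carr X. sdist X y p < s} = carr X \<inter> V"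
      unfolding openin_open by blast
  qed
  from bchoice[OF this] obtain V where
    "\<forall>p\<in>D. open (V p) \<and> {y \<in> carr X. sdist X y p < s} = carr X \<inter> V p" ..
  then have V: "\<And>p. p \<in> D \<Longrightarrow> open (V p)" "\<And>p. p \<in> D \<Longrightarrow> {y \<in> carr X. sdist X y p < s} = carr X \<inter> V p"
    by blast+
  have cover: "?K \<subseteq> (\<Union>p\<in>D. V p)"
  proof
    fix x assume x: "x \<in> ?K"
    then obtain y where "y \<in> D" "sdist X x y < s" using dense_sdist[OF D _ s(1), of x] by blast
    then have "x \<in> V y" using V(2)[of y] x by blast
    then show "x \<in> (\<Union>p\<in>D. V p)" using \<open>y \<in> D\<close> by blast
  qed
  obtain N where N: "N \<subseteq> D" "finite N" "?K \<subseteq> (\<Union>p\<in>N. V p)"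
    by (rule compactE_image[OF compact_cball V(1) cover])
  \<comment> \<open>The height stays \<open>e\<close> below \<open>f p\<close>, which absorbs the
    oscillation of \<open>f\<close> near \<open>p\<close> and keeps the tent under \<open>f\<close>.
    From above, \<open>2 * e\<close> of height, \<open>e\<close> of slope and \<open>e\<close> of
    oscillation make the total error \<open>4 * e\<close>.\<close>
  have "\<exists>q. q \<in> \<rat> \<and> f p - 2 * e < q \<and> q < f p - e" for p
    using Rats_dense_in_real[of "f p - 2 * e" "f p - e"] e by auto
  from choice[OF allI[OF this]] obtain q where
    "\<forall>p. q p \<in> \<rat> \<and> f p - 2 * e < q p \<and> q p < f p - e" ..
  then have q: "\<And>p. q p \<in> \<rat>" "\<And>p. f p - 2 * e < q p" "\<And>p. q p < f p - e" by blast+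
  obtain ps where ps: "set ps = N" using finite_list[OF N(2)] by blast
  define l where "l = map (\<lambda>p. (q p, p)) ps"
  have l: "set l = (\<lambda>p. (q p, p)) ` N" by (simp add: l_def ps)
  have up: "tent X (real k) l x \<le> f x" if x: "x \<in> carr X" for x
    unfolding tent_le_iff
  proof (intro conjI ballI)
    show fx: "0 \<le> f x" by (rule radial_supportD(2)[OF f x])
    fix z assume "z \<in> set l"
    then obtain p where p: "p \<in> N" "z = (q p, p)" using l by blast
    have pc: "p \<in> carr X" using p N D by blast
    have "q p - real k * sdist X x p \<le> f x"
    proof (cases "sdist X x p < r")
      case True
      have "real k * sdist X x p \<ge> 0" using sdist_nonneg[OF x pc] by simp
      moreover have "\<bar>f x - f p\<bar> \<le> e" by (rule r(2)[OF x pc True])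
      ultimately show ?thesis using q(3)[of p] by linarith
    next
      case False
      then have "real k * r \<le> real k * sdist X x p" by (intro mult_left_mono) simp_all
      then show ?thesis using k q(3)[of p] M(2)[OF pc] e fx by linarith
    qed
    then show "fst z - real k * sdist X x (snd z) \<le> f x" by (simp add: p)
  qed
  have low: "f x \<le> tent X (real k) l x + 4 * e" if x: "x \<in> carr X" for x
  proof (cases "x \<in> ?K")
    case True
    then obtain p where p: "p \<in> N" "x \<in> V p" using N(3) by blast
    then have pD: "p \<in> D" "p \<in> carr X" using N D by auto
    have xp: "sdist X x p < s" using V(2)[OF pD(1)] p x by blast
    have "fst (q p, p) - real k * sdist X x (snd (q p, p)) \<le> tent X (real k) l x"
      using tent_le_iff[of X "real k" l x "tent X (real k) l x"] p(1) l by blast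
    then have "q p - real k * sdist X x p \<le> tent X (real k) l x" by simp
    moreover have "real k * sdist X x p \<le> real k * s" using xp by (intro mult_left_mono) simp_all
    moreover have "\<bar>f x - f p\<bar> \<le> e" using r(2)[OF x pD(2)] xp s(2) by simp
    ultimately show ?thesis using q(2)[of p] s(3) by linarith
  next
    case False
    then have "f x = 0" using radial_supportD(3)[OF f x] x by blast
    moreover have "0 \<le> tent X (real k) l x" using tent_le_iff[of X "real k" l x "tent X (real k) l x"] by blast
    ultimately show ?thesis using e by simp
  qed
  have "radial_support X L (tent X (real k) l)"
    unfolding radial_support_def
  proof (intro conjI ballI impI)
    show "continuous_on (carr X) (tent X (real k) l)"
      by (rule tent_continuous) (use l N D in auto)
    fix x :: "'n point" assume x: "x \<in> carr X"
    show nn: "0 \<le> tent X (real k) l x" using tent_le_iff[of X "real k" l x "tent X (real k) l x"] by blast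
    assume "tent X (real k) l x \<noteq> 0"
    then have "f x \<noteq> 0" using up[OF x] nn by linarith
    then show "sdist X x orig \<le> L" by (rule radial_supportD(3)[OF f x])
  qed
  moreover have "set l \<subseteq> \<rat> \<times> D" using l N q by auto
  ultimately show ?thesis using that up low by blast
qed

context random_polarizations
begin

lemma AE_eventually_close:
  fixes f :: "'n point \<Rightarrow> real" and D :: "'n point set"
  assumes div: "\<And>(\<rho>::real) (a :: nat \<Rightarrow> 'n point) (b :: nat \<Rightarrow> 'n point).
        \<rho> > 0 \<Longrightarrow> bounded_seq X a \<Longrightarrow> bounded_seq X b \<Longrightarrow>
        (\<And>i. sdist X (b i) orig \<ge> sdist X (a i) orig + 2 * \<rho>) \<Longrightarrow>
        (\<Sum>i. emeasure P {w \<in> space P. sdist X (refl_at X (w i) (a i)) (b i) < \<rho>}) = \<infinity>"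
    and f: "radial_support X L f" and e: "e > 0"
    and D: "countable D" "carr X \<subseteq> closure D" "D \<subseteq> carr X"
  shows "AE w in P. \<exists>n. \<forall>m\<ge>n. \<forall>x\<in>carr X. \<bar>pseq X f w m x - fun_star X f x\<bar> \<le> e"
proof -
  obtain \<eta> where \<eta>: "\<eta> > 0"
    "\<And>g x. radial_support X L g \<Longrightarrow> (\<And>t. t > 0 \<Longrightarrow> emeasure (vol X) (level X g t) = emeasure (vol X) (level X f t)) \<Longrightarrow>
      x \<in> carr X \<Longrightarrow> \<bar>g x - fun_star X f x\<bar> > e \<Longrightarrow>
      \<exists>a\<in>carr X. \<exists>b\<in>carr X. sdist X b orig \<ge> sdist X a orig + \<eta> \<and> g b \<ge> g a + e / 2"
    by (rule disorder_pair[OF f e]) blast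
  have "e / 16 > 0" using e by simp
  then obtain r where r: "r > 0" "\<And>x y. x \<in> carr X \<Longrightarrow> y \<in> carr X \<Longrightarrow> sdist X x y < r \<Longrightarrow> \<bar>f x - f y\<bar> \<le> e / 16"
    using uniformly_continuous_of_support[OF radial_supportD(1,3)[OF f]] by blast
  \<comment> \<open>Of the separation \<open>7 * \<rho>\<close>, moving the two points into
    \<open>D\<close> costs \<open>2 * \<rho>\<close>, and more than the required
    \<open>4 * \<rho>\<close> remains. The values lose \<open>2 * (e / 16)\<close> of
    \<open>e / 2\<close>, which leaves more than \<open>e / 4\<close>.\<close>
  define \<rho> where "\<rho> = min r \<eta> / 7"
  have \<rho>: "\<rho> > 0" "7 * \<rho> \<le> \<eta>" "\<rho> \<le> r" using r \<eta> by (auto simp: \<rho>_def)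
  have m: "\<bar>f x - f y\<bar> \<le> e / 16" if "x \<in> carr X" "y \<in> carr X" "sdist X x y < \<rho>" for x y
    using r(2)[OF that(1,2)] that(3) \<rho>(3) by simp
  \<comment> \<open>The point \<open>b\<close> has a positive value and so lies within radius
    \<open>L\<close>; its substitute from \<open>D\<close> may lie \<rho> farther out.\<close>
  let ?L = "L + \<rho>"
  have nb: "AE w in P. \<exists>n. w \<notin> bad D ?L \<rho> e f n"
    by (rule AE_not_always_bad[OF f e \<rho>(1) D(1) m min_hit_sum[OF div \<rho>(1)]])
  show ?thesis
    using nb AE_space
  proof (rule eventually_elim2)
    fix w assume "\<exists>n. w \<notin> bad D ?L \<rho> e f n" and wP: "w \<in> space P"
    then obtain n where n: "w \<notin> bad D ?L \<rho> e f n" by blast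
    have w: "w i \<in> Omega" for i using wP by (simp add: space_P)
    let ?g = "pseq X f w n"
    have g: "radial_support X L ?g" by (rule pseq_radial_support[OF w f])
    have close: "\<bar>?g x - fun_star X f x\<bar> \<le> e" if x: "x \<in> carr X" for x
    proof (rule ccontr)
      assume "\<not> ?thesis"
      then have "\<bar>?g x - fun_star X f x\<bar> > e" by simp
      from \<eta>(2)[OF g pseq_level[OF w f] x this]
      obtain a b where ab: "a \<in> carr X" "b \<in> carr X" "sdist X b orig \<ge> sdist X a orig + \<eta>" "?g b \<ge> ?g a + e / 2"
        by blast
      have gm: "\<bar>?g x - ?g y\<bar> \<le> e / 16" if "x \<in> carr X" "y \<in> carr X" "sdist X x y < \<rho>" for x y
        using pseq_modulus[OF w f m that] .
      obtain a' where a': "a' \<in> D" "a' \<in> carr X" "sdist X a a' < \<rho>" by (rule dense_sdist[OF D(2,3) ab(1) \<rho>(1)])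
      obtain b' where b': "b' \<in> D" "b' \<in> carr X" "sdist X b b' < \<rho>" by (rule dense_sdist[OF D(2,3) ab(2) \<rho>(1)])
      have "?g a \<ge> 0" by (rule radial_supportD(2)[OF g ab(1)])
      then have "?g b \<noteq> 0" using ab(4) e by linarith
      then have bL: "sdist X b orig \<le> L" by (rule radial_supportD(3)[OF g ab(2)])
      have 1: "sdist X a' orig \<le> sdist X a orig + \<rho>"
        using sdist_triangle[OF a'(2) ab(1) orig_carr] a'(3) sdist_commute[of X a a'] by linarith
      have 2: "sdist X b orig \<le> sdist X b' orig + \<rho>"
        using sdist_triangle[OF ab(2) b'(2) orig_carr] b'(3) by linarith
      have 3: "sdist X b' orig \<le> sdist X b orig + \<rho>"
        using sdist_triangle[OF b'(2) ab(2) orig_carr] b'(3) sdist_commute[of X b b'] by linarith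
      have A: "sdist X a' orig \<le> ?L" "sdist X b' orig \<le> ?L" "sdist X b' orig \<ge> sdist X a' orig + 4 * \<rho>"
        using 1 2 3 bL ab(3) \<rho> \<eta>(1) by linarith+
      have "\<bar>?g a - ?g a'\<bar> \<le> e / 16" "\<bar>?g b - ?g b'\<bar> \<le> e / 16"
        using gm[OF ab(1) a'(2,3)] gm[OF ab(2) b'(2,3)] by auto
      then have B: "?g b' \<ge> ?g a' + e / 4" using ab(4) e by linarith
      have "(a', b') \<in> far_pairs ?L \<rho> \<inter> D \<times> D" using A a' b' by (simp add: far_pairs_def)
      then have "w \<in> bad D ?L \<rho> e f n" unfolding bad_def using wP B by force
      with n show False ..
    qed
    show "\<exists>n. \<forall>m\<ge>n. \<forall>x\<in>carr X. \<bar>pseq X f w m x - fun_star X f x\<bar> \<le> e"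
      by (intro exI[of _ n] allI impI ballI pseq_close_mono[OF w f close])
  qed
qed

lemma AE_convergence:
  assumes div: "\<And>(\<rho>::real) (a :: nat \<Rightarrow> 'n point) (b :: nat \<Rightarrow> 'n point).
        \<rho> > 0 \<Longrightarrow> bounded_seq X a \<Longrightarrow> bounded_seq X b \<Longrightarrow>
        (\<And>i. sdist X (b i) orig \<ge> sdist X (a i) orig + 2 * \<rho>) \<Longrightarrow>
        (\<Sum>i. emeasure P {w \<in> space P. sdist X (refl_at X (w i) (a i)) (b i) < \<rho>}) = \<infinity>"
  shows "AE w in P. \<forall>f\<in>Cc_plus X.
           (\<lambda>n. sup_norm X (\<lambda>x. polarize_seq X w n f x - fun_star X f x)) \<longlonglongrightarrow> 0"
proof -
  obtain D :: "'n point set" where D: "countable D" "D \<subseteq> carr X" "carr X \<subseteq> closure D"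
    using separable[of "carr X :: 'n point set"] by blast
  define T where "T = (\<lambda>(k, l). tent X (real k) l) ` (UNIV \<times> lists (\<rat> \<times> D))"
  \<comment> \<open>Slope 0 is among the parameters, so some tents have unbounded support in the
    noncompact models; these are discarded.\<close>
  define F where "F = {f \<in> T. \<exists>L. radial_support X L f}"
  have "countable T" unfolding T_def
    by (intro countable_image countable_SIGMA countable_lists countable_rat D) simp
  then have F: "countable F" unfolding F_def by (rule countable_subset[rotated]) auto
  have "AE w in P. \<forall>z\<in>F \<times> (UNIV :: nat set). \<exists>n. \<forall>m\<ge>n. \<forall>x\<in>carr X.
      \<bar>pseq X (fst z) w m x - fun_star X (fst z) x\<bar> \<le> 1 / real (Suc (snd z))"
  proof (subst AE_ball_countable)
    show "countable (F \<times> (UNIV :: nat set))" using F by simp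
    show "\<forall>z\<in>F \<times> (UNIV :: nat set). AE w in P. \<exists>n. \<forall>m\<ge>n. \<forall>x\<in>carr X.
      \<bar>pseq X (fst z) w m x - fun_star X (fst z) x\<bar> \<le> 1 / real (Suc (snd z))"
    proof
      fix z assume "z \<in> F \<times> (UNIV :: nat set)"
      then obtain L where z: "radial_support X L (fst z)" by (auto simp: F_def)
      show "AE w in P. \<exists>n. \<forall>m\<ge>n. \<forall>x\<in>carr X.
        \<bar>pseq X (fst z) w m x - fun_star X (fst z) x\<bar> \<le> 1 / real (Suc (snd z))"
        by (rule AE_eventually_close[OF div z _ D(1,3,2)]) simp_all
    qed
  qed
  then show ?thesis using AE_good
  proof (rule eventually_elim2, intro ballI)
    fix w and f :: "'n point \<Rightarrow> real"
    assume conv: "\<forall>z\<in>F \<times> (UNIV :: nat set). \<exists>n. \<forall>m\<ge>n. \<forall>x\<in>carr X.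
        \<bar>pseq X (fst z) w m x - fun_star X (fst z) x\<bar> \<le> 1 / real (Suc (snd z))"
      and good: "\<forall>i. w i \<in> Omega \<and> fst (w i) > 0 \<and> (X = Sph \<longrightarrow> fst (w i) \<le> pi)"
      and "f \<in> Cc_plus X"
    then obtain L where f: "radial_support X L f" by (elim Cc_plus_radial_support)
    have w: "w i \<in> Omega" for i using good by blast
    have goodi: "w i \<in> Omega \<and> fst (w i) > 0 \<and> (X = Sph \<longrightarrow> fst (w i) \<le> pi)" for i using good by blast
    show "(\<lambda>n. sup_norm X (\<lambda>x. polarize_seq X w n f x - fun_star X f x)) \<longlonglongrightarrow> 0"
    proof (rule LIMSEQ_I)
      fix \<epsilon> :: real assume \<epsilon>: "\<epsilon> > 0"
      \<comment> \<open>Approximating \<open>f\<close> and its rearrangement costs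
        \<open>4 * e\<close> each and convergence for the tent costs \<open>e\<close>. The total is
        below \<open>10 * e\<close>, half of \<epsilon>, so the inequality remains strict for the
        supremum.\<close>
      define e where "e = \<epsilon> / 20"
      have e: "e > 0" using \<epsilon> by (simp add: e_def)
      obtain k l where kl: "set l \<subseteq> \<rat> \<times> D" "radial_support X L (tent X (real k) l)"
        "\<And>x. x \<in> carr X \<Longrightarrow> tent X (real k) l x \<le> f x" "\<And>x. x \<in> carr X \<Longrightarrow> f x \<le> tent X (real k) l x + 4 * e"
        by (rule tent_approximation[OF f e D(3,2)]) blast
      let ?t = "tent X (real k) l"
      have tF: "?t \<in> F" unfolding F_def T_def using kl(1,2) by (auto intro!: image_eqI[of _ _ "(k, l)"])
      obtain j where j: "inverse (real (Suc j)) < e" using reals_Archimedean[OF e] by blast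
      have "(?t, j) \<in> F \<times> UNIV" using tF by simp
      from conv[rule_format, OF this] obtain n where
        n: "\<And>m x. m \<ge> n \<Longrightarrow> x \<in> carr X \<Longrightarrow> \<bar>pseq X ?t w m x - fun_star X ?t x\<bar> \<le> 1 / real (Suc j)"
        by auto
      have tf: "\<bar>?t x - f x\<bar> \<le> 4 * e" if "x \<in> carr X" for x using kl(3,4)[OF that] e by linarith
      have bound: "\<bar>polarize_seq X w m f x - fun_star X f x\<bar> \<le> 10 * e" if m: "m \<ge> n" and x: "x \<in> carr X" for m x
      proof -
        have "polarize_seq X w m f x = pseq X f w m x" by (rule polarize_seq_pseq[OF goodi x])
        moreover have "\<bar>pseq X ?t w m x - pseq X f w m x\<bar> \<le> 4 * e"
          by (rule pseq_nonexpansive[OF w tf x])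
        moreover have "\<bar>pseq X ?t w m x - fun_star X ?t x\<bar> \<le> e"
          using n[OF m x] j by (simp add: inverse_eq_divide)
        moreover have "fun_star X ?t x \<le> fun_star X f x + 0"
          by (rule fun_star_le_add[OF kl(2) f]) (use kl(3) in simp_all)
        moreover have "fun_star X f x \<le> fun_star X ?t x + 4 * e"
          by (rule fun_star_le_add[OF f kl(2)]) (use kl(4) e in simp_all)
        ultimately show ?thesis using e by linarith
      qed
      show "\<exists>n. \<forall>m\<ge>n. norm (sup_norm X (\<lambda>x. polarize_seq X w m f x - fun_star X f x) - 0) < \<epsilon>"
      proof (intro exI[of _ n] allI impI)
        fix m assume m: "m \<ge> n"
        let ?h = "\<lambda>x. \<bar>polarize_seq X w m f x - fun_star X f x\<bar>"
        have "bdd_above (?h ` carr X)" by (rule bdd_aboveI2) (rule bound[OF m])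
        then have "?h orig \<le> (SUP x\<in>carr X. ?h x)" by (intro cSUP_upper orig_carr)
        moreover have "(SUP x\<in>carr X. ?h x) \<le> 10 * e"
          by (rule cSUP_least[OF _ bound[OF m]]) (use orig_carr in blast)
        moreover have "?h orig \<ge> 0" by simp
        ultimately show "norm (sup_norm X (\<lambda>x. polarize_seq X w m f x - fun_star X f x) - 0) < \<epsilon>"
          using e unfolding sup_norm_def by (simp add: e_def)
      qed
    qed
  qed
qed

end

theorem theorem2p1:
  fixes X :: space_form
    and \<mu> :: "nat \<Rightarrow> (real \<times> (real^'n::finite)) measure"
    and P :: "(nat \<Rightarrow> real \<times> (real^'n)) measure"
  assumes law: "\<And>i. polarization_law X (\<mu> i)"
    and P: "P = PiM UNIV \<mu>"
    and div: "\<And>(\<rho>::real) (a :: nat \<Rightarrow> 'n point) (b :: nat \<Rightarrow> 'n point).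
        \<rho> > 0 \<Longrightarrow> bounded_seq X a \<Longrightarrow> bounded_seq X b \<Longrightarrow>
        (\<And>i. sdist X (b i) orig \<ge> sdist X (a i) orig + 2 * \<rho>) \<Longrightarrow>
        (\<Sum>i. emeasure P {w \<in> space P. sdist X (refl_at X (w i) (a i)) (b i) < \<rho>}) = \<infinity>"
  shows "AE w in P. \<forall>f\<in>Cc_plus X.
           (\<lambda>n. sup_norm X (\<lambda>x. polarize_seq X w n f x - fun_star X f x)) \<longlonglongrightarrow> 0"
proof -
  interpret random_polarizations X \<mu> by unfold_locales (rule law)
  show ?thesis unfolding P by (rule AE_convergence[OF div[unfolded P]])
qed

end
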